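(* Let $h>1$ and $m>1$ be integers and let $\{\beta_{i,j}:0\leq i\leq h,\ 1\leq j\leq m\}\subseteq\mathcal U$ be a set of independent differential transcendentals. Consider the system of $m-1$ linear differential equations in the variables $(z_1,\ldots,z_m)$: $\sum_{i=0}^h\beta_{i,1}z_1^{(i)}=\sum_{i=0}^h\beta_{i,j}z_j^{(i)}$ for $j=2,\ldots,m$. Then the solution set of this system in $\mathcal U^m$ has no proper infinite rank subspaces.
   Context: $\mathcal U$ is a saturated differentially closed field of characteristic zero with one derivation. A subspace here means a (Kolchin-closed) differential subvariety of the solution set; infinite rank means infinite Lascar rank, equivalently nonconstant Kolchin polynomial of a generic point. *)

theory Defs
  imports
    "HOL-Library.Poly_Mapping"
    "HOL-Library.Equipollence"
    "HOL-Library.Extended_Nat"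
    "HOL-Library.FuncSet"
    "HOL-Computational_Algebra.Polynomial"
begin

section \<open>Multivariate polynomials\<close>

text \<open>Polynomials in the indeterminates \<open>'v\<close>: finitely supported maps from monomials
  (finitely supported exponent maps) to coefficients.\<close>

type_synonym ('v, 'a) mpol = "('v \<Rightarrow>\<^sub>0 nat) \<Rightarrow>\<^sub>0 'a"

definition pvars :: "('v, 'a::zero) mpol \<Rightarrow> 'v set" where
  "pvars f = (\<Union>\<mu>\<in>Poly_Mapping.keys f. Poly_Mapping.keys \<mu>)"

definition pcoeffs :: "('v, 'a::zero) mpol \<Rightarrow> 'a set" where
  "pcoeffs f = Poly_Mapping.lookup f ` Poly_Mapping.keys f"

definition peval :: "('v, 'a::comm_semiring_1) mpol \<Rightarrow> ('v \<Rightarrow> 'a) \<Rightarrow> 'a" where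
  "peval f x = (\<Sum>\<mu>\<in>Poly_Mapping.keys f.
      Poly_Mapping.lookup f \<mu> * (\<Prod>v\<in>Poly_Mapping.keys \<mu>. x v ^ Poly_Mapping.lookup \<mu> v))"


section \<open>Subfields, algebraic independence, transcendence degree\<close>

definition is_subfield :: "'a::field set \<Rightarrow> bool" where
  "is_subfield k \<longleftrightarrow> 0 \<in> k \<and> 1 \<in> k \<and>
     (\<forall>x\<in>k. \<forall>y\<in>k. x + y \<in> k \<and> x * y \<in> k) \<and> (\<forall>x\<in>k. - x \<in> k \<and> inverse x \<in> k)"

definition field_adjoin :: "'a::field set \<Rightarrow> 'a set \<Rightarrow> 'a set" where
  "field_adjoin k S = \<Inter> {L. is_subfield L \<and> k \<subseteq> L \<and> S \<subseteq> L}"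

definition alg_independent_family :: "'a::field set \<Rightarrow> 'v set \<Rightarrow> ('v \<Rightarrow> 'a) \<Rightarrow> bool" where
  "alg_independent_family k I x \<longleftrightarrow>
     (\<forall>f :: ('v, 'a) mpol. pvars f \<subseteq> I \<and> pcoeffs f \<subseteq> k \<and> f \<noteq> 0 \<longrightarrow> peval f x \<noteq> 0)"

definition trdeg :: "'a::field set \<Rightarrow> 'a set \<Rightarrow> enat" where
  "trdeg k L = (SUP B\<in>{B. B \<subseteq> L \<and> finite B \<and> alg_independent_family k B (\<lambda>b. b)}. enat (card B))"


section \<open>Differential fields and differential polynomials\<close>

definition derivation :: "('a::field \<Rightarrow> 'a) \<Rightarrow> bool" where
  "derivation \<delta> \<longleftrightarrow> (\<forall>x y. \<delta> (x + y) = \<delta> x + \<delta> y \<and> \<delta> (x * y) = \<delta> x * y + x * \<delta> y)"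

definition differential_subfield :: "('a::field \<Rightarrow> 'a) \<Rightarrow> 'a set \<Rightarrow> bool" where
  "differential_subfield \<delta> k \<longleftrightarrow> is_subfield k \<and> (\<forall>x\<in>k. \<delta> x \<in> k)"

text \<open>A differential polynomial in the variables \<open>'v\<close> is a polynomial in the indeterminates
  \<open>(v, i)\<close>, where \<open>(v, i)\<close> stands for the \<open>i\<close>-th derivative of \<open>v\<close>.\<close>

type_synonym ('v, 'a) dpol = "('v \<times> nat, 'a) mpol"

definition jet :: "('a \<Rightarrow> 'a) \<Rightarrow> ('v \<Rightarrow> 'a) \<Rightarrow> 'v \<times> nat \<Rightarrow> 'a" where
  "jet \<delta> z = (\<lambda>(v, i). (\<delta> ^^ i) (z v))"

definition dpeval :: "('a::field \<Rightarrow> 'a) \<Rightarrow> ('v, 'a) dpol \<Rightarrow> ('v \<Rightarrow> 'a) \<Rightarrow> 'a" where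
  "dpeval \<delta> f z = peval f (jet \<delta> z)"

text \<open>The order of an element of the ground field is \<open>-1\<close>.\<close>

definition dorder :: "('v, 'a::zero) dpol \<Rightarrow> int" where
  "dorder f = Max (insert (- 1) ((\<lambda>(v, i). int i) ` pvars f))"

text \<open>Blum's axioms. With the above convention on orders, the case where \<open>f\<close> has order \<open>0\<close> and
  \<open>g = 1\<close> says that the field is algebraically closed.\<close>

definition differentially_closed :: "('a::field \<Rightarrow> 'a) \<Rightarrow> bool" where
  "differentially_closed \<delta> \<longleftrightarrow>
     (\<forall>(f :: (unit, 'a) dpol) (g :: (unit, 'a) dpol). g \<noteq> 0 \<and> dorder g < dorder f \<longrightarrow>
        (\<exists>x. dpeval \<delta> f (\<lambda>_. x) = 0 \<and> dpeval \<delta> g (\<lambda>_. x) \<noteq> 0))"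

text \<open>Algebraic independence, over the prime field, of all derivatives of all members of the
  family.\<close>

definition independent_differential_transcendentals ::
    "('a::field_char_0 \<Rightarrow> 'a) \<Rightarrow> 'v set \<Rightarrow> ('v \<Rightarrow> 'a) \<Rightarrow> bool" where
  "independent_differential_transcendentals \<delta> I b \<longleftrightarrow>
     alg_independent_family \<rat> (I \<times> UNIV) (jet \<delta> b)"


section \<open>Saturation in the language of differential rings\<close>

datatype (tm_params: 'a) tm =
    TVar nat
  | TParam 'a
  | TZero
  | TOne
  | TAdd "'a tm" "'a tm"
  | TMinus "'a tm"
  | TMult "'a tm" "'a tm"
  | TDer "'a tm"

datatype (fm_params: 'a) fm =
    FEq "'a tm" "'a tm"
  | FNot "'a fm"
  | FAnd "'a fm" "'a fm"
  | FEx nat "'a fm"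

primrec tm_vars :: "'a tm \<Rightarrow> nat set" where
  "tm_vars (TVar n) = {n}"
| "tm_vars (TParam a) = {}"
| "tm_vars TZero = {}"
| "tm_vars TOne = {}"
| "tm_vars (TAdd s t) = tm_vars s \<union> tm_vars t"
| "tm_vars (TMinus t) = tm_vars t"
| "tm_vars (TMult s t) = tm_vars s \<union> tm_vars t"
| "tm_vars (TDer t) = tm_vars t"

primrec fm_free_vars :: "'a fm \<Rightarrow> nat set" where
  "fm_free_vars (FEq s t) = tm_vars s \<union> tm_vars t"
| "fm_free_vars (FNot \<phi>) = fm_free_vars \<phi>"
| "fm_free_vars (FAnd \<phi> \<psi>) = fm_free_vars \<phi> \<union> fm_free_vars \<psi>"
| "fm_free_vars (FEx n \<phi>) = fm_free_vars \<phi> - {n}"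

primrec tm_val :: "('a::field \<Rightarrow> 'a) \<Rightarrow> (nat \<Rightarrow> 'a) \<Rightarrow> 'a tm \<Rightarrow> 'a" where
  "tm_val \<delta> e (TVar n) = e n"
| "tm_val \<delta> e (TParam a) = a"
| "tm_val \<delta> e TZero = 0"
| "tm_val \<delta> e TOne = 1"
| "tm_val \<delta> e (TAdd s t) = tm_val \<delta> e s + tm_val \<delta> e t"
| "tm_val \<delta> e (TMinus t) = - tm_val \<delta> e t"
| "tm_val \<delta> e (TMult s t) = tm_val \<delta> e s * tm_val \<delta> e t"
| "tm_val \<delta> e (TDer t) = \<delta> (tm_val \<delta> e t)"

primrec fm_sat :: "('a::field \<Rightarrow> 'a) \<Rightarrow> (nat \<Rightarrow> 'a) \<Rightarrow> 'a fm \<Rightarrow> bool" where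
  "fm_sat \<delta> e (FEq s t) \<longleftrightarrow> tm_val \<delta> e s = tm_val \<delta> e t"
| "fm_sat \<delta> e (FNot \<phi>) \<longleftrightarrow> \<not> fm_sat \<delta> e \<phi>"
| "fm_sat \<delta> e (FAnd \<phi> \<psi>) \<longleftrightarrow> fm_sat \<delta> e \<phi> \<and> fm_sat \<delta> e \<psi>"
| "fm_sat \<delta> e (FEx n \<phi>) \<longleftrightarrow> (\<exists>x. fm_sat \<delta> (e(n := x)) \<phi>)"

text \<open>Every finitely satisfiable set of formulas in the single free variable \<open>0\<close>, with parameters
  from a set of cardinality smaller than that of the field, is realized.\<close>

definition saturated :: "('a::field \<Rightarrow> 'a) \<Rightarrow> bool" where
  "saturated \<delta> \<longleftrightarrow>
     (\<forall>(A :: 'a set) \<Phi>. A \<prec> (UNIV :: 'a set) \<and>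
        (\<forall>\<phi>\<in>\<Phi>. fm_params \<phi> \<subseteq> A \<and> fm_free_vars \<phi> \<subseteq> {0}) \<and>
        (\<forall>\<Phi>'. finite \<Phi>' \<and> \<Phi>' \<subseteq> \<Phi> \<longrightarrow> (\<exists>x. \<forall>\<phi>\<in>\<Phi>'. fm_sat \<delta> (\<lambda>_. x) \<phi>)) \<longrightarrow>
        (\<exists>x. \<forall>\<phi>\<in>\<Phi>. fm_sat \<delta> (\<lambda>_. x) \<phi>))"


section \<open>Kolchin-closed sets and infinite rank\<close>

definition affine_space :: "nat \<Rightarrow> (nat \<Rightarrow> 'a) set" where
  "affine_space m = {1..m} \<rightarrow>\<^sub>E UNIV"

definition kolchin_closed_over ::
    "('a::field \<Rightarrow> 'a) \<Rightarrow> nat \<Rightarrow> 'a set \<Rightarrow> (nat \<Rightarrow> 'a) set \<Rightarrow> bool" where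
  "kolchin_closed_over \<delta> m k W \<longleftrightarrow>
     (\<exists>S :: (nat, 'a) dpol set.
        (\<forall>f\<in>S. pvars f \<subseteq> {1..m} \<times> UNIV \<and> pcoeffs f \<subseteq> k) \<and>
        W = {z \<in> affine_space m. \<forall>f\<in>S. dpeval \<delta> f z = 0})"

definition is_kolchin_polynomial ::
    "('a::field \<Rightarrow> 'a) \<Rightarrow> nat \<Rightarrow> 'a set \<Rightarrow> (nat \<Rightarrow> 'a) \<Rightarrow> rat poly \<Rightarrow> bool" where
  "is_kolchin_polynomial \<delta> m k a p \<longleftrightarrow>
     (\<forall>\<^sub>F t in sequentially. \<exists>d. trdeg k (field_adjoin k (jet \<delta> a ` ({1..m} \<times> {0..t}))) = enat d \<and>
        poly p (of_nat t) = of_nat d)"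

text \<open>Here \<open>k\<close> is a differential field over which \<open>W\<close> is defined. Each point of \<open>W\<close> is a generic
  point over \<open>k\<close> of its own locus, a closed subset of \<open>W\<close>, and specialization does not increase
  Kolchin polynomials. So for irreducible \<open>W\<close> the condition says that a generic point of \<open>W\<close> over
  \<open>k\<close> has nonconstant Kolchin polynomial, and in general that a generic point of some irreducible
  component has.\<close>

definition has_infinite_rank ::
    "('a::field \<Rightarrow> 'a) \<Rightarrow> nat \<Rightarrow> 'a set \<Rightarrow> (nat \<Rightarrow> 'a) set \<Rightarrow> bool" where
  "has_infinite_rank \<delta> m k W \<longleftrightarrow>
     (\<exists>a\<in>W. \<exists>p. is_kolchin_polynomial \<delta> m k a p \<and> 0 < degree p)"

end

theory Submission
  imports Defs
begin

text \<open>
  Let \<open>a\<close> be a solution and \<open>w\<close> the common value of the \<open>m\<close> operators at \<open>a\<close>. If \<open>w\<close> is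
  differentially algebraic over \<open>k\<close>, then so is \<open>a\<close>, and its Kolchin polynomial is constant.
  Otherwise \<open>a\<close> satisfies no differential equation over \<open>k\<close> beyond those of the system: each
  solution \<open>u\<close> of the adjoint of the \<open>j\<close>-th operator gives a combination of the jets of \<open>z\<^sub>j\<close> with
  derivative \<open>u * w\<close>. By duality these combinations, for a basis of adjoint solutions, and the jets
  of \<open>w\<close> are linear coordinates for the jets of all solutions of the system. By Ostrowski's theorem an
  algebraic relation between the coordinates at \<open>a\<close> would produce adjoint solutions \<open>u\<^sub>1, \<dots>, u\<^sub>m\<close>,
  not all zero, with sum \<open>u\<close> such that \<open>u * w\<close> has a primitive rational in the jets of \<open>w\<close>. This
  forces \<open>u = 0\<close>, which the genericity of the coefficients excludes by counting transcendence degrees.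
\<close>

section \<open>Subfields\<close>

text \<open>The equations of a closed subset and the Kolchin polynomial refer to \<open>k\<close>,
  but the adjoint solutions and the constants in Ostrowski's theorem need not lie in
  \<open>k\<close>. Independence is therefore proved over \<open>dalg k\<close>, which contains
  \<open>k\<close>, all constants and all adjoint solutions; the jets of an element outside
  \<open>dalg k\<close> are independent over all of \<open>dalg k\<close>. The jets of the unknowns
  cannot be fed to Ostrowski's theorem directly, since their derivatives involve further jets; the
  derivatives of the adjoint combinations lie in the field generated by \<open>dalg k\<close> and
  the jets of \<open>w\<close>. Blum's axioms supply as many adjoint solutions as the order of the
  operator, which makes the passage from jets to these combinations invertible. The final count is
  tight: an operator of order \<open>h\<close> has \<open>h + 1\<close> coefficients, and they are
  rational in \<open>h + 1\<close> differential generators, namely \<open>u\<^sub>j\<close> and its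
  \<open>h\<close> values of \<open>adj\<close>. Only the single relation between the
  \<open>u\<^sub>j\<close> breaks the balance.\<close>

lemma subfield_closed:
  assumes "is_subfield k"
  shows subfield_0: "0 \<in> k" and subfield_1: "1 \<in> k"
    and subfield_add: "\<And>x y. x \<in> k \<Longrightarrow> y \<in> k \<Longrightarrow> x + y \<in> k"
    and subfield_mult: "\<And>x y. x \<in> k \<Longrightarrow> y \<in> k \<Longrightarrow> x * y \<in> k"
    and subfield_uminus: "\<And>x. x \<in> k \<Longrightarrow> - x \<in> k"
    and subfield_inverse: "\<And>x. x \<in> k \<Longrightarrow> inverse x \<in> k"
  using assms unfolding is_subfield_def by blast+

lemma subfield_diff: "is_subfield k \<Longrightarrow> x \<in> k \<Longrightarrow> y \<in> k \<Longrightarrow> x - y \<in> k"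
  using subfield_add[of k x "- y"] subfield_uminus[of k y] by simp

lemma subfield_divide: "is_subfield k \<Longrightarrow> x \<in> k \<Longrightarrow> y \<in> k \<Longrightarrow> x / y \<in> k"
  by (simp add: divide_inverse subfield_mult subfield_inverse)

lemma subfield_power: "is_subfield k \<Longrightarrow> x \<in> k \<Longrightarrow> x ^ n \<in> k"
  by (induction n) (auto intro: subfield_1 subfield_mult)

lemma subfield_of_nat: "is_subfield k \<Longrightarrow> of_nat n \<in> k"
  by (induction n) (auto intro: subfield_0 subfield_1 subfield_add)

lemma subfield_sum: "is_subfield k \<Longrightarrow> (\<And>i. i \<in> A \<Longrightarrow> f i \<in> k) \<Longrightarrow> sum f A \<in> k"
  by (induction A rule: infinite_finite_induct) (auto intro: subfield_0 subfield_add)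

lemma subfield_prod: "is_subfield k \<Longrightarrow> (\<And>i. i \<in> A \<Longrightarrow> f i \<in> k) \<Longrightarrow> prod f A \<in> k"
  by (induction A rule: infinite_finite_induct) (auto intro: subfield_1 subfield_mult)

lemma is_subfield_Rats: "is_subfield (\<rat> :: 'a::field_char_0 set)"
  unfolding is_subfield_def by auto

lemma is_subfield_field_adjoin: "is_subfield (field_adjoin k S)"
  unfolding is_subfield_def field_adjoin_def by auto

lemma field_adjoin_base: "k \<subseteq> field_adjoin k S"
  unfolding field_adjoin_def by auto

lemma field_adjoin_gens: "S \<subseteq> field_adjoin k S"
  unfolding field_adjoin_def by auto

lemma field_adjoin_least: "is_subfield L \<Longrightarrow> k \<subseteq> L \<Longrightarrow> S \<subseteq> L \<Longrightarrow> field_adjoin k S \<subseteq> L"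
  unfolding field_adjoin_def by auto

lemma field_adjoin_mono: "S \<subseteq> T \<Longrightarrow> field_adjoin k S \<subseteq> field_adjoin k T"
  unfolding field_adjoin_def by auto

lemma field_adjoin_finite_support:
  assumes "x \<in> field_adjoin k S"
  obtains T where "finite T" "T \<subseteq> S" "x \<in> field_adjoin k T"
proof -
  let ?L = "{x. \<exists>T. finite T \<and> T \<subseteq> S \<and> x \<in> field_adjoin k T}"
  have two: "\<exists>T. finite T \<and> T \<subseteq> S \<and> x \<in> field_adjoin k T \<and> y \<in> field_adjoin k T"
    if xy: "x \<in> ?L" "y \<in> ?L" for x y
  proof -
    from xy obtain T T' where T: "finite T" "T \<subseteq> S" "x \<in> field_adjoin k T"
      "finite T'" "T' \<subseteq> S" "y \<in> field_adjoin k T'" by blast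
    have "x \<in> field_adjoin k (T \<union> T')" "y \<in> field_adjoin k (T \<union> T')"
      using T field_adjoin_mono[of T "T \<union> T'" k] field_adjoin_mono[of T' "T \<union> T'" k] by auto
    then show ?thesis using T by (intro exI[of _ "T \<union> T'"]) auto
  qed
  note sf = is_subfield_field_adjoin
  have "is_subfield ?L"
    unfolding is_subfield_def
  proof (intro conjI ballI)
    show "0 \<in> ?L" "1 \<in> ?L"
      using subfield_0[OF sf[of k "{}"]] subfield_1[OF sf[of k "{}"]] by auto
  next
    fix x y assume "x \<in> ?L" "y \<in> ?L"
    from two[OF this] obtain T where T: "finite T" "T \<subseteq> S"
      and xy: "x \<in> field_adjoin k T" "y \<in> field_adjoin k T" by blast
    show "x + y \<in> ?L" "x * y \<in> ?L"
      using T subfield_add[OF sf xy] subfield_mult[OF sf xy] by auto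
  next
    fix x assume "x \<in> ?L"
    then obtain T where T: "finite T" "T \<subseteq> S" and x: "x \<in> field_adjoin k T" by blast
    show "- x \<in> ?L" "inverse x \<in> ?L"
      using T subfield_uminus[OF sf x] subfield_inverse[OF sf x] by auto
  qed
  moreover have "k \<subseteq> ?L" using field_adjoin_base[of k "{}"] by blast
  moreover have "S \<subseteq> ?L"
  proof
    fix s assume "s \<in> S"
    then show "s \<in> ?L" using field_adjoin_gens[of "{s}" k] by (auto intro!: exI[of _ "{s}"])
  qed
  ultimately have "field_adjoin k S \<subseteq> ?L" by (rule field_adjoin_least)
  then show thesis using assms that by blast
qed

text \<open>Gaussian elimination inside the subfield: each equation costs one unknown, and pivoting
  divides only by elements of \<open>k\<close>.\<close>

lemma homogeneous_system_nontrivial_solution: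
  fixes A :: "'i \<Rightarrow> 'e \<Rightarrow> 'a::field"
  assumes "is_subfield k" "finite E" "finite I" "card E < card I"
    "\<And>i e. i \<in> I \<Longrightarrow> e \<in> E \<Longrightarrow> A i e \<in> k"
  shows "\<exists>c. (\<forall>i\<in>I. c i \<in> k) \<and> (\<exists>i\<in>I. c i \<noteq> 0) \<and> (\<forall>e\<in>E. (\<Sum>i\<in>I. c i * A i e) = 0)"
  using assms(2-5)
proof (induction E arbitrary: I A rule: finite_induct)
  case empty
  then obtain i where "i \<in> I" by fastforce
  then show ?case
    using subfield_1[OF assms(1)] by (intro exI[of _ "\<lambda>_. 1"]) auto
next
  case (insert e E)
  show ?case
  proof (cases "\<forall>i\<in>I. A i e = 0")
    case True
    have "\<exists>c. (\<forall>i\<in>I. c i \<in> k) \<and> (\<exists>i\<in>I. c i \<noteq> 0) \<and> (\<forall>e\<in>E. (\<Sum>i\<in>I. c i * A i e) = 0)"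
      using insert.prems insert.hyps by (intro insert.IH) auto
    then obtain c where c: "\<forall>i\<in>I. c i \<in> k" "\<exists>i\<in>I. c i \<noteq> 0"
      "\<forall>e\<in>E. (\<Sum>i\<in>I. c i * A i e) = 0" by blast
    moreover have "(\<Sum>i\<in>I. c i * A i e) = 0" using True by simp
    ultimately show ?thesis by blast
  next
    case False
    then obtain p where p: "p \<in> I" "A p e \<noteq> 0" by blast
    let ?I = "I - {p}"
    define r where "r i = A i e / A p e" for i
    have rk: "r i \<in> k" if "i \<in> I" for i
      unfolding r_def using that p insert.prems by (auto intro!: subfield_divide[OF assms(1)])
    have "\<exists>c. (\<forall>i\<in>?I. c i \<in> k) \<and> (\<exists>i\<in>?I. c i \<noteq> 0) \<and>
        (\<forall>e'\<in>E. (\<Sum>i\<in>?I. c i * (A i e' - r i * A p e')) = 0)"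
    proof (rule insert.IH)
      show "finite ?I" using insert.prems by simp
      show "card E < card ?I" using insert.prems insert.hyps p by simp
      show "A i e' - r i * A p e' \<in> k" if "i \<in> ?I" "e' \<in> E" for i e'
        using that p insert.prems rk
        by (auto intro!: subfield_diff[OF assms(1)] subfield_mult[OF assms(1)])
    qed
    then obtain c where c: "\<forall>i\<in>?I. c i \<in> k" "\<exists>i\<in>?I. c i \<noteq> 0"
      "\<forall>e'\<in>E. (\<Sum>i\<in>?I. c i * (A i e' - r i * A p e')) = 0" by blast
    \<comment> \<open>The value at the pivot is forced by equation \<open>e\<close>; with it, every
      other equation becomes the reduced one that \<open>c\<close> solves.\<close>
    define c' where "c' = c(p := - (\<Sum>i\<in>?I. c i * r i))"
    have sum: "(\<Sum>i\<in>I. c' i * A i e') = (\<Sum>i\<in>?I. c i * (A i e' - r i * A p e'))" for e'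
    proof -
      have "(\<Sum>i\<in>I. c' i * A i e') = c' p * A p e' + (\<Sum>i\<in>?I. c' i * A i e')"
        using p insert.prems by (simp add: sum.remove)
      also have "(\<Sum>i\<in>?I. c' i * A i e') = (\<Sum>i\<in>?I. c i * A i e')"
        by (rule sum.cong) (auto simp: c'_def)
      finally show ?thesis
        by (simp add: c'_def algebra_simps sum_subtractf sum_distrib_left)
    qed
    have "(\<Sum>i\<in>I. c' i * A i e) = 0"
      unfolding sum using p by (simp add: r_def)
    moreover have "\<forall>e'\<in>E. (\<Sum>i\<in>I. c' i * A i e') = 0" using sum c by simp
    moreover have "\<forall>i\<in>I. c' i \<in> k"
      using c rk unfolding c'_def
      by (auto intro!: subfield_uminus[OF assms(1)] subfield_sum[OF assms(1)] subfield_mult[OF assms(1)])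
    moreover have "\<exists>i\<in>I. c' i \<noteq> 0" using c by (auto simp: c'_def)
    ultimately show ?thesis by blast
  qed
qed

section \<open>Monomials and algebraic independence\<close>

definition pmon :: "('v \<Rightarrow> 'a::comm_monoid_mult) \<Rightarrow> ('v \<Rightarrow>\<^sub>0 nat) \<Rightarrow> 'a" where
  "pmon x \<mu> = (\<Prod>v\<in>Poly_Mapping.keys \<mu>. x v ^ Poly_Mapping.lookup \<mu> v)"

lemma pmon_superset:
  "finite A \<Longrightarrow> Poly_Mapping.keys \<mu> \<subseteq> A \<Longrightarrow> pmon x \<mu> = (\<Prod>v\<in>A. x v ^ Poly_Mapping.lookup \<mu> v)"
  unfolding pmon_def by (rule prod.mono_neutral_left) (auto simp: in_keys_iff)

lemma keys_add_nat:
  "Poly_Mapping.keys (\<mu> + \<nu> :: 'v \<Rightarrow>\<^sub>0 nat) = Poly_Mapping.keys \<mu> \<union> Poly_Mapping.keys \<nu>"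
  by (auto simp: in_keys_iff lookup_add)

lemma pmon_0 [simp]: "pmon x 0 = 1"
  by (simp add: pmon_def)

lemma pmon_add: "pmon x (\<mu> + \<nu>) = pmon x \<mu> * pmon x \<nu>"
proof -
  let ?A = "Poly_Mapping.keys \<mu> \<union> Poly_Mapping.keys \<nu>"
  show ?thesis
    by (simp add: pmon_superset[of ?A] keys_add_nat lookup_add power_add prod.distrib)
qed

lemma pmon_single [simp]: "pmon x (Poly_Mapping.single v n) = x v ^ n"
  by (cases "n = 0") (auto simp: pmon_def)

lemma peval_eq_sum_pmon: "peval f x = (\<Sum>\<mu>\<in>Poly_Mapping.keys f. Poly_Mapping.lookup f \<mu> * pmon x \<mu>)"
  unfolding peval_def pmon_def ..

lemma mpol_of_coeffs:
  assumes "finite M"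
  obtains f where "Poly_Mapping.keys f = {\<mu>\<in>M. c \<mu> \<noteq> 0}"
    "\<And>\<mu>. \<mu> \<in> M \<Longrightarrow> Poly_Mapping.lookup f \<mu> = c \<mu>" "\<And>x. peval f x = (\<Sum>\<mu>\<in>M. c \<mu> * pmon x \<mu>)"
proof -
  define f where "f = Abs_poly_mapping (\<lambda>\<mu>. c \<mu> when \<mu> \<in> M)"
  have "\<mu> \<in> M" if "(c \<mu> when \<mu> \<in> M) \<noteq> 0" for \<mu>
    using that by (cases "\<mu> \<in> M") auto
  then have "{\<mu>. (c \<mu> when \<mu> \<in> M) \<noteq> 0} \<subseteq> M" by blast
  with assms have "finite {\<mu>. (c \<mu> when \<mu> \<in> M) \<noteq> 0}" using finite_subset by blast
  then have lf: "Poly_Mapping.lookup f \<mu> = (c \<mu> when \<mu> \<in> M)" for \<mu>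
    unfolding f_def by (simp add: Abs_poly_mapping_inverse)
  have kf: "Poly_Mapping.keys f = {\<mu>\<in>M. c \<mu> \<noteq> 0}"
  proof (rule set_eqI)
    show "\<mu> \<in> Poly_Mapping.keys f \<longleftrightarrow> \<mu> \<in> {\<mu>\<in>M. c \<mu> \<noteq> 0}" for \<mu>
      by (cases "\<mu> \<in> M") (auto simp: in_keys_iff lf)
  qed
  have "peval f x = (\<Sum>\<mu>\<in>M. c \<mu> * pmon x \<mu>)" for x
    unfolding peval_eq_sum_pmon using assms
    by (intro sum.mono_neutral_cong_left) (auto simp: kf lf)
  with kf lf show thesis by (intro that) auto
qed

text \<open>Relations become finite sums with coefficients that may be zero, so no polynomial has to
  be built for each relation that comes up.\<close>

lemma alg_independent_family_iff:
  assumes "is_subfield k"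
  shows "alg_independent_family k I x \<longleftrightarrow>
    (\<forall>M c. finite M \<and> (\<forall>\<mu>\<in>M. Poly_Mapping.keys \<mu> \<subseteq> I \<and> c \<mu> \<in> k) \<and>
       (\<Sum>\<mu>\<in>M. c \<mu> * pmon x \<mu>) = 0 \<longrightarrow> (\<forall>\<mu>\<in>M. c \<mu> = 0))"
    (is "?L \<longleftrightarrow> ?R")
proof
  assume L: ?L
  show ?R
  proof (intro allI impI)
    fix M c
    assume M: "finite M \<and> (\<forall>\<mu>\<in>M. Poly_Mapping.keys \<mu> \<subseteq> I \<and> c \<mu> \<in> k) \<and>
       (\<Sum>\<mu>\<in>M. c \<mu> * pmon x \<mu>) = 0"
    obtain f where kf: "Poly_Mapping.keys f = {\<mu>\<in>M. c \<mu> \<noteq> 0}"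
      and lf: "\<And>\<mu>. \<mu> \<in> M \<Longrightarrow> Poly_Mapping.lookup f \<mu> = c \<mu>"
      and pf: "peval f x = (\<Sum>\<mu>\<in>M. c \<mu> * pmon x \<mu>)"
      by (rule mpol_of_coeffs[OF conjunct1[OF M], of c]) blast
    have "peval f x = 0" using M pf by simp
    moreover have "pvars f \<subseteq> I" "pcoeffs f \<subseteq> k"
      using M by (auto simp: pvars_def pcoeffs_def kf lf)
    ultimately have "f = 0"
      using L unfolding alg_independent_family_def by blast
    then show "\<forall>\<mu>\<in>M. c \<mu> = 0" using kf by auto
  qed
next
  assume R: ?R
  show ?L
    unfolding alg_independent_family_def
  proof (intro allI impI notI)
    fix f :: "('b, 'a) mpol"
    assume f: "pvars f \<subseteq> I \<and> pcoeffs f \<subseteq> k \<and> f \<noteq> 0" and z: "peval f x = 0"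
    have "\<forall>\<mu>\<in>Poly_Mapping.keys f. Poly_Mapping.lookup f \<mu> = 0"
    proof (rule R[THEN spec, THEN spec, THEN mp], intro conjI ballI)
      show "(\<Sum>\<mu>\<in>Poly_Mapping.keys f. Poly_Mapping.lookup f \<mu> * pmon x \<mu>) = 0"
        using z by (simp add: peval_eq_sum_pmon)
    qed (use f in \<open>auto simp: pvars_def pcoeffs_def\<close>)
    then have "Poly_Mapping.keys f = {}" using in_keys_iff[of _ f] by blast
    then show False using f by simp
  qed
qed

lemma alg_independent_familyD:
  assumes "alg_independent_family k I x" "is_subfield k" "finite M"
    "\<And>\<mu>. \<mu> \<in> M \<Longrightarrow> Poly_Mapping.keys \<mu> \<subseteq> I" "\<And>\<mu>. \<mu> \<in> M \<Longrightarrow> c \<mu> \<in> k"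
    "(\<Sum>\<mu>\<in>M. c \<mu> * pmon x \<mu>) = 0" "\<mu> \<in> M"
  shows "c \<mu> = 0"
proof -
  have "\<forall>\<mu>\<in>M. c \<mu> = 0"
    using assms(1) unfolding alg_independent_family_iff[OF assms(2)]
    by (elim allE[of _ M] allE[of _ c] mp) (use assms(3-6) in auto)
  then show ?thesis using assms(7) by blast
qed

lemma alg_independent_familyE:
  assumes "\<not> alg_independent_family k I x" "is_subfield k"
  obtains M c where "finite M" "\<And>\<mu>. \<mu> \<in> M \<Longrightarrow> Poly_Mapping.keys \<mu> \<subseteq> I" "\<And>\<mu>. \<mu> \<in> M \<Longrightarrow> c \<mu> \<in> k"
    "(\<Sum>\<mu>\<in>M. c \<mu> * pmon x \<mu>) = 0" "\<And>\<mu>. \<mu> \<in> M \<Longrightarrow> c \<mu> \<noteq> 0" "M \<noteq> {}"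
proof -
  from assms obtain M c where M: "finite M" "\<forall>\<mu>\<in>M. Poly_Mapping.keys \<mu> \<subseteq> I \<and> c \<mu> \<in> k"
    "(\<Sum>\<mu>\<in>M. c \<mu> * pmon x \<mu>) = 0" "\<exists>\<mu>\<in>M. c \<mu> \<noteq> 0"
    unfolding alg_independent_family_iff[OF assms(2)] by auto
  let ?M = "{\<mu>\<in>M. c \<mu> \<noteq> 0}"
  have "(\<Sum>\<mu>\<in>?M. c \<mu> * pmon x \<mu>) = (\<Sum>\<mu>\<in>M. c \<mu> * pmon x \<mu>)"
    using M by (intro sum.mono_neutral_left) auto
  then have s: "(\<Sum>\<mu>\<in>?M. c \<mu> * pmon x \<mu>) = 0" using M(3) by simp
  show thesis by (rule that[OF _ _ _ s]) (use M(1,2,4) in auto)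
qed

section \<open>Monomials and polynomial functions of bounded degree\<close>

definition bounded_monomials :: "'v set \<Rightarrow> nat \<Rightarrow> ('v \<Rightarrow>\<^sub>0 nat) set" where
  "bounded_monomials I D = {\<mu>. Poly_Mapping.keys \<mu> \<subseteq> I \<and> (\<forall>v. Poly_Mapping.lookup \<mu> v \<le> D)}"

lemma bij_betw_bounded_monomials:
  assumes "finite I"
  shows "bij_betw (\<lambda>\<mu>. restrict (Poly_Mapping.lookup \<mu>) I) (bounded_monomials I D) (I \<rightarrow>\<^sub>E {0..D})"
proof (rule bij_betwI')
  fix \<mu> \<nu> assume *: "\<mu> \<in> bounded_monomials I D" "\<nu> \<in> bounded_monomials I D"
  show "(restrict (Poly_Mapping.lookup \<mu>) I = restrict (Poly_Mapping.lookup \<nu>) I) = (\<mu> = \<nu>)"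
  proof
    assume eq: "restrict (Poly_Mapping.lookup \<mu>) I = restrict (Poly_Mapping.lookup \<nu>) I"
    have "Poly_Mapping.lookup \<mu> v = Poly_Mapping.lookup \<nu> v" for v
    proof (cases "v \<in> I")
      case True
      then show ?thesis using fun_cong[OF eq, of v] by simp
    next
      case False
      then have "v \<notin> Poly_Mapping.keys \<mu>" "v \<notin> Poly_Mapping.keys \<nu>"
        using * by (auto simp: bounded_monomials_def)
      then show ?thesis by (simp add: in_keys_iff)
    qed
    then show "\<mu> = \<nu>" by (intro poly_mapping_eqI)
  qed simp
next
  fix \<mu> assume "\<mu> \<in> bounded_monomials I D"
  then show "restrict (Poly_Mapping.lookup \<mu>) I \<in> I \<rightarrow>\<^sub>E {0..D}"
    by (auto simp: bounded_monomials_def)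
next
  fix g assume g: "g \<in> I \<rightarrow>\<^sub>E {0..D}"
  define \<mu> where "\<mu> = Abs_poly_mapping (\<lambda>v. g v when v \<in> I)"
  have "v \<in> I" if "(g v when v \<in> I) \<noteq> 0" for v
    using that by (cases "v \<in> I") auto
  then have sub: "{v. (g v when v \<in> I) \<noteq> 0} \<subseteq> I" by blast
  with assms have "finite {v. (g v when v \<in> I) \<noteq> 0}" using finite_subset by blast
  then have l: "Poly_Mapping.lookup \<mu> v = (g v when v \<in> I)" for v
    unfolding \<mu>_def by (simp add: Abs_poly_mapping_inverse)
  have "Poly_Mapping.keys \<mu> \<subseteq> I" using sub by (simp add: Poly_Mapping.keys.rep_eq l)
  moreover have "Poly_Mapping.lookup \<mu> v \<le> D" for v
    using g by (cases "v \<in> I") (auto simp: l)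
  ultimately have b: "\<mu> \<in> bounded_monomials I D" by (simp add: bounded_monomials_def)
  show "\<exists>\<mu>\<in>bounded_monomials I D. g = restrict (Poly_Mapping.lookup \<mu>) I"
  proof (intro bexI[of _ \<mu>])
    show "g = restrict (Poly_Mapping.lookup \<mu>) I"
      using g by (auto simp: l fun_eq_iff PiE_def extensional_def)
    show "\<mu> \<in> bounded_monomials I D" by (rule b)
  qed
qed

lemma finite_bounded_monomials: "finite I \<Longrightarrow> finite (bounded_monomials I D)"
  using bij_betw_finite[OF bij_betw_bounded_monomials, of I D] by (simp add: finite_PiE)

text \<open>Exponents are bounded one variable at a time, not through the total degree, so that the
  count is a plain power and growth rates can be compared directly.\<close>

lemma card_bounded_monomials: "finite I \<Longrightarrow> card (bounded_monomials I D) = (D + 1) ^ card I"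
  using bij_betw_same_card[OF bij_betw_bounded_monomials, of I D] by (simp add: card_PiE)

text \<open>Polynomial functions of a point \<open>p\<close> in the coordinates \<open>X v p\<close>, of degree at most \<open>D\<close> in
  each coordinate. Carrying the point along makes a relation found at one point transferable to
  all others; elements of a field are obtained by taking \<open>'p\<close> to be \<open>unit\<close>.\<close>

definition polyfun :: "'a::field set \<Rightarrow> 'v set \<Rightarrow> ('v \<Rightarrow> 'p \<Rightarrow> 'a) \<Rightarrow> nat \<Rightarrow> ('p \<Rightarrow> 'a) set" where
  "polyfun k I X D = {\<Phi>. \<exists>M c. finite M \<and> M \<subseteq> bounded_monomials I D \<and> (\<forall>\<mu>\<in>M. c \<mu> \<in> k) \<and>
     \<Phi> = (\<lambda>p. \<Sum>\<mu>\<in>M. c \<mu> * pmon (\<lambda>v. X v p) \<mu>)}"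

text \<open>Terms may repeat a monomial; \<open>c'\<close> collects them. Sums and products can then
  be indexed by \<open>M <+> N\<close> and \<open>M \<times> N\<close> without regard to coinciding
  monomials.\<close>

lemma polyfunI:
  assumes "is_subfield k" "finite A" "\<And>a. a \<in> A \<Longrightarrow> \<mu> a \<in> bounded_monomials I D"
    "\<And>a. a \<in> A \<Longrightarrow> c a \<in> k" "\<And>p. \<Phi> p = (\<Sum>a\<in>A. c a * pmon (\<lambda>v. X v p) (\<mu> a))"
  shows "\<Phi> \<in> polyfun k I X D"
proof -
  define c' where "c' \<nu> = (\<Sum>a | a \<in> A \<and> \<mu> a = \<nu>. c a)" for \<nu>
  have "\<Phi> = (\<lambda>p. \<Sum>\<nu>\<in>\<mu> ` A. c' \<nu> * pmon (\<lambda>v. X v p) \<nu>)"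
  proof
    fix p
    have "\<Phi> p = (\<Sum>\<nu>\<in>\<mu> ` A. \<Sum>a | a \<in> A \<and> \<mu> a = \<nu>. c a * pmon (\<lambda>v. X v p) (\<mu> a))"
      unfolding assms(5) by (rule sum.image_gen[OF assms(2)])
    also have "\<dots> = (\<Sum>\<nu>\<in>\<mu> ` A. c' \<nu> * pmon (\<lambda>v. X v p) \<nu>)"
      unfolding c'_def sum_distrib_right by (intro sum.cong refl) force
    finally show "\<Phi> p = (\<Sum>\<nu>\<in>\<mu> ` A. c' \<nu> * pmon (\<lambda>v. X v p) \<nu>)" .
  qed
  moreover have "\<forall>\<nu>. c' \<nu> \<in> k"
    unfolding c'_def using assms(4) by (auto intro!: subfield_sum[OF assms(1)])
  ultimately show ?thesis
    unfolding polyfun_def using assms(2,3)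
    by (intro CollectI exI[of _ "\<mu> ` A"] exI[of _ c']) auto
qed

lemma bounded_monomials_mono: "D \<le> D' \<Longrightarrow> bounded_monomials I D \<subseteq> bounded_monomials I D'"
  unfolding bounded_monomials_def using le_trans by blast

lemma polyfun_mono: "D \<le> D' \<Longrightarrow> polyfun k I X D \<subseteq> polyfun k I X D'"
  unfolding polyfun_def using bounded_monomials_mono by fast

lemma polyfun_const: "is_subfield k \<Longrightarrow> a \<in> k \<Longrightarrow> (\<lambda>_. a) \<in> polyfun k I X D"
  by (rule polyfunI[of _ "{()}" "\<lambda>_. 0"]) (auto simp: bounded_monomials_def)

lemma polyfun_coord: "is_subfield k \<Longrightarrow> v \<in> I \<Longrightarrow> X v \<in> polyfun k I X 1"
  by (rule polyfunI[of _ "{()}" "\<lambda>_. Poly_Mapping.single v 1" _ _ "\<lambda>_. 1"])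
    (auto simp: bounded_monomials_def lookup_single when_def subfield_1)

lemma polyfun_add:
  assumes "is_subfield k" "\<Phi> \<in> polyfun k I X D" "\<Psi> \<in> polyfun k I X D"
  shows "(\<lambda>p. \<Phi> p + \<Psi> p) \<in> polyfun k I X D"
proof -
  from assms obtain M c N e where
    M: "finite M" "M \<subseteq> bounded_monomials I D" "\<forall>\<mu>\<in>M. c \<mu> \<in> k"
      "\<Phi> = (\<lambda>p. \<Sum>\<mu>\<in>M. c \<mu> * pmon (\<lambda>v. X v p) \<mu>)" and
    N: "finite N" "N \<subseteq> bounded_monomials I D" "\<forall>\<mu>\<in>N. e \<mu> \<in> k"
      "\<Psi> = (\<lambda>p. \<Sum>\<mu>\<in>N. e \<mu> * pmon (\<lambda>v. X v p) \<mu>)"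
    unfolding polyfun_def by blast
  show ?thesis
    by (rule polyfunI[OF assms(1), of "M <+> N" "case_sum id id" _ _ "case_sum c e"])
      (use M N in \<open>auto simp: sum.Plus\<close>)
qed

lemma polyfun_mult:
  assumes "is_subfield k" "\<Phi> \<in> polyfun k I X D" "\<Psi> \<in> polyfun k I X D'"
  shows "(\<lambda>p. \<Phi> p * \<Psi> p) \<in> polyfun k I X (D + D')"
proof -
  from assms obtain M c N e where
    M: "finite M" "M \<subseteq> bounded_monomials I D" "\<forall>\<mu>\<in>M. c \<mu> \<in> k"
      "\<Phi> = (\<lambda>p. \<Sum>\<mu>\<in>M. c \<mu> * pmon (\<lambda>v. X v p) \<mu>)" and
    N: "finite N" "N \<subseteq> bounded_monomials I D'" "\<forall>\<mu>\<in>N. e \<mu> \<in> k"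
      "\<Psi> = (\<lambda>p. \<Sum>\<mu>\<in>N. e \<mu> * pmon (\<lambda>v. X v p) \<mu>)"
    unfolding polyfun_def by blast
  show ?thesis
  proof (rule polyfunI[OF assms(1), of "M \<times> N" "\<lambda>(\<mu>, \<nu>). \<mu> + \<nu>" _ _ "\<lambda>(\<mu>, \<nu>). c \<mu> * e \<nu>"])
    show "finite (M \<times> N)" using M N by simp
    show "(case a of (\<mu>, \<nu>) \<Rightarrow> \<mu> + \<nu>) \<in> bounded_monomials I (D + D')" if "a \<in> M \<times> N" for a
    proof -
      obtain \<mu> \<nu> where a: "a = (\<mu>, \<nu>)" by (cases a)
      then have "\<mu> \<in> bounded_monomials I D" "\<nu> \<in> bounded_monomials I D'"
        using that M(2) N(2) by auto
      then show ?thesis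
        unfolding a by (auto simp: bounded_monomials_def keys_add_nat lookup_add intro!: add_mono)
    qed
    show "(case a of (\<mu>, \<nu>) \<Rightarrow> c \<mu> * e \<nu>) \<in> k" if "a \<in> M \<times> N" for a
      using that M N by (auto intro: subfield_mult[OF assms(1)])
    show "\<Phi> p * \<Psi> p = (\<Sum>a\<in>M \<times> N. (case a of (\<mu>, \<nu>) \<Rightarrow> c \<mu> * e \<nu>) *
        pmon (\<lambda>v. X v p) (case a of (\<mu>, \<nu>) \<Rightarrow> \<mu> + \<nu>))" for p
      unfolding M(4) N(4) sum_product sum.cartesian_product
      by (intro sum.cong) (auto simp: pmon_add algebra_simps)
  qed
qed

lemma polyfun_power:
  "is_subfield k \<Longrightarrow> \<Phi> \<in> polyfun k I X D \<Longrightarrow> (\<lambda>p. \<Phi> p ^ n) \<in> polyfun k I X (n * D)"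
proof (induction n)
  case 0
  then show ?case using polyfun_const[OF _ subfield_1] by simp
next
  case (Suc n)
  then show ?case using polyfun_mult[of k \<Phi> I X D "\<lambda>p. \<Phi> p ^ n" "n * D"] by simp
qed

lemma polyfun_prod:
  assumes "is_subfield k" "finite A" "\<And>a. a \<in> A \<Longrightarrow> \<Phi> a \<in> polyfun k I X D"
  shows "(\<lambda>p. \<Prod>a\<in>A. \<Phi> a p) \<in> polyfun k I X (card A * D)"
  using assms(2,3)
proof (induction A rule: finite_induct)
  case empty
  then show ?case using polyfun_const[OF assms(1) subfield_1[OF assms(1)]] by simp
next
  case (insert a A)
  then show ?case
    using polyfun_mult[OF assms(1), of "\<Phi> a" I X D "\<lambda>p. \<Prod>a\<in>A. \<Phi> a p" "card A * D"] by simp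
qed

lemma polyfun_uminus:
  assumes "is_subfield k" "\<Phi> \<in> polyfun k I X D"
  shows "(\<lambda>p. - \<Phi> p) \<in> polyfun k I X D"
proof -
  have "(\<lambda>_. - 1) \<in> polyfun k I X 0"
    using assms(1) by (intro polyfun_const subfield_uminus subfield_1)
  from polyfun_mult[OF assms(1) this assms(2)] show ?thesis by simp
qed

section \<open>Fields generated by few elements\<close>

definition poly_values :: "'a::field set \<Rightarrow> 'a set \<Rightarrow> nat \<Rightarrow> 'a set" where
  "poly_values k S D = {s. (\<lambda>_::unit. s) \<in> polyfun k S (\<lambda>v _. v) D}"

lemma poly_values_closed:
  assumes k: "is_subfield k"
  shows poly_values_const: "\<And>a. a \<in> k \<Longrightarrow> a \<in> poly_values k S D"
    and poly_values_gen: "\<And>s. s \<in> S \<Longrightarrow> s \<in> poly_values k S 1"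
    and poly_values_add: "\<And>x y. x \<in> poly_values k S D \<Longrightarrow> y \<in> poly_values k S D \<Longrightarrow> x + y \<in> poly_values k S D"
    and poly_values_mult: "\<And>x y D'. x \<in> poly_values k S D \<Longrightarrow> y \<in> poly_values k S D' \<Longrightarrow> x * y \<in> poly_values k S (D + D')"
    and poly_values_uminus: "\<And>x. x \<in> poly_values k S D \<Longrightarrow> - x \<in> poly_values k S D"
    and poly_values_power: "\<And>x n. x \<in> poly_values k S D \<Longrightarrow> x ^ n \<in> poly_values k S (n * D)"
  unfolding poly_values_def mem_Collect_eq
  using polyfun_const[OF k] polyfun_coord[OF k, where X = "\<lambda>v _. v"] polyfun_add[OF k] polyfun_mult[OF k]
    polyfun_uminus[OF k] polyfun_power[OF k] by fast+

lemma poly_values_prod: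
  "is_subfield k \<Longrightarrow> finite A \<Longrightarrow> (\<And>a. a \<in> A \<Longrightarrow> x a \<in> poly_values k S D) \<Longrightarrow>
    (\<Prod>a\<in>A. x a) \<in> poly_values k S (card A * D)"
  unfolding poly_values_def mem_Collect_eq by (rule polyfun_prod)

lemma poly_valuesE:
  assumes "is_subfield k" "finite S" "s \<in> poly_values k S D"
  obtains c where "\<And>\<mu>. c \<mu> \<in> k" "s = (\<Sum>\<mu>\<in>bounded_monomials S D. c \<mu> * pmon (\<lambda>v. v) \<mu>)"
proof -
  from assms(3) obtain M c where M: "finite M" "M \<subseteq> bounded_monomials S D" "\<forall>\<mu>\<in>M. c \<mu> \<in> k"
    "(\<lambda>_::unit. s) = (\<lambda>p. \<Sum>\<mu>\<in>M. c \<mu> * pmon (\<lambda>v. v) \<mu>)"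
    unfolding poly_values_def polyfun_def by auto
  have s: "s = (\<Sum>\<mu>\<in>M. c \<mu> * pmon (\<lambda>v. v) \<mu>)" using fun_cong[OF M(4)] by simp
  show thesis
  proof (rule that[of "\<lambda>\<mu>. if \<mu> \<in> M then c \<mu> else 0"])
    show "(if \<mu> \<in> M then c \<mu> else 0) \<in> k" for \<mu> using M(3) subfield_0[OF assms(1)] by simp
    show "s = (\<Sum>\<mu>\<in>bounded_monomials S D. (if \<mu> \<in> M then c \<mu> else 0) * pmon (\<lambda>v. v) \<mu>)"
      unfolding s using M(2) finite_bounded_monomials[OF assms(2)]
      by (intro sum.mono_neutral_cong_left) auto
  qed
qed

text \<open>Quotients of polynomial values form a subfield containing \<open>k\<close> and
  \<open>S\<close>, so minimality of \<open>field_adjoin\<close> applies. A single \<open>D\<close>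
  bounds numerator and denominator and may grow under the field operations.\<close>

lemma field_adjoin_fraction:
  assumes k: "is_subfield k" and x: "x \<in> field_adjoin k S"
  obtains p q D where "p \<in> poly_values k S D" "q \<in> poly_values k S D" "q \<noteq> 0" "x = p / q"
proof -
  let ?L = "{x. \<exists>p q D. p \<in> poly_values k S D \<and> q \<in> poly_values k S D \<and> q \<noteq> 0 \<and> x = p / q}"
  have LI: "x \<in> ?L" if "p \<in> poly_values k S D" "q \<in> poly_values k S D" "q \<noteq> 0" "x = p / q" for x p q D
    using that by blast
  have one: "1 \<in> poly_values k S D" for D by (rule poly_values_const[OF k subfield_1[OF k]])
  have kL: "a \<in> ?L" if "a \<in> k" for a
    by (rule LI[OF poly_values_const[OF k that, of _ 0] one]) auto
  have "is_subfield ?L"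
    unfolding is_subfield_def
  proof (intro conjI ballI)
    show "0 \<in> ?L" "1 \<in> ?L" by (rule kL[OF subfield_0[OF k]], rule kL[OF subfield_1[OF k]])
  next
    fix x y assume "x \<in> ?L" "y \<in> ?L"
    then obtain p q D p' q' D' where
      x: "p \<in> poly_values k S D" "q \<in> poly_values k S D" "q \<noteq> 0" "x = p / q" and
      y: "p' \<in> poly_values k S D'" "q' \<in> poly_values k S D'" "q' \<noteq> 0" "y = p' / q'"
      by auto
    note qq = poly_values_mult[OF k x(2) y(2)]
    show "x * y \<in> ?L"
      by (rule LI[OF poly_values_mult[OF k x(1) y(1)] qq]) (use x y in auto)
    have "q * p' + p * q' \<in> poly_values k S (D + D')"
      by (intro poly_values_add[OF k] poly_values_mult[OF k] x y)
    then show "x + y \<in> ?L"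
      by (rule LI[OF _ qq]) (use x y in \<open>auto simp: field_simps\<close>)
  next
    fix x assume "x \<in> ?L"
    then obtain p q D where
      x: "p \<in> poly_values k S D" "q \<in> poly_values k S D" "q \<noteq> 0" "x = p / q" by auto
    show "- x \<in> ?L"
      by (rule LI[OF poly_values_uminus[OF k x(1)] x(2)]) (use x in auto)
    show "inverse x \<in> ?L"
    proof (cases "p = 0")
      case True
      then show ?thesis using kL[OF subfield_0[OF k]] x by simp
    next
      case False
      show ?thesis by (rule LI[OF x(2) x(1) False]) (use x in auto)
    qed
  qed
  moreover have "k \<subseteq> ?L" using kL by blast
  moreover have "S \<subseteq> ?L"
  proof
    show "s \<in> ?L" if "s \<in> S" for s
      by (rule LI[OF poly_values_gen[OF k that] one]) auto
  qed
  ultimately have "field_adjoin k S \<subseteq> ?L" by (rule field_adjoin_least)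
  then have "x \<in> ?L" using x by blast
  then show thesis using that by auto
qed

lemma common_denominator:
  assumes k: "is_subfield k" and "finite J" "\<And>j. j \<in> J \<Longrightarrow> y j \<in> field_adjoin k S"
  shows "\<exists>q D. q \<noteq> 0 \<and> q \<in> poly_values k S D \<and> (\<forall>j\<in>J. y j * q \<in> poly_values k S D)"
  using assms(2,3)
proof (induction J rule: finite_induct)
  case empty
  show ?case
    by (rule exI[of _ 1], rule exI[of _ 0]) (simp add: poly_values_const[OF k subfield_1[OF k]])
next
  case (insert j J)
  then obtain q D where q: "q \<noteq> 0" "q \<in> poly_values k S D" "\<forall>j\<in>J. y j * q \<in> poly_values k S D"
    by auto
  obtain p r D' where r: "p \<in> poly_values k S D'" "r \<in> poly_values k S D'" "r \<noteq> 0" "y j = p / r"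
    by (rule field_adjoin_fraction[OF k insert.prems[of j]]) auto
  have "q * r \<in> poly_values k S (D + D')" by (rule poly_values_mult[OF k q(2) r(2)])
  moreover have "y j * (q * r) \<in> poly_values k S (D + D')"
    using poly_values_mult[OF k q(2) r(1)] r(3,4) by (simp add: mult.commute)
  moreover have "y i * (q * r) \<in> poly_values k S (D + D')" if "i \<in> J" for i
    using poly_values_mult[OF k q(3)[THEN bspec, OF that] r(2)] by (simp add: mult.assoc)
  ultimately show ?case using q(1) r(3) by (intro exI[of _ "q * r"] exI[of _ "D + D'"]) auto
qed

text \<open>Count monomials: after clearing denominators, those in the \<open>y j\<close> of degree at most \<open>N\<close> in
  each variable lie in the span of the monomials in \<open>S\<close> of degree \<open>O(N)\<close>, of which there are only
  \<open>O(N ^ card S)\<close>.\<close>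

theorem not_alg_independent_if_few_generators:
  assumes k: "is_subfield k" and S: "finite S" and J: "finite J" and card: "card S < card J"
    and y: "\<And>j. j \<in> J \<Longrightarrow> y j \<in> field_adjoin k S"
  shows "\<not> alg_independent_family k J y"
proof
  assume indep: "alg_independent_family k J y"
  obtain q D where q: "q \<noteq> 0" "q \<in> poly_values k S D" "\<And>j. j \<in> J \<Longrightarrow> y j * q \<in> poly_values k S D"
    using common_denominator[OF k J, of y S] y by blast
  \<comment> \<open>The target monomials will number at most \<open>N * (N + 1) ^ card S\<close>:
    this \<open>N\<close> is exactly the constant produced by the degree bound, and one more factor
    \<open>N + 1\<close> beats it.\<close>
  define N where "N = (card J * D + 1) ^ card S"
  define E where "E = card J * (N * D)"
  \<comment> \<open>Padding each factor with powers of \<open>q\<close> up to exponent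
    \<open>N\<close> clears all denominators by the same power of \<open>q\<close>, which can be
    cancelled from a linear relation.\<close>
  have step: "pmon y \<mu> * q ^ (card J * N) \<in> poly_values k S E" if \<mu>: "\<mu> \<in> bounded_monomials J N" for \<mu>
  proof -
    let ?l = "Poly_Mapping.lookup \<mu>"
    have le: "?l j \<le> N" for j using \<mu> by (simp add: bounded_monomials_def)
    have "pmon y \<mu> * q ^ (card J * N) = (\<Prod>j\<in>J. y j ^ ?l j * q ^ N)"
      using \<mu> J by (simp add: bounded_monomials_def pmon_superset[of J] prod.distrib power_mult
          mult.commute)
    also have "\<dots> = (\<Prod>j\<in>J. (y j * q) ^ ?l j * q ^ (N - ?l j))"
      using le by (intro prod.cong refl) (simp add: power_mult_distrib flip: power_add)
    also have "\<dots> \<in> poly_values k S E"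
      unfolding E_def
    proof (rule poly_values_prod[OF k J])
      fix j assume j: "j \<in> J"
      have "(y j * q) ^ ?l j * q ^ (N - ?l j) \<in> poly_values k S (?l j * D + (N - ?l j) * D)"
        by (intro poly_values_mult[OF k] poly_values_power[OF k] q j)
      also have "?l j * D + (N - ?l j) * D = N * D"
        using le[of j] by (simp flip: add_mult_distrib)
      finally show "(y j * q) ^ ?l j * q ^ (N - ?l j) \<in> poly_values k S (N * D)" .
    qed
    finally show ?thesis .
  qed
  have "\<exists>c. (\<forall>\<nu>. c \<nu> \<in> k) \<and>
      pmon y \<mu> * q ^ (card J * N) = (\<Sum>\<nu>\<in>bounded_monomials S E. c \<nu> * pmon (\<lambda>v. v) \<nu>)"
    if "\<mu> \<in> bounded_monomials J N" for \<mu>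
    using poly_valuesE[OF k S step[OF that]] by metis
  then obtain A where A: "\<And>\<mu> \<nu>. \<mu> \<in> bounded_monomials J N \<Longrightarrow> A \<mu> \<nu> \<in> k"
    "\<And>\<mu>. \<mu> \<in> bounded_monomials J N \<Longrightarrow>
      pmon y \<mu> * q ^ (card J * N) = (\<Sum>\<nu>\<in>bounded_monomials S E. A \<mu> \<nu> * pmon (\<lambda>v. v) \<nu>)"
    by metis
  have "card (bounded_monomials S E) < card (bounded_monomials J N)"
  proof -
    have "E + 1 \<le> (card J * D + 1) * (N + 1)" by (simp add: E_def algebra_simps)
    then have "(E + 1) ^ card S \<le> N * (N + 1) ^ card S"
      unfolding N_def power_mult_distrib[symmetric] by (intro power_mono) auto
    also have "\<dots> < (N + 1) ^ (card S + 1)" by simp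
    also have "\<dots> \<le> (N + 1) ^ card J" using card by (intro power_increasing) auto
    finally show ?thesis using S J by (simp add: card_bounded_monomials)
  qed
  then obtain c where c: "\<forall>\<mu>\<in>bounded_monomials J N. c \<mu> \<in> k"
    and c_ne: "\<exists>\<mu>\<in>bounded_monomials J N. c \<mu> \<noteq> 0"
    and c_sum: "\<forall>\<nu>\<in>bounded_monomials S E. (\<Sum>\<mu>\<in>bounded_monomials J N. c \<mu> * A \<mu> \<nu>) = 0"
    using homogeneous_system_nontrivial_solution[OF k finite_bounded_monomials[OF S]
        finite_bounded_monomials[OF J], of E N A] A(1) by blast
  have "(\<Sum>\<mu>\<in>bounded_monomials J N. c \<mu> * pmon y \<mu>) * q ^ (card J * N) =
      (\<Sum>\<mu>\<in>bounded_monomials J N. c \<mu> * (\<Sum>\<nu>\<in>bounded_monomials S E. A \<mu> \<nu> * pmon (\<lambda>v. v) \<nu>))"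
    unfolding sum_distrib_right using A(2) by (intro sum.cong refl) (simp add: mult.assoc)
  also have "\<dots> = (\<Sum>\<nu>\<in>bounded_monomials S E. (\<Sum>\<mu>\<in>bounded_monomials J N. c \<mu> * A \<mu> \<nu>) * pmon (\<lambda>v. v) \<nu>)"
    unfolding sum_distrib_left sum_distrib_right by (subst sum.swap) (simp add: mult.assoc)
  also have "\<dots> = 0" using c_sum by simp
  finally have "(\<Sum>\<mu>\<in>bounded_monomials J N. c \<mu> * pmon y \<mu>) = 0" using q(1) by simp
  from alg_independent_familyD[OF indep k finite_bounded_monomials[OF J] _ _ this]
  have "\<forall>\<mu>\<in>bounded_monomials J N. c \<mu> = 0"
    using c by (auto simp: bounded_monomials_def)
  then show False using c_ne by blast
qed

lemma trdeg_field_adjoin_le: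
  assumes "is_subfield k" "finite T" "L \<subseteq> field_adjoin k T"
  shows "trdeg k L \<le> enat (card T)"
  unfolding trdeg_def
proof (rule SUP_least)
  fix B assume "B \<in> {B. B \<subseteq> L \<and> finite B \<and> alg_independent_family k B (\<lambda>b. b)}"
  then have B: "B \<subseteq> L" "finite B" "alg_independent_family k B (\<lambda>b. b)" by auto
  have "\<not> card T < card B"
    using not_alg_independent_if_few_generators[OF assms(1,2) B(2), of "\<lambda>b. b"] B assms(3) by blast
  then show "enat (card B) \<le> enat (card T)" by simp
qed

text \<open>Independence of the coordinates at \<open>a\<close> forces all coefficients to be zero.
  This is how an equation satisfied at one generic point spreads to every other point.\<close>

lemma polyfun_transfer:
  assumes "is_subfield k" "alg_independent_family k I (\<lambda>v. X v a)" "\<Phi> \<in> polyfun k I X D" "\<Phi> a = 0"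
  shows "\<Phi> z = 0"
proof -
  obtain M c where M: "finite M" "M \<subseteq> bounded_monomials I D" "\<forall>\<mu>\<in>M. c \<mu> \<in> k"
    and \<Phi>: "\<Phi> = (\<lambda>p. \<Sum>\<mu>\<in>M. c \<mu> * pmon (\<lambda>v. X v p) \<mu>)"
    using assms(3) unfolding polyfun_def by auto
  have "c \<mu> = 0" if "\<mu> \<in> M" for \<mu>
    by (rule alg_independent_familyD[OF assms(2,1) M(1) _ _ _ that])
      (use M assms(4) in \<open>auto simp: \<Phi> bounded_monomials_def\<close>)
  then show ?thesis by (simp add: \<Phi>)
qed

lemma polyfun_peval:
  assumes k: "is_subfield k" and "pcoeffs f \<subseteq> k"
    and "\<And>v. v \<in> pvars f \<Longrightarrow> \<exists>D. (\<lambda>p. y p v) \<in> polyfun k I X D"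
  shows "\<exists>D. (\<lambda>p. peval f (y p)) \<in> polyfun k I X D"
proof -
  have mon: "\<exists>D. (\<lambda>p. \<Prod>v\<in>A. y p v ^ n v) \<in> polyfun k I X D" if "finite A" "A \<subseteq> pvars f" for A n
    using that
  proof (induction A rule: finite_induct)
    case empty
    then show ?case using polyfun_const[OF k subfield_1[OF k]] by auto
  next
    case (insert v A)
    then obtain D D' where "(\<lambda>p. \<Prod>v\<in>A. y p v ^ n v) \<in> polyfun k I X D" "(\<lambda>p. y p v) \<in> polyfun k I X D'"
      using assms(3)[of v] by auto
    from polyfun_mult[OF k polyfun_power[OF k this(2)] this(1)] show ?case
      using insert.hyps by auto
  qed
  have "\<exists>D. (\<lambda>p. \<Sum>\<mu>\<in>A. Poly_Mapping.lookup f \<mu> * pmon (y p) \<mu>) \<in> polyfun k I X D"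
    if "finite A" "A \<subseteq> Poly_Mapping.keys f" for A
    using that
  proof (induction A rule: finite_induct)
    case empty
    then show ?case using polyfun_const[OF k subfield_0[OF k]] by auto
  next
    case (insert \<mu> A)
    then obtain D where D: "(\<lambda>p. \<Sum>\<mu>\<in>A. Poly_Mapping.lookup f \<mu> * pmon (y p) \<mu>) \<in> polyfun k I X D"
      by auto
    have "Poly_Mapping.keys \<mu> \<subseteq> pvars f" using insert.prems by (auto simp: pvars_def)
    then obtain D' where D': "(\<lambda>p. pmon (y p) \<mu>) \<in> polyfun k I X D'"
      unfolding pmon_def using mon[of "Poly_Mapping.keys \<mu>"] by auto
    have "Poly_Mapping.lookup f \<mu> \<in> k" using assms(2) insert.prems by (auto simp: pcoeffs_def)
    from polyfun_mult[OF k polyfun_const[OF k this, of _ _ 0] D']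
    have "(\<lambda>p. Poly_Mapping.lookup f \<mu> * pmon (y p) \<mu>) \<in> polyfun k I X (max D D')"
      using polyfun_mono[of D' "max D D'" k I X] by auto
    moreover have "(\<lambda>p. \<Sum>\<mu>\<in>A. Poly_Mapping.lookup f \<mu> * pmon (y p) \<mu>) \<in> polyfun k I X (max D D')"
      using D polyfun_mono[of D "max D D'" k I X] by auto
    ultimately show ?case
      using polyfun_add[OF k] insert.hyps by (auto intro!: exI[of _ "max D D'"])
  qed
  then show ?thesis unfolding peval_eq_sum_pmon by simp
qed

section \<open>Independence in towers of fields\<close>

lemma pmon_sum_type:
  fixes \<mu> :: "'v + 'w \<Rightarrow>\<^sub>0 nat"
  obtains l r where "\<And>v. Poly_Mapping.lookup l v = Poly_Mapping.lookup \<mu> (Inl v)"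
    "\<And>w. Poly_Mapping.lookup r w = Poly_Mapping.lookup \<mu> (Inr w)"
    "\<And>x y :: _ \<Rightarrow> 'a::comm_monoid_mult. pmon (case_sum x y) \<mu> = pmon x l * pmon y r"
proof -
  let ?m = "Poly_Mapping.lookup \<mu>"
  have "finite (Inl -` Poly_Mapping.keys \<mu>)" "finite (Inr -` Poly_Mapping.keys \<mu>)"
    by (auto intro!: finite_vimageI)
  then have fin: "finite {v. ?m (Inl v) \<noteq> 0}" "finite {w. ?m (Inr w) \<noteq> 0}"
    by (simp_all add: vimage_def in_keys_iff)
  define l where "l = Abs_poly_mapping (\<lambda>v. ?m (Inl v))"
  define r where "r = Abs_poly_mapping (\<lambda>w. ?m (Inr w))"
  have l: "Poly_Mapping.lookup l v = ?m (Inl v)" for v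
    unfolding l_def using fin by (simp add: Abs_poly_mapping_inverse)
  have r: "Poly_Mapping.lookup r w = ?m (Inr w)" for w
    unfolding r_def using fin by (simp add: Abs_poly_mapping_inverse)
  have keys: "Poly_Mapping.keys \<mu> = Poly_Mapping.keys l <+> Poly_Mapping.keys r"
  proof (rule set_eqI)
    show "s \<in> Poly_Mapping.keys \<mu> \<longleftrightarrow> s \<in> Poly_Mapping.keys l <+> Poly_Mapping.keys r" for s
      by (cases s) (auto simp: in_keys_iff l r)
  qed
  have "pmon (case_sum x y) \<mu> = pmon x l * pmon y r" for x y :: "_ \<Rightarrow> 'a"
    unfolding pmon_def keys by (simp add: prod.Plus l r)
  with l r show thesis by (rule that)
qed

text \<open>Group a relation by its monomials in \<open>x\<close>: the grouped coefficients lie in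
  \<open>E\<close>, so they vanish, and each of them is a relation between the \<open>y\<close> over
  \<open>K\<close>.\<close>

lemma alg_independent_family_sum_type:
  assumes K: "is_subfield K" and E: "is_subfield E" and "K \<subseteq> E" and yE: "\<And>j. j \<in> J \<Longrightarrow> y j \<in> E"
    and x: "alg_independent_family E I x" and y: "alg_independent_family K J y"
  shows "alg_independent_family K (I <+> J) (case_sum x y)"
proof (rule ccontr)
  assume "\<not> ?thesis"
  then obtain M c where M: "finite M" "\<And>\<mu>. \<mu> \<in> M \<Longrightarrow> Poly_Mapping.keys \<mu> \<subseteq> I <+> J"
    and c: "\<And>\<mu>. \<mu> \<in> M \<Longrightarrow> c \<mu> \<in> K" and sum: "(\<Sum>\<mu>\<in>M. c \<mu> * pmon (case_sum x y) \<mu>) = 0"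
    and c_ne: "\<And>\<mu>. \<mu> \<in> M \<Longrightarrow> c \<mu> \<noteq> 0" and M_ne: "M \<noteq> {}"
    by (rule alg_independent_familyE[OF _ K]) blast
  have "\<forall>\<mu>. \<exists>l r. (\<forall>v. Poly_Mapping.lookup l v = Poly_Mapping.lookup \<mu> (Inl v)) \<and>
      (\<forall>w. Poly_Mapping.lookup r w = Poly_Mapping.lookup \<mu> (Inr w)) \<and>
      pmon (case_sum x y) \<mu> = pmon x l * pmon y r"
    using pmon_sum_type by metis
  then obtain l r where l: "\<And>\<mu> v. Poly_Mapping.lookup (l \<mu>) v = Poly_Mapping.lookup \<mu> (Inl v)"
    and r: "\<And>\<mu> w. Poly_Mapping.lookup (r \<mu>) w = Poly_Mapping.lookup \<mu> (Inr w)"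
    and lr: "\<And>\<mu>. pmon (case_sum x y) \<mu> = pmon x (l \<mu>) * pmon y (r \<mu>)"
    by metis
  have keys_l: "Poly_Mapping.keys (l \<mu>) \<subseteq> I" and keys_r: "Poly_Mapping.keys (r \<mu>) \<subseteq> J" if "\<mu> \<in> M" for \<mu>
  proof -
    show "Poly_Mapping.keys (l \<mu>) \<subseteq> I"
    proof
      fix v assume "v \<in> Poly_Mapping.keys (l \<mu>)"
      then have "Inl v \<in> Poly_Mapping.keys \<mu>" by (simp add: in_keys_iff l)
      then show "v \<in> I" using M(2)[OF that] by auto
    qed
    show "Poly_Mapping.keys (r \<mu>) \<subseteq> J"
    proof
      fix v assume "v \<in> Poly_Mapping.keys (r \<mu>)"
      then have "Inr v \<in> Poly_Mapping.keys \<mu>" by (simp add: in_keys_iff r)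
      then show "v \<in> J" using M(2)[OF that] by auto
    qed
  qed
  obtain \<mu>0 where \<mu>0: "\<mu>0 \<in> M" using M_ne by blast
  define N where "N = {\<mu>\<in>M. l \<mu> = l \<mu>0}"
  define e where "e \<nu> = (\<Sum>\<mu>\<in>{\<mu>\<in>M. l \<mu> = \<nu>}. c \<mu> * pmon y (r \<mu>))" for \<nu>
  have "(\<Sum>\<nu>\<in>l ` M. e \<nu> * pmon x \<nu>) = (\<Sum>\<mu>\<in>M. c \<mu> * pmon (case_sum x y) \<mu>)"
    unfolding e_def sum_distrib_right sum.image_gen[OF M(1), of _ l]
    by (intro sum.cong refl) (auto simp: lr mult_ac)
  then have e_sum: "(\<Sum>\<nu>\<in>l ` M. e \<nu> * pmon x \<nu>) = 0" using sum by simp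
  have "e (l \<mu>0) = 0"
  proof (rule alg_independent_familyD[OF x E _ _ _ e_sum])
    show "e \<nu> \<in> E" for \<nu>
      unfolding e_def pmon_def
      by (intro subfield_sum[OF E] subfield_mult[OF E] subfield_prod[OF E] subfield_power[OF E])
        (use c keys_r yE \<open>K \<subseteq> E\<close> in blast)+
  qed (use M(1) keys_l \<mu>0 in auto)
  then have "(\<Sum>\<mu>\<in>N. c \<mu> * pmon y (r \<mu>)) = 0" by (simp add: e_def N_def)
  \<comment> \<open>Within \<open>N\<close> the \<open>x\<close>-part is fixed, so the
    \<open>y\<close>-part determines the monomial and no two terms of the relation in
    \<open>y\<close> merge.\<close>
  moreover have inj: "inj_on r N"
  proof
    fix \<mu> \<nu> assume *: "\<mu> \<in> N" "\<nu> \<in> N" "r \<mu> = r \<nu>"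
    then have "l \<mu> = l \<nu>" by (simp add: N_def)
    have "Poly_Mapping.lookup \<mu> s = Poly_Mapping.lookup \<nu> s" for s
      using l[of \<mu>] l[of \<nu>] r[of \<mu>] r[of \<nu>] \<open>l \<mu> = l \<nu>\<close> *(3) by (cases s) metis+
    then show "\<mu> = \<nu>" by (rule poly_mapping_eqI)
  qed
  ultimately have y_sum: "(\<Sum>\<rho>\<in>r ` N. c (the_inv_into N r \<rho>) * pmon y \<rho>) = 0"
    by (simp add: sum.reindex the_inv_into_f_f)
  have "c (the_inv_into N r (r \<mu>0)) = 0"
  proof (rule alg_independent_familyD[OF y K _ _ _ y_sum])
    show "finite (r ` N)" using M(1) by (simp add: N_def)
    show "r \<mu>0 \<in> r ` N" using \<mu>0 by (simp add: N_def)
    show "c (the_inv_into N r \<rho>) \<in> K" if "\<rho> \<in> r ` N" for \<rho>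
      using that inj c by (auto simp: the_inv_into_f_f N_def)
    show "Poly_Mapping.keys \<rho> \<subseteq> J" if "\<rho> \<in> r ` N" for \<rho>
      using that keys_r by (auto simp: N_def)
  qed
  then have "c \<mu>0 = 0" using inj \<mu>0 by (simp add: the_inv_into_f_f N_def)
  then show False using c_ne[OF \<mu>0] by simp
qed

section \<open>Derivations\<close>

locale differential_field =
  fixes \<delta> :: "'a::field_char_0 \<Rightarrow> 'a"
  assumes derivation: "derivation \<delta>"
begin

lemma deriv_add: "\<delta> (x + y) = \<delta> x + \<delta> y"
  and deriv_mult: "\<delta> (x * y) = \<delta> x * y + x * \<delta> y"
  using derivation unfolding derivation_def by blast+

lemma deriv_0 [simp]: "\<delta> 0 = 0"
  using deriv_add[of 0 0] by simp

lemma deriv_1 [simp]: "\<delta> 1 = 0"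
  using deriv_mult[of 1 1] by simp

lemma deriv_uminus: "\<delta> (- x) = - \<delta> x"
  using deriv_add[of x "- x"] by (simp add: add_eq_0_iff)

lemma deriv_sum: "\<delta> (sum f A) = (\<Sum>a\<in>A. \<delta> (f a))"
  by (induction A rule: infinite_finite_induct) (auto simp: deriv_add)

lemma deriv_inverse: "\<delta> (inverse x) = - \<delta> x * inverse x * inverse x"
proof (cases "x = 0")
  case False
  have "\<delta> (x * inverse x) = 0" using False by simp
  then have "x * \<delta> (inverse x) = - \<delta> x * inverse x"
    unfolding deriv_mult by (simp add: add_eq_0_iff)
  then have "inverse x * (x * \<delta> (inverse x)) = inverse x * (- \<delta> x * inverse x)" by simp
  moreover have "inverse x * (x * \<delta> (inverse x)) = \<delta> (inverse x)" using False by simp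
  ultimately show ?thesis by (simp add: mult_ac)
qed simp

lemma deriv_power: "\<delta> (x ^ n) = of_nat n * x ^ (n - 1) * \<delta> x"
proof (induction n)
  case (Suc n)
  then show ?case by (cases n) (simp_all add: deriv_mult algebra_simps)
qed simp

lemma deriv_of_nat [simp]: "\<delta> (of_nat n) = 0"
  by (induction n) (auto simp: deriv_add)

lemma deriv_prod: "finite A \<Longrightarrow> \<delta> (prod f A) = (\<Sum>a\<in>A. \<delta> (f a) * prod f (A - {a}))"
proof (induction A rule: finite_induct)
  case (insert a A)
  have "(\<Sum>b\<in>A. \<delta> (f b) * prod f (insert a A - {b})) = (\<Sum>b\<in>A. f a * (\<delta> (f b) * prod f (A - {b})))"
  proof (rule sum.cong[OF refl])
    fix b assume "b \<in> A"
    then have "insert a A - {b} = insert a (A - {b})" using insert.hyps by auto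
    then show "\<delta> (f b) * prod f (insert a A - {b}) = f a * (\<delta> (f b) * prod f (A - {b}))"
      using insert.hyps by simp
  qed
  then show ?case using insert by (simp add: deriv_mult sum_distrib_left)
qed simp

text \<open>By the sum, product and quotient rules. Claims about derivatives of a generated field
  thus reduce to its generators; \<open>M\<close> may exceed \<open>L\<close> because
  differentiation can introduce one more jet.\<close>

lemma is_subfield_deriv_in:
  assumes L: "is_subfield L" and M: "is_subfield M" and "L \<subseteq> M"
  shows "is_subfield {x \<in> L. \<delta> x \<in> M}"
  unfolding is_subfield_def
proof (intro conjI ballI)
  show "0 \<in> {x \<in> L. \<delta> x \<in> M}" "1 \<in> {x \<in> L. \<delta> x \<in> M}"
    by (auto simp: subfield_0[OF L] subfield_1[OF L] subfield_0[OF M])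
next
  fix x y assume xy: "x \<in> {x \<in> L. \<delta> x \<in> M}" "y \<in> {x \<in> L. \<delta> x \<in> M}"
  then have xM: "x \<in> M" "y \<in> M" using \<open>L \<subseteq> M\<close> by auto
  show "x + y \<in> {x \<in> L. \<delta> x \<in> M}"
    using xy by (auto simp: deriv_add intro: subfield_add[OF L] subfield_add[OF M])
  show "x * y \<in> {x \<in> L. \<delta> x \<in> M}"
    using xy xM by (auto simp: deriv_mult intro!: subfield_mult[OF L] subfield_add[OF M] subfield_mult[OF M])
next
  fix x assume x: "x \<in> {x \<in> L. \<delta> x \<in> M}"
  then have "x \<in> M" using \<open>L \<subseteq> M\<close> by auto
  then show "inverse x \<in> {x \<in> L. \<delta> x \<in> M}"
    using x by (auto simp: deriv_inverse intro!: subfield_inverse[OF L] subfield_uminus[OF M]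
        subfield_mult[OF M] subfield_inverse[OF M])
  show "- x \<in> {x \<in> L. \<delta> x \<in> M}"
    using x by (auto simp: deriv_uminus intro!: subfield_uminus[OF L] subfield_uminus[OF M])
qed

lemma deriv_field_adjoin_subset:
  assumes "is_subfield M" "field_adjoin k S \<subseteq> M" "\<delta> ` k \<subseteq> M" "\<delta> ` S \<subseteq> M"
  shows "\<delta> ` field_adjoin k S \<subseteq> M"
proof -
  have "field_adjoin k S \<subseteq> {x \<in> field_adjoin k S. \<delta> x \<in> M}"
    using assms field_adjoin_base[of k S] field_adjoin_gens[of S k]
    by (intro field_adjoin_least is_subfield_deriv_in is_subfield_field_adjoin) auto
  then show ?thesis by auto
qed

lemma differential_subfield_field_adjoin:
  assumes "\<delta> ` k \<subseteq> field_adjoin k S" "\<delta> ` S \<subseteq> field_adjoin k S"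
  shows "differential_subfield \<delta> (field_adjoin k S)"
  using deriv_field_adjoin_subset[OF is_subfield_field_adjoin order_refl assms]
  unfolding differential_subfield_def by (auto simp: is_subfield_field_adjoin)

lemma differential_subfieldD:
  assumes "differential_subfield \<delta> k"
  shows "is_subfield k" "\<And>x. x \<in> k \<Longrightarrow> \<delta> x \<in> k"
  using assms unfolding differential_subfield_def by auto

lemma differential_subfield_iter: "differential_subfield \<delta> k \<Longrightarrow> x \<in> k \<Longrightarrow> (\<delta> ^^ i) x \<in> k"
  by (induction i) (auto intro: differential_subfieldD)

end

section \<open>Differentiating polynomial relations\<close>

definition tdeg :: "('v \<Rightarrow>\<^sub>0 nat) \<Rightarrow> nat" where
  "tdeg \<mu> = (\<Sum>v\<in>Poly_Mapping.keys \<mu>. Poly_Mapping.lookup \<mu> v)"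

lemma tdeg_superset:
  "finite A \<Longrightarrow> Poly_Mapping.keys \<mu> \<subseteq> A \<Longrightarrow> tdeg \<mu> = (\<Sum>v\<in>A. Poly_Mapping.lookup \<mu> v)"
  unfolding tdeg_def by (rule sum.mono_neutral_left) (auto simp: in_keys_iff)

lemma tdeg_add: "tdeg (\<mu> + \<nu>) = tdeg \<mu> + tdeg \<nu>"
proof -
  let ?A = "Poly_Mapping.keys \<mu> \<union> Poly_Mapping.keys \<nu>"
  show ?thesis by (simp add: tdeg_superset[of ?A] keys_add_nat lookup_add sum.distrib)
qed

lemma tdeg_single [simp]: "tdeg (Poly_Mapping.single v n) = n"
  by (cases "n = 0") (auto simp: tdeg_def)

lemma tdeg_eq_0: "tdeg \<mu> = 0 \<Longrightarrow> \<mu> = 0"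
  by (auto simp: tdeg_def in_keys_iff intro!: poly_mapping_eqI)

lemma monomial_split:
  fixes \<mu> :: "'v \<Rightarrow>\<^sub>0 nat"
  assumes "v \<in> Poly_Mapping.keys \<mu>"
  obtains \<rho> where "\<mu> = \<rho> + Poly_Mapping.single v 1"
proof (rule that[of "\<mu> - Poly_Mapping.single v 1"])
  show "\<mu> = \<mu> - Poly_Mapping.single v 1 + Poly_Mapping.single v 1"
    using assms by (intro poly_mapping_eqI) (auto simp: lookup_add lookup_minus lookup_single when_def in_keys_iff)
qed

text \<open>Lowering the exponent of \<open>v\<close> is injective on the monomials containing
  \<open>v\<close>; reindexing by the lowered monomial exhibits the coefficients of the formal
  partial derivative.\<close>

lemma sum_partial_derivative:
  fixes c :: "('v \<Rightarrow>\<^sub>0 nat) \<Rightarrow> 'a::field"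
  assumes "finite M"
  shows "(\<Sum>\<mu>\<in>M. c \<mu> * (of_nat (Poly_Mapping.lookup \<mu> v) * pmon x (\<mu> - Poly_Mapping.single v 1))) =
    (\<Sum>\<rho> | \<rho> + Poly_Mapping.single v 1 \<in> M. c (\<rho> + Poly_Mapping.single v 1) *
      of_nat (Poly_Mapping.lookup \<rho> v + 1) * pmon x \<rho>)"
proof -
  let ?e = "Poly_Mapping.single v 1 :: 'v \<Rightarrow>\<^sub>0 nat"
  let ?N = "{\<mu>\<in>M. v \<in> Poly_Mapping.keys \<mu>}"
  have "(\<Sum>\<mu>\<in>M. c \<mu> * (of_nat (Poly_Mapping.lookup \<mu> v) * pmon x (\<mu> - ?e))) =
      (\<Sum>\<mu>\<in>?N. c \<mu> * (of_nat (Poly_Mapping.lookup \<mu> v) * pmon x (\<mu> - ?e)))"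
    using assms by (intro sum.mono_neutral_right) (auto simp: in_keys_iff)
  also have "\<dots> = (\<Sum>\<rho> | \<rho> + ?e \<in> M. c (\<rho> + ?e) * of_nat (Poly_Mapping.lookup \<rho> v + 1) * pmon x \<rho>)"
  proof (rule sum.reindex_bij_witness[of _ "\<lambda>\<rho>. \<rho> + ?e" "\<lambda>\<mu>. \<mu> - ?e"])
    fix \<mu> assume \<mu>: "\<mu> \<in> ?N"
    then obtain \<rho> where \<rho>: "\<mu> = \<rho> + ?e" using monomial_split[of v \<mu>] by blast
    show "\<mu> - ?e + ?e = \<mu>" by (simp add: \<rho>)
    then show "\<mu> - ?e \<in> {\<rho>. \<rho> + ?e \<in> M}" using \<mu> by simp
    show "c (\<mu> - ?e + ?e) * of_nat (Poly_Mapping.lookup (\<mu> - ?e) v + 1) * pmon x (\<mu> - ?e) =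
        c \<mu> * (of_nat (Poly_Mapping.lookup \<mu> v) * pmon x (\<mu> - ?e))"
      by (simp add: \<rho> lookup_add)
  next
    fix \<rho> assume "\<rho> \<in> {\<rho>. \<rho> + ?e \<in> M}"
    then show "\<rho> + ?e \<in> ?N" by (simp add: in_keys_iff lookup_add)
    show "\<rho> + ?e - ?e = \<rho>" by simp
  qed
  finally show ?thesis .
qed

lemma finite_add_monomial_vimage:
  "finite M \<Longrightarrow> finite {\<rho>. \<rho> + \<sigma> \<in> M}" for \<sigma> :: "'v \<Rightarrow>\<^sub>0 nat"
  using finite_vimageI[of M "\<lambda>\<rho>. \<rho> + \<sigma>"] by (simp add: vimage_def inj_on_def)

text \<open>Nonzero coefficients make \<open>M\<close> the exact support, so degrees and numbers of
  top monomials can be read off from \<open>M\<close>.\<close>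

definition poly_relation :: "'a::field set \<Rightarrow> 'v set \<Rightarrow> ('v \<Rightarrow> 'a) \<Rightarrow> ('v \<Rightarrow>\<^sub>0 nat) set \<Rightarrow> (('v \<Rightarrow>\<^sub>0 nat) \<Rightarrow> 'a) \<Rightarrow> bool" where
  "poly_relation k I x M c \<longleftrightarrow> finite M \<and> M \<noteq> {} \<and> (\<forall>\<mu>\<in>M. Poly_Mapping.keys \<mu> \<subseteq> I \<and> c \<mu> \<in> k \<and> c \<mu> \<noteq> 0) \<and>
     (\<Sum>\<mu>\<in>M. c \<mu> * pmon x \<mu>) = 0"

lemma ex_poly_relation:
  assumes "\<not> alg_independent_family k I x" "is_subfield k"
  shows "\<exists>M c. poly_relation k I x M c"
  using alg_independent_familyE[OF assms] unfolding poly_relation_def by metis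

lemma poly_relation_deg_pos:
  assumes "poly_relation k I x M c"
  shows "\<not> (\<forall>\<mu>\<in>M. \<mu> = 0)"
proof
  assume *: "\<forall>\<mu>\<in>M. \<mu> = 0"
  moreover have "M \<noteq> {}" using assms by (simp add: poly_relation_def)
  ultimately have "M = {0}" by auto
  then show False using assms unfolding poly_relation_def by auto
qed

lemma subfield_pmon: "is_subfield k \<Longrightarrow> (\<And>v. v \<in> Poly_Mapping.keys \<mu> \<Longrightarrow> x v \<in> k) \<Longrightarrow> pmon x \<mu> \<in> k"
  unfolding pmon_def by (intro subfield_prod subfield_power)

context differential_field
begin

lemma deriv_pmon:
  assumes "finite A" "Poly_Mapping.keys \<mu> \<subseteq> A"
  shows "\<delta> (pmon x \<mu>) = (\<Sum>v\<in>A. \<delta> (x v) *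
    (of_nat (Poly_Mapping.lookup \<mu> v) * pmon x (\<mu> - Poly_Mapping.single v 1)))"
proof -
  have "\<delta> (pmon x \<mu>) = (\<Sum>v\<in>A. \<delta> (x v ^ Poly_Mapping.lookup \<mu> v) * (\<Prod>w\<in>A - {v}. x w ^ Poly_Mapping.lookup \<mu> w))"
    using assms by (simp add: pmon_superset[of A] deriv_prod)
  also have "\<dots> = (\<Sum>v\<in>A. \<delta> (x v) *
    (of_nat (Poly_Mapping.lookup \<mu> v) * pmon x (\<mu> - Poly_Mapping.single v 1)))"
  proof (rule sum.cong[OF refl])
    fix v assume v: "v \<in> A"
    let ?\<nu> = "\<mu> - Poly_Mapping.single v 1"
    have "Poly_Mapping.keys ?\<nu> \<subseteq> A"
    proof
      fix w assume "w \<in> Poly_Mapping.keys ?\<nu>"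
      then have "w \<in> Poly_Mapping.keys \<mu>" by (auto simp: in_keys_iff lookup_minus)
      then show "w \<in> A" using assms(2) by blast
    qed
    then have "pmon x ?\<nu> = (\<Prod>w\<in>A. x w ^ Poly_Mapping.lookup ?\<nu> w)"
      by (rule pmon_superset[OF assms(1)])
    also have "\<dots> = x v ^ (Poly_Mapping.lookup \<mu> v - 1) * (\<Prod>w\<in>A - {v}. x w ^ Poly_Mapping.lookup ?\<nu> w)"
      using v assms(1) by (simp add: prod.remove lookup_minus)
    also have "(\<Prod>w\<in>A - {v}. x w ^ Poly_Mapping.lookup ?\<nu> w) = (\<Prod>w\<in>A - {v}. x w ^ Poly_Mapping.lookup \<mu> w)"
      by (intro prod.cong refl) (auto simp: lookup_minus lookup_single)
    finally show "\<delta> (x v ^ Poly_Mapping.lookup \<mu> v) * (\<Prod>w\<in>A - {v}. x w ^ Poly_Mapping.lookup \<mu> w) =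
        \<delta> (x v) * (of_nat (Poly_Mapping.lookup \<mu> v) * pmon x ?\<nu>)"
      by (simp add: deriv_power mult_ac)
  qed
  finally show ?thesis .
qed

lemma deriv_sum_pmon:
  assumes "finite A" "finite M" "\<And>\<mu>. \<mu> \<in> M \<Longrightarrow> Poly_Mapping.keys \<mu> \<subseteq> A"
  shows "\<delta> (\<Sum>\<mu>\<in>M. c \<mu> * pmon x \<mu>) = (\<Sum>\<mu>\<in>M. \<delta> (c \<mu>) * pmon x \<mu>) +
    (\<Sum>v\<in>A. \<delta> (x v) * (\<Sum>\<rho> | \<rho> + Poly_Mapping.single v 1 \<in> M. c (\<rho> + Poly_Mapping.single v 1) *
      of_nat (Poly_Mapping.lookup \<rho> v + 1) * pmon x \<rho>))"
proof -
  let ?d = "\<lambda>\<mu> v. of_nat (Poly_Mapping.lookup \<mu> v) * pmon x (\<mu> - Poly_Mapping.single v 1)"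
  have "\<delta> (\<Sum>\<mu>\<in>M. c \<mu> * pmon x \<mu>) = (\<Sum>\<mu>\<in>M. \<delta> (c \<mu>) * pmon x \<mu>) + (\<Sum>\<mu>\<in>M. c \<mu> * \<delta> (pmon x \<mu>))"
    by (simp add: deriv_sum deriv_mult sum.distrib)
  also have "(\<Sum>\<mu>\<in>M. c \<mu> * \<delta> (pmon x \<mu>)) = (\<Sum>\<mu>\<in>M. \<Sum>v\<in>A. \<delta> (x v) * (c \<mu> * ?d \<mu> v))"
    using deriv_pmon[OF assms(1,3)]
    by (intro sum.cong refl) (simp add: sum_distrib_left mult.left_commute)
  also have "\<dots> = (\<Sum>v\<in>A. \<delta> (x v) * (\<Sum>\<mu>\<in>M. c \<mu> * ?d \<mu> v))"
    by (subst sum.swap) (simp add: sum_distrib_left)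
  finally show ?thesis unfolding sum_partial_derivative[OF assms(2)] .
qed

text \<open>Ostrowski's theorem. Differentiating a relation of least degree with as few monomials of top
  degree as possible, one of them with coefficient \<open>1\<close>, must give the zero polynomial; comparing
  coefficients just below the top degree yields the linear relation.\<close>

theorem ostrowski:
  assumes E: "differential_subfield \<delta> E" and const: "\<And>c. \<delta> c = 0 \<Longrightarrow> c \<in> E"
    and I: "finite I" and xE: "\<And>v. v \<in> I \<Longrightarrow> \<delta> (x v) \<in> E"
    and dep: "\<not> alg_independent_family E I x"
  shows "\<exists>C. (\<forall>v\<in>I. \<delta> (C v) = 0) \<and> (\<exists>v\<in>I. C v \<noteq> 0) \<and> (\<Sum>v\<in>I. C v * x v) \<in> E"
proof -
  note Esf = differential_subfieldD(1)[OF E]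
  let ?e = "\<lambda>v. Poly_Mapping.single v (1::nat)"
  let ?R = "poly_relation E I x"
  let ?P = "\<lambda>N. \<exists>M c. ?R M c \<and> (\<forall>\<mu>\<in>M. tdeg \<mu> \<le> N)"
  obtain M1 c1 where M1: "?R M1 c1" using ex_poly_relation[OF dep Esf] by blast
  have "finite M1" using M1 by (simp add: poly_relation_def)
  then have "\<forall>\<mu>\<in>M1. tdeg \<mu> \<le> Max (tdeg ` M1)" by auto
  with M1 have exP: "\<exists>N. ?P N" by blast
  define N where "N = (LEAST N. ?P N)"
  have PN: "?P N" unfolding N_def using exP by (rule LeastI_ex)
  have minN: "N \<le> n" if "?P n" for n unfolding N_def using that by (rule Least_le)
  let ?Q = "\<lambda>t. \<exists>M c. ?R M c \<and> (\<forall>\<mu>\<in>M. tdeg \<mu> \<le> N) \<and> card {\<mu>\<in>M. tdeg \<mu> = N} = t"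
  define t where "t = (LEAST t. ?Q t)"
  have "\<exists>t. ?Q t" using PN by blast
  then have Qt: "?Q t" unfolding t_def by (rule LeastI_ex)
  have mint: "t \<le> s" if "?Q s" for s unfolding t_def using that by (rule Least_le)
  obtain M c0 where R0: "?R M c0" and degM: "\<forall>\<mu>\<in>M. tdeg \<mu> \<le> N" and cardt: "card {\<mu>\<in>M. tdeg \<mu> = N} = t"
    using Qt by blast
  have finM: "finite M" and keysM: "\<And>\<mu>. \<mu> \<in> M \<Longrightarrow> Poly_Mapping.keys \<mu> \<subseteq> I" and M_ne: "M \<noteq> {}"
    and c0: "\<And>\<mu>. \<mu> \<in> M \<Longrightarrow> c0 \<mu> \<in> E" "\<And>\<mu>. \<mu> \<in> M \<Longrightarrow> c0 \<mu> \<noteq> 0" and sum0: "(\<Sum>\<mu>\<in>M. c0 \<mu> * pmon x \<mu>) = 0"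
    using R0 by (auto simp: poly_relation_def)
  have "\<exists>\<nu>\<in>M. tdeg \<nu> = N"
  proof (rule ccontr)
    assume "\<not> ?thesis"
    then have less: "\<forall>\<mu>\<in>M. tdeg \<mu> < N" using degM by (auto simp: le_less)
    then have "\<forall>\<mu>\<in>M. tdeg \<mu> \<le> N - 1" "N > 0" using M_ne by auto
    moreover from this(1) R0 have "N \<le> N - 1" by (intro minN) blast
    ultimately show False by simp
  qed
  then obtain \<nu> where \<nu>: "\<nu> \<in> M" "tdeg \<nu> = N" by blast
  \<comment> \<open>The coefficient at \<open>\<nu>\<close> becomes the constant 1, so
    \<open>\<nu>\<close> drops out on differentiation. The value 0 off \<open>M\<close> lets
    \<open>g\<close> be defined at all monomials.\<close>
  define c where "c \<mu> = (if \<mu> \<in> M then c0 \<mu> / c0 \<nu> else 0)" for \<mu>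
  have cE: "c \<mu> \<in> E" for \<mu>
    unfolding c_def using c0(1) \<nu>(1) by (auto intro: subfield_divide[OF Esf] subfield_0[OF Esf])
  have c\<nu>: "c \<nu> = 1" using \<nu> c0 by (simp add: c_def)
  have c_out: "c \<mu> = 0" if "\<mu> \<notin> M" for \<mu> using that by (simp add: c_def)
  have "(\<Sum>\<mu>\<in>M. c \<mu> * pmon x \<mu>) = (\<Sum>\<mu>\<in>M. c0 \<mu> * pmon x \<mu>) / c0 \<nu>"
    unfolding sum_divide_distrib by (intro sum.cong refl) (simp add: c_def)
  then have csum: "(\<Sum>\<mu>\<in>M. c \<mu> * pmon x \<mu>) = 0" using sum0 by simp
  \<comment> \<open>These are the coefficients of the differentiated relation. As all
    \<open>\<delta> (x v)\<close> lie in \<open>E\<close>, it is again polynomial in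
    \<open>x\<close> over \<open>E\<close>.\<close>
  define g where "g \<rho> = \<delta> (c \<rho>) +
      (\<Sum>v\<in>I. \<delta> (x v) * (c (\<rho> + ?e v) * of_nat (Poly_Mapping.lookup \<rho> v + 1)))" for \<rho>
  have gE: "g \<rho> \<in> E" for \<rho>
    unfolding g_def using differential_subfieldD(2)[OF E cE] cE xE subfield_of_nat[OF Esf]
    by (intro subfield_add[OF Esf] subfield_sum[OF Esf] subfield_mult[OF Esf]) (auto simp del: of_nat_add of_nat_Suc)
  define M' where "M' = M \<union> (\<Union>v\<in>I. {\<rho>. \<rho> + ?e v \<in> M})"
  have finM': "finite M'"
    unfolding M'_def using finM I finite_add_monomial_vimage by auto
  have keysM': "Poly_Mapping.keys \<rho> \<subseteq> I" if "\<rho> \<in> M'" for \<rho>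
  proof -
    from that consider "\<rho> \<in> M" | v where "\<rho> + ?e v \<in> M" unfolding M'_def by blast
    then show ?thesis
    proof cases
      case 2
      then show ?thesis using keysM[OF 2] unfolding keys_add_nat by blast
    qed (rule keysM)
  qed
  have g_sum: "(\<Sum>\<rho>\<in>M'. g \<rho> * pmon x \<rho>) = 0"
  proof -
    have "(\<Sum>\<rho>\<in>M'. g \<rho> * pmon x \<rho>) = (\<Sum>\<rho>\<in>M'. \<delta> (c \<rho>) * pmon x \<rho>) +
        (\<Sum>\<rho>\<in>M'. \<Sum>v\<in>I. \<delta> (x v) * (c (\<rho> + ?e v) * of_nat (Poly_Mapping.lookup \<rho> v + 1) * pmon x \<rho>))"
      by (simp add: g_def distrib_right sum.distrib sum_distrib_right mult.assoc)
    also have "(\<Sum>\<rho>\<in>M'. \<delta> (c \<rho>) * pmon x \<rho>) = (\<Sum>\<rho>\<in>M. \<delta> (c \<rho>) * pmon x \<rho>)"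
      using finM' c_out by (intro sum.mono_neutral_right) (auto simp: M'_def)
    also have "(\<Sum>\<rho>\<in>M'. \<Sum>v\<in>I. \<delta> (x v) * (c (\<rho> + ?e v) * of_nat (Poly_Mapping.lookup \<rho> v + 1) * pmon x \<rho>)) =
        (\<Sum>v\<in>I. \<delta> (x v) * (\<Sum>\<rho>\<in>M'. c (\<rho> + ?e v) * of_nat (Poly_Mapping.lookup \<rho> v + 1) * pmon x \<rho>))"
      by (subst sum.swap) (simp add: sum_distrib_left)
    also have "\<dots> = (\<Sum>v\<in>I. \<delta> (x v) * (\<Sum>\<rho> | \<rho> + ?e v \<in> M. c (\<rho> + ?e v) * of_nat (Poly_Mapping.lookup \<rho> v + 1) * pmon x \<rho>))"
    proof (rule sum.cong[OF refl])
      fix v assume v: "v \<in> I"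
      have "(\<Sum>\<rho>\<in>M'. c (\<rho> + ?e v) * of_nat (Poly_Mapping.lookup \<rho> v + 1) * pmon x \<rho>) =
          (\<Sum>\<rho> | \<rho> + ?e v \<in> M. c (\<rho> + ?e v) * of_nat (Poly_Mapping.lookup \<rho> v + 1) * pmon x \<rho>)"
        using finM' v c_out by (intro sum.mono_neutral_right) (auto simp: M'_def)
      then show "\<delta> (x v) * (\<Sum>\<rho>\<in>M'. c (\<rho> + ?e v) * of_nat (Poly_Mapping.lookup \<rho> v + 1) * pmon x \<rho>) =
          \<delta> (x v) * (\<Sum>\<rho> | \<rho> + ?e v \<in> M. c (\<rho> + ?e v) * of_nat (Poly_Mapping.lookup \<rho> v + 1) * pmon x \<rho>)"
        by simp
    qed
    also have "(\<Sum>\<rho>\<in>M. \<delta> (c \<rho>) * pmon x \<rho>) + \<dots> = \<delta> (\<Sum>\<mu>\<in>M. c \<mu> * pmon x \<mu>)"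
      using deriv_sum_pmon[OF I finM keysM] by simp
    finally show ?thesis by (simp add: csum)
  qed
  have g_top: "g \<rho> = \<delta> (c \<rho>)" if "tdeg \<rho> = N" for \<rho>
  proof -
    have "\<rho> + ?e v \<notin> M" for v
    proof
      assume "\<rho> + ?e v \<in> M"
      then have "tdeg (\<rho> + ?e v) \<le> N" using degM by blast
      then show False using that by (simp add: tdeg_add)
    qed
    then show ?thesis by (simp add: g_def c_out)
  qed
  \<comment> \<open>Otherwise the support of \<open>g\<close> carries a relation of degree at most
    \<open>N\<close> whose top monomials are among those of \<open>M\<close> but omit
    \<open>\<nu>\<close>, against the choice of \<open>t\<close>.\<close>
  have g0: "g \<rho> = 0" for \<rho>
  proof (rule ccontr)
    assume g\<rho>: "g \<rho> \<noteq> 0"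
    have out: "g \<sigma> = 0" if "\<sigma> \<notin> M'" for \<sigma>
      using that c_out by (simp add: g_def M'_def)
    let ?M = "{\<rho>\<in>M'. g \<rho> \<noteq> 0}"
    have "(\<Sum>\<rho>\<in>?M. g \<rho> * pmon x \<rho>) = (\<Sum>\<rho>\<in>M'. g \<rho> * pmon x \<rho>)"
      using finM' by (intro sum.mono_neutral_left) auto
    then have "(\<Sum>\<rho>\<in>?M. g \<rho> * pmon x \<rho>) = 0" using g_sum by simp
    moreover have "\<rho> \<in> ?M" using g\<rho> out by auto
    ultimately have "?R ?M g"
      using finM' keysM' gE unfolding poly_relation_def
      by (intro conjI ballI) (simp, blast, simp_all)
    moreover have "\<forall>\<mu>\<in>?M. tdeg \<mu> \<le> N"
    proof
      fix \<mu> assume "\<mu> \<in> ?M"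
      then consider "\<mu> \<in> M" | v where "\<mu> + ?e v \<in> M" unfolding M'_def by blast
      then show "tdeg \<mu> \<le> N"
      proof cases
        case 2
        then have "tdeg (\<mu> + ?e v) \<le> N" using degM by blast
        then show ?thesis by (simp add: tdeg_add)
      qed (use degM in blast)
    qed
    ultimately have "t \<le> card {\<mu>\<in>?M. tdeg \<mu> = N}" by (intro mint) blast
    also have "\<dots> < card {\<mu>\<in>M. tdeg \<mu> = N}"
    proof (rule psubset_card_mono)
      show "finite {\<mu>\<in>M. tdeg \<mu> = N}" using finM by simp
      have sub: "\<mu> \<in> M" "\<mu> \<noteq> \<nu>" if "\<mu> \<in> ?M" "tdeg \<mu> = N" for \<mu>
      proof -
        have ne: "\<delta> (c \<mu>) \<noteq> 0" using that g_top[of \<mu>] by simp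
        then show "\<mu> \<in> M" using c_out[of \<mu>] deriv_0 by metis
        show "\<mu> \<noteq> \<nu>" using ne c\<nu> deriv_1 by metis
      qed
      show "{\<mu>\<in>?M. tdeg \<mu> = N} \<subset> {\<mu>\<in>M. tdeg \<mu> = N}"
      proof
        show "{\<mu>\<in>?M. tdeg \<mu> = N} \<subseteq> {\<mu>\<in>M. tdeg \<mu> = N}" using sub by blast
        have "\<nu> \<in> {\<mu>\<in>M. tdeg \<mu> = N}" "\<nu> \<notin> {\<mu>\<in>?M. tdeg \<mu> = N}" using \<nu> sub by blast+
        then show "{\<mu>\<in>?M. tdeg \<mu> = N} \<noteq> {\<mu>\<in>M. tdeg \<mu> = N}" by blast
      qed
    qed
    finally show False using cardt by simp
  qed
  have "\<nu> \<noteq> 0"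
  proof
    assume "\<nu> = 0"
    then have "N = 0" using \<nu> by (simp add: tdeg_def)
    then have "\<forall>\<mu>\<in>M. \<mu> = 0" using degM tdeg_eq_0 by blast
    then show False using poly_relation_deg_pos[OF R0] by blast
  qed
  then obtain w where w: "w \<in> Poly_Mapping.keys \<nu>" by (metis all_not_in_conv keys_eq_empty)
  then have wI: "w \<in> I" using keysM[OF \<nu>(1)] by blast
  \<comment> \<open>Each \<open>\<rho> + ?e v\<close> has top degree, so its coefficient is a
    constant. Then \<open>g \<rho> = 0\<close> says that
    \<open>c \<rho> + (\<Sum>v\<in>I. C v * x v)\<close> is a constant. In characteristic zero the
    exponent factor keeps \<open>C w\<close> nonzero.\<close>
  obtain \<rho> where \<rho>: "\<nu> = \<rho> + ?e w" using monomial_split[OF w] by blast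
  have deg\<rho>: "tdeg (\<rho> + ?e v) = N" for v using \<nu>(2) by (simp add: \<rho> tdeg_add)
  define C where "C v = c (\<rho> + ?e v) * of_nat (Poly_Mapping.lookup \<rho> v + 1)" for v
  have Cconst: "\<delta> (C v) = 0" for v
    using g_top[OF deg\<rho>[of v]] g0 unfolding C_def deriv_mult by (simp del: of_nat_Suc of_nat_add)
  have "C w = of_nat (Suc (Poly_Mapping.lookup \<rho> w))" unfolding C_def \<rho>[symmetric] c\<nu> by simp
  then have "C w \<noteq> 0" by (metis of_nat_neq_0)
  moreover have "\<delta> (c \<rho> + (\<Sum>v\<in>I. C v * x v)) = g \<rho>"
    by (simp add: g_def deriv_add deriv_sum deriv_mult Cconst) (simp add: C_def mult_ac)
  then have "c \<rho> + (\<Sum>v\<in>I. C v * x v) \<in> E" using g0 const by simp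
  then have "(\<Sum>v\<in>I. C v * x v) \<in> E" using subfield_diff[OF Esf _ cE[of \<rho>]] by fastforce
  ultimately show ?thesis using Cconst wI by blast
qed

text \<open>The classical separant argument: in a relation of least order and then least degree, the
  derivative with respect to the highest jet does not vanish.\<close>

lemma next_jet_in_field_adjoin:
  assumes K: "differential_subfield \<delta> K" and dep: "\<not> alg_independent_family K UNIV (\<lambda>i. (\<delta> ^^ i) y)"
  shows "\<exists>n. (\<delta> ^^ Suc n) y \<in> field_adjoin K ((\<lambda>i. (\<delta> ^^ i) y) ` {..n})"
proof -
  note Ksf = differential_subfieldD(1)[OF K]
  let ?x = "\<lambda>i. (\<delta> ^^ i) y"
  let ?P = "\<lambda>n. \<exists>M c. poly_relation K {..n} ?x M c"
  obtain M1 c1 where M1: "poly_relation K UNIV ?x M1 c1" using ex_poly_relation[OF dep Ksf] by blast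
  let ?V = "\<Union>\<mu>\<in>M1. Poly_Mapping.keys \<mu>"
  have "finite ?V" using M1 by (auto simp: poly_relation_def)
  then have "?V \<subseteq> {..Max ?V}" using Max_ge by blast
  then have "\<And>\<mu>. \<mu> \<in> M1 \<Longrightarrow> Poly_Mapping.keys \<mu> \<subseteq> {..Max ?V}" by blast
  then have "poly_relation K {..Max ?V} ?x M1 c1"
    using M1 unfolding poly_relation_def by simp
  then have exP: "\<exists>n. ?P n" by blast
  define n where "n = (LEAST n. ?P n)"
  have Pn: "?P n" unfolding n_def using exP by (rule LeastI_ex)
  have minn: "n \<le> i" if "?P i" for i unfolding n_def using that by (rule Least_le)
  let ?Q = "\<lambda>N. \<exists>M c. poly_relation K {..n} ?x M c \<and> (\<forall>\<mu>\<in>M. tdeg \<mu> \<le> N)"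
  have "\<exists>N. ?Q N"
  proof -
    obtain M c where M: "poly_relation K {..n} ?x M c" using Pn by blast
    then have "finite M" by (simp add: poly_relation_def)
    then have "\<forall>\<mu>\<in>M. tdeg \<mu> \<le> Max (tdeg ` M)" by auto
    with M show ?thesis by blast
  qed
  define N where "N = (LEAST N. ?Q N)"
  have QN: "?Q N" unfolding N_def using \<open>\<exists>N. ?Q N\<close> by (rule LeastI_ex)
  have minN: "N \<le> i" if "?Q i" for i unfolding N_def using that by (rule Least_le)
  obtain M c where R: "poly_relation K {..n} ?x M c" and degM: "\<forall>\<mu>\<in>M. tdeg \<mu> \<le> N" using QN by blast
  have finM: "finite M" and keysM: "\<And>\<mu>. \<mu> \<in> M \<Longrightarrow> Poly_Mapping.keys \<mu> \<subseteq> {..n}" and M_ne: "M \<noteq> {}"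
    and cK: "\<And>\<mu>. \<mu> \<in> M \<Longrightarrow> c \<mu> \<in> K" "\<And>\<mu>. \<mu> \<in> M \<Longrightarrow> c \<mu> \<noteq> 0" and csum: "(\<Sum>\<mu>\<in>M. c \<mu> * pmon ?x \<mu>) = 0"
    using R by (auto simp: poly_relation_def)
  have "\<exists>\<mu>\<in>M. n \<in> Poly_Mapping.keys \<mu>"
  proof (rule ccontr)
    assume "\<not> ?thesis"
    then have less: "Poly_Mapping.keys \<mu> \<subseteq> {..<n}" if "\<mu> \<in> M" for \<mu>
      using keysM[OF that] that by (force simp: le_less)
    show False
    proof (cases n)
      case 0
      then have "\<forall>\<mu>\<in>M. \<mu> = 0" using less by fastforce
      then show False using poly_relation_deg_pos[OF R] by blast
    next
      case (Suc i)
      then have "{..<n} = {..i}" by auto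
      then have "poly_relation K {..i} ?x M c" using R less unfolding poly_relation_def by simp
      then have "n \<le> i" using minn by blast
      then show False using Suc by simp
    qed
  qed
  then obtain \<mu>0 where \<mu>0: "\<mu>0 \<in> M" "n \<in> Poly_Mapping.keys \<mu>0" by blast
  let ?e = "\<lambda>v. Poly_Mapping.single v (1::nat)"
  let ?M = "\<lambda>v. {\<rho>. \<rho> + ?e v \<in> M}"
  let ?c = "\<lambda>v \<rho>. c (\<rho> + ?e v) * of_nat (Poly_Mapping.lookup \<rho> v + 1)"
  let ?s = "\<lambda>v. \<Sum>\<rho>\<in>?M v. ?c v \<rho> * pmon ?x \<rho>"
  have keys\<rho>: "Poly_Mapping.keys \<rho> \<subseteq> {..n}" if "\<rho> + ?e v \<in> M" for \<rho> v
    using keysM[OF that] unfolding keys_add_nat by blast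
  \<comment> \<open>If the separant \<open>?s n\<close> vanished, it would give a relation in the
    same jets of degree at most \<open>N - 1\<close>. Truncation does no harm: a monomial containing
    \<open>n\<close> forces \<open>N\<close> to be positive.\<close>
  have sep: "?s n \<noteq> 0"
  proof
    assume s0: "?s n = 0"
    obtain \<rho>0 where \<rho>0: "\<mu>0 = \<rho>0 + ?e n" using monomial_split[OF \<mu>0(2)] by blast
    have "poly_relation K {..n} ?x (?M n) (?c n)"
      unfolding poly_relation_def
    proof (intro conjI ballI)
      show "finite (?M n)" by (rule finite_add_monomial_vimage[OF finM])
      show "?M n \<noteq> {}" using \<mu>0 \<rho>0 by blast
      show "?s n = 0" by (rule s0)
    next
      fix \<rho> assume \<rho>: "\<rho> \<in> ?M n"
      then show "Poly_Mapping.keys \<rho> \<subseteq> {..n}" using keys\<rho> by blast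
      show "?c n \<rho> \<in> K" using \<rho> cK(1) by (intro subfield_mult[OF Ksf] subfield_of_nat[OF Ksf]) blast
      show "?c n \<rho> \<noteq> 0" using \<rho> cK(2) of_nat_neq_0[of "Poly_Mapping.lookup \<rho> n"] by simp
    qed
    moreover have "\<forall>\<rho>\<in>?M n. tdeg \<rho> \<le> N - 1"
    proof
      fix \<rho> assume "\<rho> \<in> ?M n"
      then have "tdeg (\<rho> + ?e n) \<le> N" using degM by blast
      then show "tdeg \<rho> \<le> N - 1" by (simp add: tdeg_add)
    qed
    ultimately have "N \<le> N - 1" by (intro minN) blast
    moreover have "tdeg (\<rho>0 + ?e n) \<le> N" using degM \<mu>0 \<rho>0 by blast
    ultimately show False by (simp add: tdeg_add)
  qed
  let ?L = "field_adjoin K (?x ` {..n})"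
  have L: "is_subfield ?L" by (rule is_subfield_field_adjoin)
  have KL: "K \<subseteq> ?L" by (rule field_adjoin_base)
  have xL: "?x i \<in> ?L" if "i \<le> n" for i using that field_adjoin_gens[of "?x ` {..n}" K] by auto
  have pmonL: "pmon ?x \<rho> \<in> ?L" if "Poly_Mapping.keys \<rho> \<subseteq> {..n}" for \<rho>
    using that xL by (intro subfield_pmon[OF L]) auto
  have sL: "?s v \<in> ?L" for v
    using cK(1) KL keys\<rho> pmonL
    by (intro subfield_sum[OF L] subfield_mult[OF L] subfield_of_nat[OF L]) blast+
  \<comment> \<open>The differentiated relation without \<open>\<delta> (?x n) * ?s n\<close>, its
    only term that reaches beyond order \<open>n\<close>.\<close>
  define A where "A = (\<Sum>\<mu>\<in>M. \<delta> (c \<mu>) * pmon ?x \<mu>) + (\<Sum>v<n. \<delta> (?x v) * ?s v)"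
  have "A \<in> ?L"
  proof -
    have "(\<Sum>\<mu>\<in>M. \<delta> (c \<mu>) * pmon ?x \<mu>) \<in> ?L"
      using differential_subfieldD(2)[OF K] cK(1) KL keysM pmonL
      by (intro subfield_sum[OF L] subfield_mult[OF L]) blast+
    moreover have "\<delta> (?x v) * ?s v \<in> ?L" if "v < n" for v
      using subfield_mult[OF L xL[of "Suc v"] sL] that by simp
    then have "(\<Sum>v<n. \<delta> (?x v) * ?s v) \<in> ?L" by (intro subfield_sum[OF L]) simp
    ultimately show ?thesis unfolding A_def by (rule subfield_add[OF L])
  qed
  have "\<delta> (\<Sum>\<mu>\<in>M. c \<mu> * pmon ?x \<mu>) = (\<Sum>\<mu>\<in>M. \<delta> (c \<mu>) * pmon ?x \<mu>) + (\<Sum>v\<le>n. \<delta> (?x v) * ?s v)"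
    by (rule deriv_sum_pmon[OF _ finM keysM]) auto
  also have "(\<Sum>v\<le>n. \<delta> (?x v) * ?s v) = (\<Sum>v<n. \<delta> (?x v) * ?s v) + \<delta> (?x n) * ?s n"
    unfolding lessThan_Suc_atMost[symmetric] by (rule sum.lessThan_Suc)
  finally have "A + \<delta> (?x n) * ?s n = 0" using csum by (simp add: A_def add.assoc)
  then have "\<delta> (?x n) = - A / ?s n" using sep by (simp add: field_simps eq_neg_iff_add_eq_0)
  then have "\<delta> (?x n) \<in> ?L"
    using subfield_divide[OF L subfield_uminus[OF L \<open>A \<in> ?L\<close>] sL[of n]] by simp
  then show ?thesis by (intro exI[of _ n]) simp
qed

section \<open>The differentially algebraic hull\<close>

text \<open>The elements of differential fields that are finitely generated over \<open>k\<close> as fields; this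
  replaces the closure of \<open>k\<close> under elements of finite transcendence degree and needs no algebraic
  closures.\<close>

definition deriv_closed_gens :: "'a set \<Rightarrow> 'a set \<Rightarrow> bool" where
  "deriv_closed_gens k T \<longleftrightarrow> finite T \<and> \<delta> ` T \<subseteq> field_adjoin k T"

definition dalg :: "'a set \<Rightarrow> 'a set" where
  "dalg k = {x. \<exists>T. deriv_closed_gens k T \<and> x \<in> field_adjoin k T}"

lemma deriv_closed_gens_Un:
  assumes "deriv_closed_gens k T" "deriv_closed_gens k T'"
  shows "deriv_closed_gens k (T \<union> T')"
  using assms field_adjoin_mono[of T "T \<union> T'" k] field_adjoin_mono[of T' "T \<union> T'" k]
  unfolding deriv_closed_gens_def by auto

lemma deriv_closed_gens_UN:
  assumes "finite A" "\<And>a. a \<in> A \<Longrightarrow> deriv_closed_gens k (T a)"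
  shows "deriv_closed_gens k (\<Union>a\<in>A. T a)"
  using assms
proof (induction A rule: finite_induct)
  case (insert a A)
  then show ?case using deriv_closed_gens_Un by simp
qed (simp add: deriv_closed_gens_def)

lemma finite_subset_dalg:
  assumes "finite A" "A \<subseteq> dalg k"
  obtains T where "deriv_closed_gens k T" "A \<subseteq> field_adjoin k T"
proof -
  have "\<forall>a\<in>A. \<exists>T. deriv_closed_gens k T \<and> a \<in> field_adjoin k T"
    using assms(2) unfolding dalg_def by blast
  then obtain T where T: "\<And>a. a \<in> A \<Longrightarrow> deriv_closed_gens k (T a)" "\<And>a. a \<in> A \<Longrightarrow> a \<in> field_adjoin k (T a)"
    by metis
  show thesis
  proof (rule that)
    show "deriv_closed_gens k (\<Union>a\<in>A. T a)" using assms(1) T(1) by (rule deriv_closed_gens_UN)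
    show "A \<subseteq> field_adjoin k (\<Union>a\<in>A. T a)"
    proof
      fix a assume "a \<in> A"
      then show "a \<in> field_adjoin k (\<Union>a\<in>A. T a)"
        using T(2)[of a] field_adjoin_mono[of "T a" "\<Union>a\<in>A. T a" k] by blast
    qed
  qed
qed

text \<open>The case \<open>Z = {}\<close> says that \<open>dalg k\<close> is a subfield.\<close>

lemma is_subfield_adjoin_to_dalg:
  "is_subfield {x. \<exists>T. deriv_closed_gens k T \<and> x \<in> field_adjoin k (T \<union> Z)}" (is "is_subfield ?L")
  unfolding is_subfield_def
proof (intro conjI ballI)
  note sf = is_subfield_field_adjoin
  have LI: "x \<in> ?L" if "deriv_closed_gens k T" "x \<in> field_adjoin k (T \<union> Z)" for x T using that by blast
  have emp: "deriv_closed_gens k {}" by (simp add: deriv_closed_gens_def)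
  show "0 \<in> ?L" "1 \<in> ?L" by (rule LI[OF emp subfield_0[OF sf]], rule LI[OF emp subfield_1[OF sf]])
  fix x assume "x \<in> ?L"
  then obtain T where T: "deriv_closed_gens k T" "x \<in> field_adjoin k (T \<union> Z)" by blast
  show "- x \<in> ?L" "inverse x \<in> ?L"
    by (rule LI[OF T(1) subfield_uminus[OF sf T(2)]], rule LI[OF T(1) subfield_inverse[OF sf T(2)]])
  fix y assume "y \<in> ?L"
  then obtain T' where T': "deriv_closed_gens k T'" "y \<in> field_adjoin k (T' \<union> Z)" by blast
  have xy: "x \<in> field_adjoin k (T \<union> T' \<union> Z)" "y \<in> field_adjoin k (T \<union> T' \<union> Z)"
    using T(2) T'(2) field_adjoin_mono[of "T \<union> Z" "T \<union> T' \<union> Z" k]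
      field_adjoin_mono[of "T' \<union> Z" "T \<union> T' \<union> Z" k] by auto
  note TT = deriv_closed_gens_Un[OF T(1) T'(1)]
  show "x + y \<in> ?L" "x * y \<in> ?L"
    by (rule LI[OF TT subfield_add[OF sf xy]], rule LI[OF TT subfield_mult[OF sf xy]])
qed

lemma differential_subfield_dalg:
  assumes "differential_subfield \<delta> k"
  shows "differential_subfield \<delta> (dalg k)"
  unfolding differential_subfield_def
proof (intro conjI ballI)
  show "is_subfield (dalg k)"
    using is_subfield_adjoin_to_dalg[of k "{}"] by (simp add: dalg_def)
  fix x assume "x \<in> dalg k"
  then obtain T where T: "deriv_closed_gens k T" "x \<in> field_adjoin k T" unfolding dalg_def by blast
  have "\<delta> ` k \<subseteq> field_adjoin k T"
    using differential_subfieldD(2)[OF assms] field_adjoin_base[of k T] by blast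
  then have "differential_subfield \<delta> (field_adjoin k T)"
    using T(1) by (intro differential_subfield_field_adjoin) (auto simp: deriv_closed_gens_def)
  then show "\<delta> x \<in> dalg k"
    using differential_subfieldD(2) T unfolding dalg_def by blast
qed

lemma dalg_base: "k \<subseteq> dalg k"
  unfolding dalg_def using field_adjoin_base[of k "{}"]
  by (auto simp: deriv_closed_gens_def intro!: exI[of _ "{}"])

text \<open>A constant generates over \<open>k\<close> by itself a field with derivation-closed
  generators, even if it is transcendental over \<open>k\<close>. This provides the hypothesis on
  constants in \<open>ostrowski\<close>.\<close>

lemma dalg_constant:
  assumes "\<delta> c = 0" shows "c \<in> dalg k"
proof -
  have "deriv_closed_gens k {c}"
    using assms subfield_0[OF is_subfield_field_adjoin] by (simp add: deriv_closed_gens_def)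
  then show ?thesis using field_adjoin_gens[of "{c}" k] unfolding dalg_def by blast
qed

text \<open>Closure under repetition: the derivatives of the finitely many elements of
  \<open>Z\<close> use only finitely many generators of \<open>dalg k\<close>, and these together
  with \<open>Z\<close> are derivation-closed over \<open>k\<close> itself.\<close>

lemma dalg_closed:
  assumes "finite Z" "\<delta> ` Z \<subseteq> field_adjoin (dalg k) Z"
  shows "Z \<subseteq> dalg k"
proof -
  let ?L = "{x. \<exists>T. deriv_closed_gens k T \<and> x \<in> field_adjoin k (T \<union> Z)}"
  have "dalg k \<subseteq> ?L"
  proof
    fix x assume "x \<in> dalg k"
    then obtain T where T: "deriv_closed_gens k T" "x \<in> field_adjoin k T" unfolding dalg_def by blast
    then have "x \<in> field_adjoin k (T \<union> Z)" using field_adjoin_mono[of T "T \<union> Z" k] by auto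
    then show "x \<in> ?L" using T(1) by blast
  qed
  moreover have "Z \<subseteq> ?L"
  proof
    fix x assume "x \<in> Z"
    then have "x \<in> field_adjoin k ({} \<union> Z)" using field_adjoin_gens[of Z k] by auto
    moreover have "deriv_closed_gens k {}" by (simp add: deriv_closed_gens_def)
    ultimately show "x \<in> ?L" by blast
  qed
  ultimately have "field_adjoin (dalg k) Z \<subseteq> ?L"
    by (rule field_adjoin_least[OF is_subfield_adjoin_to_dalg])
  then have "\<forall>z\<in>Z. \<exists>T. deriv_closed_gens k T \<and> \<delta> z \<in> field_adjoin k (T \<union> Z)"
    using assms(2) by blast
  then obtain T where T: "\<And>z. z \<in> Z \<Longrightarrow> deriv_closed_gens k (T z)"
    "\<And>z. z \<in> Z \<Longrightarrow> \<delta> z \<in> field_adjoin k (T z \<union> Z)" by metis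
  let ?T = "\<Union>z\<in>Z. T z"
  have good: "deriv_closed_gens k ?T" using assms(1) T(1) by (rule deriv_closed_gens_UN)
  have "\<delta> z \<in> field_adjoin k (?T \<union> Z)" if "z \<in> Z" for z
    using T(2)[OF that] field_adjoin_mono[of "T z \<union> Z" "?T \<union> Z" k] that by blast
  moreover have "\<delta> ` ?T \<subseteq> field_adjoin k (?T \<union> Z)" "finite ?T"
    using good field_adjoin_mono[of ?T "?T \<union> Z" k] unfolding deriv_closed_gens_def by blast+
  ultimately have "deriv_closed_gens k (?T \<union> Z)"
    using assms(1) unfolding deriv_closed_gens_def by blast
  then show ?thesis using field_adjoin_gens[of "?T \<union> Z" k] unfolding dalg_def by blast
qed

text \<open>Once a jet is rational in its predecessors, the predecessors form a finite
  derivation-closed family over \<open>dalg k\<close>. Contrapositively, an element outside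
  \<open>dalg k\<close> has jets independent over \<open>dalg k\<close>, not merely over
  \<open>k\<close>.\<close>

lemma dalg_of_dependent_jets:
  assumes k: "differential_subfield \<delta> k"
    and dep: "\<not> alg_independent_family (dalg k) UNIV (\<lambda>i. (\<delta> ^^ i) y)"
  shows "y \<in> dalg k"
proof -
  let ?x = "\<lambda>i. (\<delta> ^^ i) y"
  obtain n where n: "?x (Suc n) \<in> field_adjoin (dalg k) (?x ` {..n})"
    using next_jet_in_field_adjoin[OF differential_subfield_dalg[OF k] dep] by blast
  have "?x ` {..n} \<subseteq> dalg k"
  proof (rule dalg_closed)
    show "\<delta> ` ?x ` {..n} \<subseteq> field_adjoin (dalg k) (?x ` {..n})"
    proof (clarsimp)
      fix i assume "i \<le> n"
      then consider "Suc i \<le> n" | "i = n" by linarith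
      then show "\<delta> (?x i) \<in> field_adjoin (dalg k) (?x ` {..n})"
      proof cases
        case 1
        then have "?x (Suc i) \<in> ?x ` {..n}" by blast
        then show ?thesis using field_adjoin_gens[of "?x ` {..n}" "dalg k"] by auto
      qed (use n in simp)
    qed
  qed simp
  then show ?thesis using image_eqI[of y ?x 0 "{..n}"] by auto
qed

text \<open>The first jets of \<open>e\<close> outnumber the jets of \<open>w\<close> over which they are rational, so \<open>e\<close>, and
  with it \<open>w\<close>, is differentially algebraic.\<close>

lemma dalg_if_rational_primitive_of_multiple:
  assumes k: "differential_subfield \<delta> k" and e: "e \<in> field_adjoin (dalg k) (range (\<lambda>i. (\<delta> ^^ i) w))"
    and eq: "\<delta> e = u * w" and u: "u \<in> dalg k" "u \<noteq> 0"
  shows "w \<in> dalg k"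
proof -
  let ?K = "dalg k" and ?x = "\<lambda>i. (\<delta> ^^ i) w"
  note K = differential_subfield_dalg[OF k]
  note Ksf = differential_subfieldD(1)[OF K]
  obtain T where T: "finite T" "T \<subseteq> range ?x" "e \<in> field_adjoin ?K T"
    by (rule field_adjoin_finite_support[OF e])
  obtain B where B: "finite B" "T = ?x ` B" using finite_subset_image[OF T(1,2)] by blast
  define t where "t = (if B = {} then 0 else Max B)"
  have "B \<subseteq> {..t}" using B(1) by (auto simp: t_def)
  then have e0: "e \<in> field_adjoin ?K (?x ` {..t})"
    using T(3) field_adjoin_mono[of T "?x ` {..t}" ?K] B(2) by blast
  \<comment> \<open>As \<open>\<delta> e = u * w\<close>, the derivative of order
    \<open>i + 1\<close> of \<open>e\<close> involves \<open>w\<close> only up to order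
    \<open>i\<close>, whatever the order \<open>t\<close> of \<open>w\<close> in \<open>e\<close>
    itself.\<close>
  have jets: "(\<delta> ^^ Suc i) e \<in> field_adjoin ?K (?x ` {..i})" for i
  proof (induction i)
    case 0
    have "w \<in> field_adjoin ?K (?x ` {..0})"
      using field_adjoin_gens[of "?x ` {..0}" ?K] by simp
    moreover have "u \<in> field_adjoin ?K (?x ` {..0})" using u(1) field_adjoin_base[of ?K] by blast
    ultimately have "u * w \<in> field_adjoin ?K (?x ` {..0})"
      by (intro subfield_mult[OF is_subfield_field_adjoin])
    then show ?case by (simp add: eq)
  next
    case (Suc i)
    let ?M = "field_adjoin ?K (?x ` {..Suc i})"
    have "\<delta> ` field_adjoin ?K (?x ` {..i}) \<subseteq> ?M"
    proof (rule deriv_field_adjoin_subset[OF is_subfield_field_adjoin])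
      show "field_adjoin ?K (?x ` {..i}) \<subseteq> ?M" by (intro field_adjoin_mono image_mono) auto
      show "\<delta> ` ?K \<subseteq> ?M" using differential_subfieldD(2)[OF K] field_adjoin_base[of ?K] by blast
      have "\<delta> ` ?x ` {..i} \<subseteq> ?x ` {..Suc i}"
      proof clarify
        fix j assume "j \<le> i"
        then show "\<delta> (?x j) \<in> ?x ` {..Suc i}" by (intro image_eqI[of _ _ "Suc j"]) auto
      qed
      then show "\<delta> ` ?x ` {..i} \<subseteq> ?M" using field_adjoin_gens[of "?x ` {..Suc i}" ?K] by blast
    qed
    then show ?case using Suc by auto
  qed
  have e_in: "(\<delta> ^^ i) e \<in> field_adjoin ?K (?x ` {..t})" if "i \<le> Suc t" for i
  proof (cases i)
    case (Suc j)
    have "field_adjoin ?K (?x ` {..j}) \<subseteq> field_adjoin ?K (?x ` {..t})"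
      using that Suc by (intro field_adjoin_mono image_mono) auto
    then show ?thesis using jets[of j] Suc by blast
  qed (use e0 in simp)
  \<comment> \<open>The jets of \<open>e\<close> of orders 0 to \<open>t + 1\<close> are
    \<open>t + 2\<close> in number, against at most \<open>t + 1\<close> generators.\<close>
  have "card (?x ` {..t}) < card {..Suc t}"
    using card_image_le[of "{..t}" ?x] by simp
  then have "\<not> alg_independent_family ?K {..Suc t} (\<lambda>i. (\<delta> ^^ i) e)"
    using e_in by (intro not_alg_independent_if_few_generators[OF Ksf, of "?x ` {..t}"]) auto
  then have "\<not> alg_independent_family ?K UNIV (\<lambda>i. (\<delta> ^^ i) e)"
    unfolding alg_independent_family_def by blast
  then have "e \<in> ?K" by (rule dalg_of_dependent_jets[OF k])
  then have "u * w \<in> ?K" using differential_subfieldD(2)[OF K] eq by metis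
  then have "u * w / u \<in> ?K" using subfield_divide[OF Ksf] u by blast
  then show ?thesis using u(2) by simp
qed

section \<open>Linear differential operators\<close>

text \<open>Blum's axiom for linear \<open>f\<close> and \<open>g\<close>: \<open>a N\<close> fixes
  the order of \<open>f\<close>, while \<open>n\<close> merely bounds the order of \<open>g\<close>
  and \<open>c i\<close> keeps \<open>g\<close> nonzero.\<close>

lemma differentially_closed_linear:
  assumes dc: "differentially_closed \<delta>" and "a N \<noteq> 0" "n < N" "i \<le> n" "c i \<noteq> 0"
  shows "\<exists>u. (\<Sum>i\<le>N. a i * (\<delta> ^^ i) u) = 0 \<and> (\<Sum>i\<le>n. c i * (\<delta> ^^ i) u) \<noteq> 0"
proof -
  let ?e = "\<lambda>i. Poly_Mapping.single ((), i::nat) (1::nat)"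
  have inj: "inj_on ?e A" for A
  proof
    fix i j assume "?e i = ?e j"
    then have "Poly_Mapping.keys (?e i) = Poly_Mapping.keys (?e j)" by simp
    then show "i = j" by simp
  qed
  have lin: "\<exists>f :: (unit, 'a) dpol. pvars f = {((), i) | i. i \<le> n \<and> a i \<noteq> 0} \<and>
      (\<forall>u. dpeval \<delta> f (\<lambda>_. u) = (\<Sum>i\<le>n. a i * (\<delta> ^^ i) u))" for a :: "nat \<Rightarrow> 'a" and n
  proof -
    define d where "d \<mu> = a (the_inv_into UNIV ?e \<mu>)" for \<mu>
    have d: "d (?e i) = a i" for i unfolding d_def using the_inv_into_f_f[OF inj UNIV_I, of i] by (simp only:)
    obtain f where kf: "Poly_Mapping.keys f = {\<mu>\<in>?e ` {..n}. d \<mu> \<noteq> 0}"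
      and pf: "\<And>x. peval f x = (\<Sum>\<mu>\<in>?e ` {..n}. d \<mu> * pmon x \<mu>)"
      by (rule mpol_of_coeffs[of "?e ` {..n}" d]) auto
    have "pvars f = {((), i) | i. i \<le> n \<and> a i \<noteq> 0}"
      unfolding pvars_def kf by (auto simp: d[simplified])
    moreover have "dpeval \<delta> f (\<lambda>_. u) = (\<Sum>i\<le>n. a i * (\<delta> ^^ i) u)" for u
      unfolding dpeval_def pf sum.reindex[OF inj] by (simp add: d[simplified] jet_def)
    ultimately show ?thesis by blast
  qed
  obtain f where f: "pvars f = {((), i) | i. i \<le> N \<and> a i \<noteq> 0}"
    "\<And>u. dpeval \<delta> f (\<lambda>_. u) = (\<Sum>i\<le>N. a i * (\<delta> ^^ i) u)" using lin[of N a] by blast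
  obtain g where g: "pvars g = {((), i) | i. i \<le> n \<and> c i \<noteq> 0}"
    "\<And>u. dpeval \<delta> g (\<lambda>_. u) = (\<Sum>i\<le>n. c i * (\<delta> ^^ i) u)" using lin[of n c] by blast
  have fin: "finite (pvars f)" "finite (pvars g)" unfolding f(1) g(1) by simp_all
  have "((), i) \<in> pvars g" unfolding g(1) using assms by blast
  then have "g \<noteq> 0" by (auto simp: pvars_def)
  moreover have "((), N) \<in> pvars f" unfolding f(1) using assms by blast
  then have "int N \<le> dorder f" unfolding dorder_def using fin by (intro Max_ge) force+
  moreover have "dorder g \<le> int n" unfolding dorder_def using fin g(1) by (subst Max_le_iff) auto
  ultimately have "\<exists>u. dpeval \<delta> f (\<lambda>_. u) = 0 \<and> dpeval \<delta> g (\<lambda>_. u) \<noteq> 0"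
    using dc \<open>n < N\<close> unfolding differentially_closed_def by simp
  then show ?thesis unfolding f(2) g(2) .
qed

text \<open>For \<open>L z = (\<Sum>i\<le>Suc g. b i * z\<^sup>(\<^sup>i\<^sup>))\<close> and \<open>u\<close> in the kernel of the adjoint of \<open>L\<close>, the
  bilinear concomitant of \<open>u\<close> and \<open>z\<close> is \<open>\<Sum>s\<le>g. adj b g s u * z\<^sup>(\<^sup>g\<^sup>-\<^sup>s\<^sup>)\<close>.\<close>

primrec adj :: "(nat \<Rightarrow> 'a) \<Rightarrow> nat \<Rightarrow> nat \<Rightarrow> 'a \<Rightarrow> 'a" where
  "adj b g 0 u = b (Suc g) * u"
| "adj b g (Suc s) u = b (g - s) * u - \<delta> (adj b g s u)"

text \<open>One further step of the recursion,
  \<open>adj b g (Suc g) u = b 0 * u - \<delta> (adj b g g u)\<close>, is the full adjoint operator;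
  the condition is its vanishing at \<open>u\<close>.\<close>

definition adj_kernel :: "(nat \<Rightarrow> 'a) \<Rightarrow> nat \<Rightarrow> 'a set" where
  "adj_kernel b g = {u. \<delta> (adj b g g u) = b 0 * u}"

definition concomitant :: "(nat \<Rightarrow> 'a) \<Rightarrow> nat \<Rightarrow> 'a \<Rightarrow> 'a \<Rightarrow> 'a" where
  "concomitant b g u z = (\<Sum>s\<le>g. adj b g s u * (\<delta> ^^ (g - s)) z)"

text \<open>Lagrange's identity. The recursion for \<open>adj\<close> makes the terms of the two
  sums from the product rule cancel, and the kernel condition supplies the last term, at
  \<open>s = g\<close>.\<close>

lemma deriv_concomitant:
  assumes "u \<in> adj_kernel b g"
  shows "\<delta> (concomitant b g u z) = u * (\<Sum>i\<le>Suc g. b i * (\<delta> ^^ i) z)"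
proof -
  let ?p = "\<lambda>s. adj b g s u"
  let ?A = "\<Sum>s<g. ?p (Suc s) * (\<delta> ^^ (g - s)) z"
  have "(\<Sum>s\<le>g. \<delta> (?p s) * (\<delta> ^^ (g - s)) z) =
      (\<Sum>s<g. \<delta> (?p s) * (\<delta> ^^ (g - s)) z) + b 0 * u * z"
    using assms by (simp add: adj_kernel_def flip: lessThan_Suc_atMost)
  also have "(\<Sum>s<g. \<delta> (?p s) * (\<delta> ^^ (g - s)) z) = (\<Sum>s<g. b (g - s) * u * (\<delta> ^^ (g - s)) z) - ?A"
    by (simp add: algebra_simps flip: sum.distrib)
  also have "(\<Sum>s<g. b (g - s) * u * (\<delta> ^^ (g - s)) z) - ?A + b 0 * u * z =
      (\<Sum>s\<le>g. b (g - s) * u * (\<delta> ^^ (g - s)) z) - ?A"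
    by (simp flip: lessThan_Suc_atMost)
  also have "(\<Sum>s\<le>g. b (g - s) * u * (\<delta> ^^ (g - s)) z) = (\<Sum>i\<le>g. b i * u * (\<delta> ^^ i) z)"
    by (rule sum.reindex_bij_witness[of _ "\<lambda>i. g - i" "\<lambda>i. g - i"]) auto
  finally have 1: "(\<Sum>s\<le>g. \<delta> (?p s) * (\<delta> ^^ (g - s)) z) = (\<Sum>i\<le>g. b i * u * (\<delta> ^^ i) z) - ?A" .
  have "(\<Sum>s\<le>g. ?p s * \<delta> ((\<delta> ^^ (g - s)) z)) = ?p 0 * \<delta> ((\<delta> ^^ g) z) + (\<Sum>s<g. ?p (Suc s) * \<delta> ((\<delta> ^^ (g - Suc s)) z))"
    by (subst sum.atMost_shift) simp
  also have "(\<Sum>s<g. ?p (Suc s) * \<delta> ((\<delta> ^^ (g - Suc s)) z)) = ?A"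
  proof (rule sum.cong[OF refl])
    fix s assume "s \<in> {..<g}"
    then have "g - s = Suc (g - Suc s)" by auto
    then show "?p (Suc s) * \<delta> ((\<delta> ^^ (g - Suc s)) z) = ?p (Suc s) * (\<delta> ^^ (g - s)) z" by simp
  qed
  finally have 2: "(\<Sum>s\<le>g. ?p s * \<delta> ((\<delta> ^^ (g - s)) z)) = b (Suc g) * u * (\<delta> ^^ Suc g) z + ?A" by simp
  have "\<delta> (concomitant b g u z) =
      (\<Sum>s\<le>g. \<delta> (?p s) * (\<delta> ^^ (g - s)) z) + (\<Sum>s\<le>g. ?p s * \<delta> ((\<delta> ^^ (g - s)) z))"
    by (simp add: concomitant_def deriv_sum deriv_mult sum.distrib)
  also have "\<dots> = (\<Sum>i\<le>g. b i * u * (\<delta> ^^ i) z) + b (Suc g) * u * (\<delta> ^^ Suc g) z"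
    unfolding 1 2 by simp
  finally show ?thesis by (simp add: sum_distrib_left distrib_left mult_ac)
qed

section \<open>Fundamental systems of adjoint solutions\<close>

lemma adj_const_lincomb:
  assumes "finite A" "\<And>l. l \<in> A \<Longrightarrow> \<delta> (C l) = 0"
  shows "adj b g s (\<Sum>l\<in>A. C l * u l) = (\<Sum>l\<in>A. C l * adj b g s (u l))"
proof (induction s)
  case 0
  then show ?case by (simp add: sum_distrib_left mult_ac)
next
  case (Suc s)
  have "\<delta> (\<Sum>l\<in>A. C l * adj b g s (u l)) = (\<Sum>l\<in>A. C l * \<delta> (adj b g s (u l)))"
    unfolding deriv_sum using assms(2) by (intro sum.cong) (auto simp: deriv_mult)
  then show ?case
    by (simp add: Suc sum_distrib_left right_diff_distrib mult_ac sum_subtractf)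
qed

lemma adj_kernel_const_lincomb:
  assumes "finite A" "\<And>l. l \<in> A \<Longrightarrow> \<delta> (C l) = 0" "\<And>l. l \<in> A \<Longrightarrow> u l \<in> adj_kernel b g"
  shows "(\<Sum>l\<in>A. C l * u l) \<in> adj_kernel b g"
proof -
  have "\<delta> (\<Sum>l\<in>A. C l * adj b g g (u l)) = (\<Sum>l\<in>A. C l * \<delta> (adj b g g (u l)))"
    unfolding deriv_sum using assms(2) by (intro sum.cong) (auto simp: deriv_mult)
  also have "\<dots> = b 0 * (\<Sum>l\<in>A. C l * u l)"
    using assms(3) by (simp add: adj_kernel_def sum_distrib_left mult_ac)
  finally show ?thesis
    by (simp add: adj_kernel_def adj_const_lincomb[OF assms(1,2)])
qed

lemma deriv_linear_operator:
  "\<exists>a'. a' (Suc s) = a s \<and>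
    (\<forall>u. \<delta> (\<Sum>i\<le>s. a i * (\<delta> ^^ i) u) = (\<Sum>i\<le>Suc s. a' i * (\<delta> ^^ i) u))"
proof -
  define a' where "a' i = (if i \<le> s then \<delta> (a i) else 0) + (case i of 0 \<Rightarrow> 0 | Suc j \<Rightarrow> a j)" for i
  have "(\<Sum>i\<le>Suc s. a' i * (\<delta> ^^ i) u) = \<delta> (\<Sum>i\<le>s. a i * (\<delta> ^^ i) u)" for u
  proof -
    have "(\<Sum>i\<le>Suc s. a' i * (\<delta> ^^ i) u) =
        (\<Sum>i\<le>Suc s. (if i \<le> s then \<delta> (a i) else 0) * (\<delta> ^^ i) u) +
        (\<Sum>i\<le>Suc s. (case i of 0 \<Rightarrow> 0 | Suc j \<Rightarrow> a j) * (\<delta> ^^ i) u)"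
      unfolding a'_def distrib_right sum.distrib ..
    also have "(\<Sum>i\<le>Suc s. (if i \<le> s then \<delta> (a i) else 0) * (\<delta> ^^ i) u) = (\<Sum>i\<le>s. \<delta> (a i) * (\<delta> ^^ i) u)"
      by simp
    also have "(\<Sum>i\<le>Suc s. (case i of 0 \<Rightarrow> 0 | Suc j \<Rightarrow> a j) * (\<delta> ^^ i) u) = (\<Sum>i\<le>s. a i * (\<delta> ^^ Suc i) u)"
      by (subst sum.atMost_Suc_shift) simp
    finally show ?thesis by (simp add: deriv_sum deriv_mult sum.distrib)
  qed
  moreover have "a' (Suc s) = a s" by (simp add: a'_def)
  ultimately show ?thesis by metis
qed

text \<open>Each recursion step differentiates once: the order rises by exactly one and the leading
  coefficient, initially \<open>b (Suc g)\<close>, only changes sign.\<close>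

lemma adj_linear_operator:
  assumes "b (Suc g) \<noteq> 0"
  shows "\<exists>a. a s \<noteq> 0 \<and> (\<forall>u. adj b g s u = (\<Sum>i\<le>s. a i * (\<delta> ^^ i) u))"
proof (induction s)
  case 0
  show ?case using assms by (intro exI[of _ "\<lambda>_. b (Suc g)"]) simp
next
  case (Suc s)
  then obtain a where a: "a s \<noteq> 0" "\<And>u. adj b g s u = (\<Sum>i\<le>s. a i * (\<delta> ^^ i) u)" by blast
  obtain a' where a': "a' (Suc s) = a s"
    "\<And>u. \<delta> (\<Sum>i\<le>s. a i * (\<delta> ^^ i) u) = (\<Sum>i\<le>Suc s. a' i * (\<delta> ^^ i) u)"
    using deriv_linear_operator[of s a] by blast
  define c where "c i = (if i = 0 then b (g - s) else 0) - a' i" for i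
  have "adj b g (Suc s) u = (\<Sum>i\<le>Suc s. c i * (\<delta> ^^ i) u)" for u
  proof -
    have "(\<Sum>i\<le>Suc s. c i * (\<delta> ^^ i) u) =
        (\<Sum>i\<le>Suc s. (if i = 0 then b (g - s) else 0) * (\<delta> ^^ i) u) - (\<Sum>i\<le>Suc s. a' i * (\<delta> ^^ i) u)"
      unfolding c_def left_diff_distrib sum_subtractf ..
    also have "(\<Sum>i\<le>Suc s. (if i = 0 then b (g - s) else 0) * (\<delta> ^^ i) u) = b (g - s) * u"
      by (subst sum.atMost_Suc_shift) simp
    finally show ?thesis by (simp only: adj.simps a a')
  qed
  moreover have "c (Suc s) \<noteq> 0" using a(1) a'(1) by (simp add: c_def)
  ultimately show ?case by metis
qed

text \<open>Since \<open>adj b g i\<close> has order exactly \<open>i\<close>, a nontrivial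
  combination is a nonzero operator of order at most \<open>g\<close>, below the order
  \<open>Suc g\<close> of the adjoint equation, so Blum's axiom applies.\<close>

lemma ex_adj_kernel_avoiding:
  assumes dc: "differentially_closed \<delta>" and b: "b (Suc g) \<noteq> 0" and r: "r \<le> g"
    and "\<exists>i\<le>r. c i \<noteq> 0"
  shows "\<exists>u\<in>adj_kernel b g. (\<Sum>i\<le>r. c i * adj b g i u) \<noteq> 0"
proof -
  have "\<forall>s. \<exists>a. a s \<noteq> 0 \<and> (\<forall>u. adj b g s u = (\<Sum>i\<le>s. a i * (\<delta> ^^ i) u))"
    using adj_linear_operator[of b g, OF b] by blast
  then obtain a where a: "\<And>s. a s s \<noteq> 0" "\<And>s u. adj b g s u = (\<Sum>i\<le>s. a s i * (\<delta> ^^ i) u)"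
    by metis
  obtain a' where a': "a' (Suc g) = a g g"
    "\<And>u. \<delta> (\<Sum>i\<le>g. a g i * (\<delta> ^^ i) u) = (\<Sum>i\<le>Suc g. a' i * (\<delta> ^^ i) u)"
    using deriv_linear_operator[of g "a g"] by blast
  define f where "f i = a' i - (if i = 0 then b 0 else 0)" for i
  have f: "(\<Sum>i\<le>Suc g. f i * (\<delta> ^^ i) u) = \<delta> (adj b g g u) - b 0 * u" for u
  proof -
    have "(\<Sum>i\<le>Suc g. (if i = 0 then b 0 else 0) * (\<delta> ^^ i) u) = b 0 * u"
      by (subst sum.atMost_Suc_shift) simp
    then show ?thesis unfolding f_def left_diff_distrib sum_subtractf a(2) a'(2) by simp
  qed
  define A where "A s i = (if i \<le> s then a s i else 0)" for s i
  have A: "adj b g s u = (\<Sum>i\<le>r. A s i * (\<delta> ^^ i) u)" if "s \<le> r" for s u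
    unfolding a(2) using that by (intro sum.mono_neutral_cong_left) (auto simp: A_def)
  define d where "d i = (\<Sum>s\<le>r. c s * A s i)" for i
  have d: "(\<Sum>i\<le>r. d i * (\<delta> ^^ i) u) = (\<Sum>s\<le>r. c s * adj b g s u)" for u
  proof -
    have "(\<Sum>s\<le>r. c s * adj b g s u) = (\<Sum>s\<le>r. \<Sum>i\<le>r. c s * A s i * (\<delta> ^^ i) u)"
      using A by (intro sum.cong) (auto simp: sum_distrib_left mult.assoc)
    also have "\<dots> = (\<Sum>i\<le>r. d i * (\<delta> ^^ i) u)"
      unfolding d_def sum_distrib_right by (rule sum.swap)
    finally show ?thesis ..
  qed
  \<comment> \<open>At the largest index with nonzero \<open>c\<close>, only one summand contributes
    to order \<open>n\<close>, so \<open>d n = c n * a n n\<close>.\<close>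
  define n where "n = (GREATEST i. i \<le> r \<and> c i \<noteq> 0)"
  have n: "n \<le> r \<and> c n \<noteq> 0" unfolding n_def using assms(4)
    by (intro GreatestI_ex_nat[where P = "\<lambda>i. i \<le> r \<and> c i \<noteq> 0" and b = r]) auto
  have n_max: "i \<le> n" if "i \<le> r" "c i \<noteq> 0" for i
    unfolding n_def using that
    by (intro Greatest_le_nat[where P = "\<lambda>i. i \<le> r \<and> c i \<noteq> 0" and b = r]) auto
  have "c s * A s n = (if s = n then c n * a n n else 0)" if "s \<le> r" for s
    using n_max[of s] that by (cases "c s = 0") (auto simp: A_def)
  then have "d n = (\<Sum>s\<le>r. if s = n then c n * a n n else 0)"
    unfolding d_def by (intro sum.cong) auto
  then have "d n \<noteq> 0" using n a(1) by simp
  moreover have "f (Suc g) \<noteq> 0" using a(1) a'(1) by (simp add: f_def)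
  ultimately obtain u where "(\<Sum>i\<le>Suc g. f i * (\<delta> ^^ i) u) = 0" "(\<Sum>i\<le>r. d i * (\<delta> ^^ i) u) \<noteq> 0"
    using differentially_closed_linear[OF dc, of f "Suc g" r n d] n r by auto
  then show ?thesis unfolding f d by (auto simp: adj_kernel_def)
qed

text \<open>The scalars \<open>c\<close> are arbitrary, not only constants: the claim is
  invertibility of a matrix, analogous to a Wronskian. It grows by one row at a time: some nonzero
  vector \<open>d\<close> is orthogonal to all rows so far, and the next adjoint solution is chosen
  not orthogonal to \<open>d\<close>.\<close>

lemma adj_kernel_independent:
  assumes dc: "differentially_closed \<delta>" and b: "b (Suc g) \<noteq> 0"
  shows "r \<le> Suc g \<Longrightarrow> \<exists>u. (\<forall>l<r. u l \<in> adj_kernel b g) \<and>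
    (\<forall>c. (\<forall>i<r. (\<Sum>l<r. c l * adj b g i (u l)) = 0) \<longrightarrow> (\<forall>l<r. c l = 0))"
proof (induction r)
  case (Suc r)
  then obtain u where u: "\<forall>l<r. u l \<in> adj_kernel b g"
    and ind: "\<And>c. \<forall>i<r. (\<Sum>l<r. c l * adj b g i (u l)) = 0 \<Longrightarrow> \<forall>l<r. c l = 0" by auto
  have "is_subfield (UNIV :: 'a set)" by (simp add: is_subfield_def)
  from homogeneous_system_nontrivial_solution[OF this, of "{..<r}" "{..r}" "\<lambda>i l. adj b g i (u l)"]
  obtain d where d: "\<exists>i\<le>r. d i \<noteq> 0" "\<forall>l<r. (\<Sum>i\<le>r. d i * adj b g i (u l)) = 0" by auto
  obtain v where v: "v \<in> adj_kernel b g" "(\<Sum>i\<le>r. d i * adj b g i v) \<noteq> 0"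
    using ex_adj_kernel_avoiding[OF dc, of b g r d] b d(1) Suc.prems by auto
  define u' where "u' = u(r := v)"
  have sum_u': "(\<Sum>l<Suc r. c l * adj b g i (u' l)) = (\<Sum>l<r. c l * adj b g i (u l)) + c r * adj b g i v" for c i
    by (simp add: u'_def)
  have "\<forall>l<Suc r. c l = 0" if c: "\<forall>i<Suc r. (\<Sum>l<Suc r. c l * adj b g i (u' l)) = 0" for c
  proof -
    \<comment> \<open>Pairing with \<open>d\<close> annihilates the old rows and isolates
      \<open>c r\<close>.\<close>
    have "0 = (\<Sum>i\<le>r. d i * (\<Sum>l<Suc r. c l * adj b g i (u' l)))" using c by simp
    also have "\<dots> = (\<Sum>i\<le>r. d i * (\<Sum>l<r. c l * adj b g i (u l))) + (\<Sum>i\<le>r. d i * (c r * adj b g i v))"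
      unfolding sum_u' distrib_left sum.distrib ..
    also have "(\<Sum>i\<le>r. d i * (\<Sum>l<r. c l * adj b g i (u l))) = (\<Sum>l<r. c l * (\<Sum>i\<le>r. d i * adj b g i (u l)))"
      unfolding sum_distrib_left by (subst sum.swap) (simp add: mult_ac)
    also have "\<dots> = 0" using d(2) by simp
    also have "(\<Sum>i\<le>r. d i * (c r * adj b g i v)) = c r * (\<Sum>i\<le>r. d i * adj b g i v)"
      by (simp add: sum_distrib_left mult_ac)
    finally have cr: "c r = 0" using v(2) by simp
    then have "\<forall>i<r. (\<Sum>l<r. c l * adj b g i (u l)) = 0" using c unfolding sum_u' by simp
    then show ?thesis using ind cr less_Suc_eq by auto
  qed
  moreover have "\<forall>l<Suc r. u' l \<in> adj_kernel b g" using u v(1) by (simp add: u'_def)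
  ultimately show ?case by blast
qed simp

text \<open>The recursion and the kernel condition express the derivatives of the values of
  \<open>adj\<close> through these values and \<open>u\<close>, which is the first of them divided
  by \<open>b (Suc g)\<close>.\<close>

lemma adj_kernel_in_dalg:
  assumes k: "differential_subfield \<delta> k" and b: "\<And>i. i \<le> Suc g \<Longrightarrow> b i \<in> k" "b (Suc g) \<noteq> 0"
    and u: "u \<in> adj_kernel b g"
  shows "u \<in> dalg k" "s \<le> g \<Longrightarrow> adj b g s u \<in> dalg k"
proof -
  let ?K = "dalg k" and ?Z = "(\<lambda>s. adj b g s u) ` {..g}"
  let ?L = "field_adjoin ?K ?Z"
  note L = is_subfield_field_adjoin[of ?K ?Z]
  note Ksf = differential_subfieldD(1)[OF differential_subfield_dalg[OF k]]
  have bK: "b i \<in> ?K" if "i \<le> Suc g" for i using b(1)[OF that] dalg_base by blast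
  have bL: "b i \<in> ?L" if "i \<le> Suc g" for i using bK[OF that] field_adjoin_base[of ?K ?Z] by blast
  have ZL: "adj b g s u \<in> ?L" if "s \<le> g" for s using that field_adjoin_gens[of ?Z ?K] by auto
  have u_eq: "u = adj b g 0 u / b (Suc g)" using b(2) by simp
  have uL: "u \<in> ?L" using subfield_divide[OF L ZL[of 0] bL[of "Suc g"]] u_eq by simp
  have ZK: "?Z \<subseteq> ?K"
  proof (rule dalg_closed)
    have "\<delta> (adj b g s u) \<in> ?L" if "s \<le> g" for s
    proof (cases "s = g")
      case True
      then show ?thesis using u subfield_mult[OF L bL[of 0] uL] by (simp add: adj_kernel_def)
    next
      case False
      then have "b (g - s) * u - adj b g (Suc s) u \<in> ?L"
        using that by (intro subfield_diff[OF L] subfield_mult[OF L] bL uL ZL) auto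
      then show ?thesis by simp
    qed
    then show "\<delta> ` ?Z \<subseteq> ?L" by auto
  qed simp
  then show *: "adj b g s u \<in> ?K" if "s \<le> g" for s using that by auto
  show "u \<in> ?K" using subfield_divide[OF Ksf *[of 0] bK[of "Suc g"]] u_eq by simp
qed

text \<open>The equation makes the jet of order \<open>Suc g\<close> rational in the lower ones,
  which are therefore derivation-closed over \<open>dalg k\<close>.\<close>

lemma linear_solution_in_dalg:
  assumes k: "differential_subfield \<delta> k" and b: "\<And>i. i \<le> Suc g \<Longrightarrow> b i \<in> k" "b (Suc g) \<noteq> 0"
    and w: "(\<Sum>i\<le>Suc g. b i * (\<delta> ^^ i) z) \<in> dalg k"
  shows "z \<in> dalg k"
proof -
  let ?K = "dalg k" and ?Z = "(\<lambda>i. (\<delta> ^^ i) z) ` {..g}"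
  let ?L = "field_adjoin ?K ?Z" and ?w = "\<Sum>i\<le>Suc g. b i * (\<delta> ^^ i) z"
  note L = is_subfield_field_adjoin[of ?K ?Z]
  have KL: "?K \<subseteq> ?L" by (rule field_adjoin_base)
  have bL: "b i \<in> ?L" if "i \<le> Suc g" for i using b(1)[OF that] dalg_base KL by blast
  have ZL: "(\<delta> ^^ i) z \<in> ?L" if "i \<le> g" for i using that field_adjoin_gens[of ?Z ?K] by auto
  have "(\<Sum>i\<le>g. b i * (\<delta> ^^ i) z) \<in> ?L"
    by (intro subfield_sum[OF L] subfield_mult[OF L] bL ZL) auto
  then have "(?w - (\<Sum>i\<le>g. b i * (\<delta> ^^ i) z)) / b (Suc g) \<in> ?L"
    using w KL by (intro subfield_divide[OF L] subfield_diff[OF L] bL) auto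
  then have top: "(\<delta> ^^ Suc g) z \<in> ?L" using b(2) by simp
  have "?Z \<subseteq> ?K"
  proof (rule dalg_closed)
    have "\<delta> ((\<delta> ^^ i) z) \<in> ?L" if "i \<le> g" for i
      using ZL[of "Suc i"] top that by (cases "i = g") auto
    then show "\<delta> ` ?Z \<subseteq> ?L" by auto
  qed simp
  then show ?thesis using image_eqI[of z "\<lambda>i. (\<delta> ^^ i) z" 0 "{..g}"] by auto
qed

section \<open>Recovering generic coefficients from adjoint solutions\<close>

lemma is_subfield_jets_in:
  assumes "is_subfield F"
  shows "is_subfield {x. \<forall>n\<le>N. (\<delta> ^^ n) x \<in> F}"
proof (induction N)
  case 0
  then show ?case using assms by simp
next
  case (Suc N)
  let ?G = "{x. \<forall>n\<le>N. (\<delta> ^^ n) x \<in> F}"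
  have "(\<forall>n\<le>Suc N. (\<delta> ^^ n) x \<in> F) \<longleftrightarrow> x \<in> ?G \<and> \<delta> x \<in> ?G" for x
  proof
    assume *: "\<forall>n\<le>Suc N. (\<delta> ^^ n) x \<in> F"
    have "(\<delta> ^^ n) (\<delta> x) \<in> F" if "n \<le> N" for n
      using *[rule_format, of "Suc n"] that by (simp add: funpow_swap1)
    then show "x \<in> ?G \<and> \<delta> x \<in> ?G" using * by simp
  next
    assume *: "x \<in> ?G \<and> \<delta> x \<in> ?G"
    show "\<forall>n\<le>Suc N. (\<delta> ^^ n) x \<in> F"
    proof (intro allI impI)
      fix n assume "n \<le> Suc N"
      then show "(\<delta> ^^ n) x \<in> F" using * by (cases n) (auto simp: funpow_swap1)
    qed
  qed
  then have "{x. \<forall>n\<le>Suc N. (\<delta> ^^ n) x \<in> F} = {x \<in> ?G. \<delta> x \<in> ?G}" by blast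
  then show ?case using is_subfield_deriv_in[OF Suc Suc order_refl] by simp
qed

text \<open>The recursion read backwards: \<open>b (g - s) * u\<close> is
  \<open>adj b g (Suc s) u + \<delta> (adj b g s u)\<close>, with the definition of
  \<open>adj\<close> and the kernel condition covering the two extreme coefficients.\<close>

lemma coefficient_in_adj_field:
  assumes F: "is_subfield F" and u: "u \<in> adj_kernel b g" "u \<noteq> 0" "u \<in> F"
    and p: "\<And>s. s \<le> g \<Longrightarrow> adj b g s u \<in> F" "\<And>s. s \<le> g \<Longrightarrow> \<delta> (adj b g s u) \<in> F"
    and i: "i \<le> Suc g"
  shows "b i \<in> F"
proof -
  have "b i * u \<in> F"
  proof (cases "i = Suc g")
    case True
    then show ?thesis using p(1)[of 0] by simp
  next
    case False
    show ?thesis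
    proof (cases "i = 0")
      case True
      then show ?thesis using p(2)[of g] u(1) by (simp add: adj_kernel_def)
    next
      case False
      define s where "s = g - i"
      have s: "g - s = i" "Suc s \<le> g" using False \<open>i \<noteq> Suc g\<close> i by (auto simp: s_def)
      have "adj b g (Suc s) u + \<delta> (adj b g s u) \<in> F"
        using s by (intro subfield_add[OF F] p) auto
      then show ?thesis using s(1) by simp
    qed
  qed
  then have "b i * u / u \<in> F" using u(3) by (rule subfield_divide[OF F])
  then show ?thesis using u(2) by simp
qed

text \<open>If the \<open>u j\<close> were not all zero, the coefficients of the operators with \<open>u j \<noteq> 0\<close> could be
  recovered rationally from the \<open>u j\<close> and the \<open>adj s (u j)\<close>; as the \<open>u j\<close> sum to zero, this is
  one differential generator too few.\<close>

lemma generic_adj_kernels_independent: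
  fixes \<beta> :: "nat \<Rightarrow> nat \<Rightarrow> 'a" and g m :: nat
  assumes gen: "independent_differential_transcendentals \<delta> ({0..Suc g} \<times> {1..m}) (\<lambda>(i, j). \<beta> i j)"
    and u: "\<And>j. j \<in> {1..m} \<Longrightarrow> u j \<in> adj_kernel (\<lambda>i. \<beta> i j) g" and sum: "(\<Sum>j=1..m. u j) = 0"
    and j: "j \<in> {1..m}"
  shows "u j = 0"
proof (rule ccontr)
  assume "u j \<noteq> 0"
  define J where "J = {j\<in>{1..m}. u j \<noteq> 0}"
  have jJ: "j \<in> J" using \<open>u j \<noteq> 0\<close> j by (simp add: J_def)
  have finJ: "finite J" by (rule finite_subset[of _ "{1..m}"]) (auto simp: J_def)
  \<comment> \<open>With \<open>N + 1\<close> jets per coefficient, the jets outnumber the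
    generators by at least \<open>N + 1 - card J * Suc g\<close>; this \<open>N\<close> makes that
    bound exactly one.\<close>
  define N where "N = card J * Suc g"
  let ?p = "\<lambda>j s. adj (\<lambda>i. \<beta> i j) g s (u j)"
  \<comment> \<open>No jets of \<open>u j\<close> are listed, as \<open>u j\<close> is minus the sum
    of the others; this saving decides the count.\<close>
  define S1 where "S1 = (\<lambda>(i, n). (\<delta> ^^ n) (u i)) ` ((J - {j}) \<times> {..N})"
  \<comment> \<open>One order beyond \<open>N\<close>, because recovering a coefficient uses the
    derivatives of the values of \<open>adj\<close>.\<close>
  define S2 where "S2 = (\<lambda>(i, s, n). (\<delta> ^^ n) (?p i s)) ` (J \<times> {..g} \<times> {..Suc N})"
  have fin: "finite S1" "finite S2" using finJ by (auto simp: S1_def S2_def)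
  let ?F = "field_adjoin \<rat> (S1 \<union> S2)"
  \<comment> \<open>\<open>?F\<close> need not be closed under \<open>\<delta>\<close>. Recovering
    the coefficients in the field \<open>?G\<close> puts all their jets up to order \<open>N\<close>
    into \<open>?F\<close> at once.\<close>
  let ?G = "{x. \<forall>n\<le>N. (\<delta> ^^ n) x \<in> ?F}"
  have G: "is_subfield ?G" by (rule is_subfield_jets_in[OF is_subfield_field_adjoin])
  have gens: "x \<in> ?F" if "x \<in> S1 \<union> S2" for x using that field_adjoin_gens[of "S1 \<union> S2" "\<rat>"] by blast
  have u1: "u i \<in> ?G" if "i \<in> J - {j}" for i
  proof -
    have "(\<delta> ^^ n) (u i) \<in> S1" if "n \<le> N" for n
      unfolding S1_def using that \<open>i \<in> J - {j}\<close> by (intro image_eqI[of _ _ "(i, n)"]) auto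
    then show ?thesis using gens by blast
  qed
  have "(\<Sum>i\<in>J. u i) = (\<Sum>i=1..m. u i)"
    by (intro sum.mono_neutral_left) (auto simp: J_def)
  then have "(\<Sum>i\<in>J. u i) = 0" using sum by simp
  then have "u j = - (\<Sum>i\<in>J - {j}. u i)"
    using sum.remove[OF finJ jJ, of u] by (simp add: eq_neg_iff_add_eq_0)
  moreover have "- (\<Sum>i\<in>J - {j}. u i) \<in> ?G"
    by (intro subfield_uminus[OF G] subfield_sum[OF G] u1)
  ultimately have "u j \<in> ?G" by (simp only:)
  with u1 have uG: "u i \<in> ?G" if "i \<in> J" for i using that by (cases "i = j") blast+
  have S2_mem: "(\<delta> ^^ n) (?p i s) \<in> S2" if "i \<in> J" "s \<le> g" "n \<le> Suc N" for i s n
    unfolding S2_def using that by (intro image_eqI[of _ _ "(i, s, n)"]) auto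
  have pG: "?p i s \<in> ?G" "\<delta> (?p i s) \<in> ?G" if "i \<in> J" "s \<le> g" for i s
  proof -
    show "?p i s \<in> ?G" using gens S2_mem[OF that] by auto
    have "(\<delta> ^^ n) (\<delta> (?p i s)) \<in> ?F" if "n \<le> N" for n
      using gens S2_mem[OF \<open>i \<in> J\<close> \<open>s \<le> g\<close>, of "Suc n"] that by (simp add: funpow_swap1)
    then show "\<delta> (?p i s) \<in> ?G" by simp
  qed
  have bG: "\<beta> i l \<in> ?G" if "i \<le> Suc g" "l \<in> J" for i l
  proof (rule coefficient_in_adj_field[OF G, of "u l" "\<lambda>i. \<beta> i l" g i])
    show "u l \<in> adj_kernel (\<lambda>i. \<beta> i l) g" "u l \<noteq> 0" using that u by (auto simp: J_def)
  qed (use that uG pG in blast)+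
  define Fam where "Fam = ({0..Suc g} \<times> J) \<times> {..N}"
  have "card S1 \<le> (card J - 1) * Suc N"
    unfolding S1_def by (rule order_trans[OF card_image_le]) (use finJ jJ in auto)
  moreover have "card S2 \<le> card J * (Suc g * Suc (Suc N))"
    unfolding S2_def by (rule order_trans[OF card_image_le]) (use finJ in auto)
  ultimately have "card (S1 \<union> S2) \<le> (card J - 1) * Suc N + card J * (Suc g * Suc (Suc N))"
    using card_Un_le[of S1 S2] by linarith
  also have "\<dots> < card Fam"
  proof -
    have "card J > 0" using finJ jJ card_gt_0_iff by blast
    then obtain c where c: "card J = Suc c" using gr0_implies_Suc by blast
    have "card Fam = Suc (Suc g) * card J * Suc N" by (simp add: Fam_def card_cartesian_product)
    then show ?thesis unfolding N_def c by (simp add: algebra_simps)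
  qed
  finally have card: "card (S1 \<union> S2) < card Fam" .
  have "\<not> alg_independent_family \<rat> Fam (jet \<delta> (\<lambda>(i, j). \<beta> i j))"
  proof (rule not_alg_independent_if_few_generators[OF is_subfield_Rats _ _ card])
    show "finite (S1 \<union> S2)" "finite Fam" using fin finJ by (auto simp: Fam_def)
    show "jet \<delta> (\<lambda>(i, j). \<beta> i j) v \<in> ?F" if "v \<in> Fam" for v
      using that bG unfolding Fam_def by (auto simp: jet_def)
  qed
  moreover have "Fam \<subseteq> ({0..Suc g} \<times> {1..m}) \<times> UNIV" by (auto simp: Fam_def J_def)
  ultimately show False
    using gen unfolding independent_differential_transcendentals_def alg_independent_family_def
    by (meson subset_trans)
qed

lemma independent_differential_transcendentals_nonzero:
  assumes "independent_differential_transcendentals \<delta> I b" "v \<in> I"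
  shows "b v \<noteq> 0"
proof
  assume "b v = 0"
  let ?\<mu> = "Poly_Mapping.single (v, 0::nat) (1::nat)"
  have "(1::'a) = 0"
    by (rule alg_independent_familyD[of "\<rat>" "I \<times> UNIV" "jet \<delta> b" "{?\<mu>}" "\<lambda>_. 1" ?\<mu>])
      (use assms \<open>b v = 0\<close> in \<open>auto simp: independent_differential_transcendentals_def is_subfield_Rats jet_def\<close>)
  then show False by simp
qed

end

text \<open>Functions that agree on \<open>V\<close> with a \<open>K\<close>-linear combination of the coordinates \<open>X v\<close>.\<close>

inductive_set linfun :: "'a::field set \<Rightarrow> 'v set \<Rightarrow> ('v \<Rightarrow> 'p \<Rightarrow> 'a) \<Rightarrow> 'p set \<Rightarrow> ('p \<Rightarrow> 'a) set"
  for K I X V where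
  linfun_zero: "(\<And>z. z \<in> V \<Longrightarrow> \<phi> z = 0) \<Longrightarrow> \<phi> \<in> linfun K I X V"
| linfun_coord: "v \<in> I \<Longrightarrow> (\<And>z. z \<in> V \<Longrightarrow> \<phi> z = X v z) \<Longrightarrow> \<phi> \<in> linfun K I X V"
| linfun_add: "\<phi> \<in> linfun K I X V \<Longrightarrow> \<psi> \<in> linfun K I X V \<Longrightarrow> (\<And>z. z \<in> V \<Longrightarrow> \<chi> z = \<phi> z + \<psi> z) \<Longrightarrow>
    \<chi> \<in> linfun K I X V"
| linfun_scale: "a \<in> K \<Longrightarrow> \<phi> \<in> linfun K I X V \<Longrightarrow> (\<And>z. z \<in> V \<Longrightarrow> \<chi> z = a * \<phi> z) \<Longrightarrow>
    \<chi> \<in> linfun K I X V"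

lemma linfun_sum:
  assumes "finite A" "\<And>a. a \<in> A \<Longrightarrow> \<phi> a \<in> linfun K I X V"
  shows "(\<lambda>z. \<Sum>a\<in>A. \<phi> a z) \<in> linfun K I X V"
  using assms
proof (induction A rule: finite_induct)
  case empty
  show ?case by (rule linfun_zero) simp
next
  case (insert a A)
  show ?case
    by (rule linfun_add[of "\<phi> a" _ _ _ _ "\<lambda>z. \<Sum>a\<in>A. \<phi> a z"]) (use insert in simp_all)
qed

lemma linfun_polyfun:
  assumes K: "is_subfield K" and "\<phi> \<in> linfun K I X V"
  shows "\<exists>\<Phi>\<in>polyfun K I X 1. \<forall>z\<in>V. \<Phi> z = \<phi> z"
  using assms(2)
proof (induction rule: linfun.induct)
  case (linfun_zero \<phi>)
  then show ?case using polyfun_const[OF K subfield_0[OF K], of I X 1] by force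
next
  case (linfun_coord v \<phi>)
  then show ?case using polyfun_coord[OF K, of v I X] by force
next
  case (linfun_add \<phi> \<psi> \<chi>)
  then obtain \<Phi> \<Psi> where "\<Phi> \<in> polyfun K I X 1" "\<Psi> \<in> polyfun K I X 1"
    "\<forall>z\<in>V. \<Phi> z = \<phi> z" "\<forall>z\<in>V. \<Psi> z = \<psi> z" by blast
  then show ?case
    using polyfun_add[OF K, of \<Phi> I X 1 \<Psi>] linfun_add(3) by (intro bexI[of _ "\<lambda>z. \<Phi> z + \<Psi> z"]) simp_all
next
  case (linfun_scale a \<phi> \<chi>)
  then obtain \<Phi> where "\<Phi> \<in> polyfun K I X 1" "\<forall>z\<in>V. \<Phi> z = \<phi> z" by blast
  then show ?case
    using polyfun_mult[OF K polyfun_const[OF K linfun_scale(1), of I X 0], of \<Phi> 1] linfun_scale(3)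
    by (intro bexI[of _ "\<lambda>z. a * \<Phi> z"]) simp_all
qed

lemma peval_cong: "(\<And>v. v \<in> pvars f \<Longrightarrow> x v = y v) \<Longrightarrow> peval f x = peval f y"
proof -
  assume eq: "\<And>v. v \<in> pvars f \<Longrightarrow> x v = y v"
  have "x v = y v" if "\<mu> \<in> Poly_Mapping.keys f" "v \<in> Poly_Mapping.keys \<mu>" for \<mu> v
    by (rule eq) (use that in \<open>auto simp: pvars_def\<close>)
  then show ?thesis unfolding peval_def by simp
qed

text \<open>By pigeonhole some value is taken infinitely often, and \<open>p\<close> minus that
  value has infinitely many roots.\<close>

lemma degree_eq_0_if_bounded_nat_values:
  fixes p :: "rat poly"
  assumes "\<forall>\<^sub>F t in sequentially. \<exists>d\<le>n. poly p (of_nat t) = of_nat (d::nat)"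
  shows "degree p = 0"
proof -
  obtain T where T: "\<And>t. t \<ge> T \<Longrightarrow> \<exists>d\<le>n. poly p (of_nat t) = of_nat (d::nat)"
    using assms unfolding eventually_sequentially by blast
  have "\<forall>t\<in>{T..}. \<exists>d\<in>{..n}. poly p (of_nat t) = of_nat (d::nat)" using T by auto
  then obtain D where D: "\<And>t. t \<ge> T \<Longrightarrow> D t \<le> n \<and> poly p (of_nat t) = of_nat (D t :: nat)"
    by (metis atLeast_iff atMost_iff)
  have "D ` {T..} \<subseteq> {..n}" by (rule image_subsetI) (simp add: D)
  then have "finite (D ` {T..})" by (rule finite_subset) simp
  then obtain t0 where t0: "infinite {t \<in> {T..}. D t = D t0}"
    using pigeonhole_infinite[of "{T..}" D] infinite_Ici by blast
  let ?q = "p - [:of_nat (D t0):]"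
  have "of_nat ` {t \<in> {T..}. D t = D t0} \<subseteq> {x. poly ?q x = 0}" using D by auto
  moreover have "infinite (of_nat ` {t \<in> {T..}. D t = D t0} :: rat set)"
    using t0 by (subst finite_image_iff) (auto simp: inj_on_def)
  ultimately have "infinite {x. poly ?q x = 0}" using finite_subset by blast
  then have "?q = 0" using poly_roots_finite by blast
  then have "p = [:of_nat (D t0):]" by simp
  then show ?thesis by simp
qed

text \<open>Append the unit vector to the \<open>r\<close> rows: \<open>r + 1\<close> rows in
  \<open>r\<close> columns are dependent over \<open>K\<close>, and by \<open>ind\<close> the unit
  vector must occur. This gives rows of the inverse matrix with entries in \<open>K\<close>.\<close>

lemma unit_vector_in_span:
  fixes P :: "nat \<Rightarrow> nat \<Rightarrow> 'a::field"
  assumes K: "is_subfield K" and P: "\<And>l i. l < r \<Longrightarrow> i < r \<Longrightarrow> P l i \<in> K"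
    and ind: "\<And>c. \<forall>i<r. (\<Sum>l<r. c l * P l i) = 0 \<Longrightarrow> \<forall>l<r. c l = 0" and t: "t < r"
  obtains n where "\<And>l. l < r \<Longrightarrow> n l \<in> K" "\<And>i. i < r \<Longrightarrow> (\<Sum>l<r. n l * P l i) = (if i = t then 1 else 0)"
proof -
  define A where "A l i = (if l < r then P l i else if i = t then 1 else 0)" for l i
  have "\<exists>c. (\<forall>l\<in>{..r}. c l \<in> K) \<and> (\<exists>l\<in>{..r}. c l \<noteq> 0) \<and> (\<forall>i\<in>{..<r}. (\<Sum>l\<in>{..r}. c l * A l i) = 0)"
    by (rule homogeneous_system_nontrivial_solution[OF K])
      (use P in \<open>auto simp: A_def subfield_0[OF K] subfield_1[OF K]\<close>)
  then obtain c where c: "\<And>l. l \<le> r \<Longrightarrow> c l \<in> K" "\<exists>l\<le>r. c l \<noteq> 0"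
    "\<And>i. i < r \<Longrightarrow> (\<Sum>l\<le>r. c l * A l i) = 0" by auto
  have "(\<Sum>l\<le>r. c l * A l i) = (\<Sum>l<r. c l * P l i) + c r * (if i = t then 1 else 0)" for i
    unfolding lessThan_Suc_atMost[symmetric] by (simp add: A_def)
  with c(3) have c_sum: "(\<Sum>l<r. c l * P l i) + c r * (if i = t then 1 else 0) = 0" if "i < r" for i
    using that by simp
  have cr: "c r \<noteq> 0"
  proof
    assume "c r = 0"
    with c_sum have "\<forall>i<r. (\<Sum>l<r. c l * P l i) = 0" by simp
    then have "\<forall>l<r. c l = 0" by (rule ind)
    then show False using c(2) \<open>c r = 0\<close> by (auto simp: le_less)
  qed
  show thesis
  proof (rule that[of "\<lambda>l. - (c l / c r)"])
    show "- (c l / c r) \<in> K" if "l < r" for l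
      using that by (intro subfield_uminus[OF K] subfield_divide[OF K] c) auto
    show "(\<Sum>l<r. - (c l / c r) * P l i) = (if i = t then 1 else 0)" if "i < r" for i
    proof -
      have "(\<Sum>l<r. - (c l / c r) * P l i) = - ((\<Sum>l<r. c l * P l i) / c r)"
        by (simp add: sum_divide_distrib sum_negf)
      also have "(\<Sum>l<r. c l * P l i) = - (c r * (if i = t then 1 else 0))"
        using c_sum[OF that] by (simp add: add_eq_0_iff2)
      finally show ?thesis using cr by simp
    qed
  qed
qed

section \<open>Linear coordinates on the solution set, and Kolchin polynomials\<close>

context differential_field
begin

text \<open>By the product rule only the derivatives of the coordinates need checking. Agreement on
  \<open>V\<close> is enough because \<open>\<delta>\<close> acts on the values at each
  point.\<close>

lemma linfun_deriv:
  assumes K: "differential_subfield \<delta> K" and X: "\<And>v. v \<in> I \<Longrightarrow> (\<lambda>z. \<delta> (X v z)) \<in> linfun K I X V"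
    and "\<phi> \<in> linfun K I X V"
  shows "(\<lambda>z. \<delta> (\<phi> z)) \<in> linfun K I X V"
  using assms(3)
proof (induction rule: linfun.induct)
  case (linfun_zero \<phi>)
  then show ?case by (intro linfun.linfun_zero) simp
next
  case (linfun_coord v \<phi>)
  have "(\<lambda>_. 0) \<in> linfun K I X V" by (rule linfun.linfun_zero) simp
  with X[OF linfun_coord(1)] show ?case by (rule linfun.linfun_add) (simp add: linfun_coord(2))
next
  case (linfun_add \<phi> \<psi> \<chi>)
  then show ?case by (intro linfun.linfun_add[OF linfun_add.IH]) (simp add: deriv_add)
next
  case (linfun_scale a \<phi> \<chi>)
  have 1: "(\<lambda>z. \<delta> a * \<phi> z) \<in> linfun K I X V"
    by (rule linfun.linfun_scale[OF differential_subfieldD(2)[OF K linfun_scale.hyps(1)] linfun_scale.hyps(2)]) simp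
  have 2: "(\<lambda>z. a * \<delta> (\<phi> z)) \<in> linfun K I X V"
    by (rule linfun.linfun_scale[OF linfun_scale.hyps(1) linfun_scale.IH]) simp
  show ?case by (rule linfun.linfun_add[OF 1 2]) (simp add: linfun_scale.hyps(3) deriv_mult)
qed

text \<open>In coordinates that are independent at \<open>a\<close>, evaluation of \<open>f\<close>
  is a polynomial vanishing at \<open>a\<close>, hence everywhere. Points of \<open>V\<close> are
  unrestricted outside \<open>{1..m}\<close>, where \<open>f\<close> has no variables.\<close>

lemma relation_holds_on_solution_set:
  fixes \<beta> :: "nat \<Rightarrow> nat \<Rightarrow> 'a" and g m :: nat
  defines "L \<equiv> \<lambda>j z. \<Sum>i\<le>Suc g. \<beta> i j * (\<delta> ^^ i) z"
  defines "V \<equiv> {z :: nat \<Rightarrow> 'a. \<forall>j\<in>{1..m}. L j (z j) = L 1 (z 1)}"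
  assumes dc: "differentially_closed \<delta>"
    and gen: "independent_differential_transcendentals \<delta> ({0..Suc g} \<times> {1..m}) (\<lambda>(i, j). \<beta> i j)"
    and k: "differential_subfield \<delta> k" and \<beta>k: "\<And>i j. i \<le> Suc g \<Longrightarrow> j \<in> {1..m} \<Longrightarrow> \<beta> i j \<in> k"
    and a: "a \<in> V" and w: "L 1 (a 1) \<notin> dalg k"
    and f: "pvars f \<subseteq> {1..m} \<times> UNIV" "pcoeffs f \<subseteq> k" "dpeval \<delta> f a = 0"
    and z: "z \<in> V"
  shows "dpeval \<delta> f z = 0"
proof -
  let ?K = "dalg k"
  note K = differential_subfield_dalg[OF k]
  note Ksf = differential_subfieldD(1)[OF K]
  let ?b = "\<lambda>j i. \<beta> i j"
  have b_ne: "\<beta> (Suc g) j \<noteq> 0" if "j \<in> {1..m}" for j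
    using independent_differential_transcendentals_nonzero[OF gen, of "(Suc g, j)"] that by simp
  have "\<forall>j\<in>{1..m}. \<exists>u. (\<forall>l<Suc g. u l \<in> adj_kernel (?b j) g) \<and>
      (\<forall>c. (\<forall>i<Suc g. (\<Sum>l<Suc g. c l * adj (?b j) g i (u l)) = 0) \<longrightarrow> (\<forall>l<Suc g. c l = 0))"
    using adj_kernel_independent[OF dc, of "?b _" g "Suc g"] b_ne by blast
  then obtain u where u': "\<forall>j\<in>{1..m}. (\<forall>l<Suc g. u j l \<in> adj_kernel (?b j) g) \<and>
      (\<forall>c. (\<forall>i<Suc g. (\<Sum>l<Suc g. c l * adj (?b j) g i (u j l)) = 0) \<longrightarrow> (\<forall>l<Suc g. c l = 0))"
    by (rule bchoice[THEN exE])
  have u: "\<And>j l. j \<in> {1..m} \<Longrightarrow> l < Suc g \<Longrightarrow> u j l \<in> adj_kernel (?b j) g"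
    and ind: "\<And>j c. j \<in> {1..m} \<Longrightarrow> \<forall>i<Suc g. (\<Sum>l<Suc g. c l * adj (?b j) g i (u j l)) = 0 \<Longrightarrow> \<forall>l<Suc g. c l = 0"
    using u' by blast+
  have uK: "u j l \<in> ?K" and adjK: "\<And>s. s \<le> g \<Longrightarrow> adj (?b j) g s (u j l) \<in> ?K"
    if "j \<in> {1..m}" "l < Suc g" for j l
    using adj_kernel_in_dalg[OF k _ _ u[OF that]] \<beta>k[OF _ that(1)] b_ne[OF that(1)] by blast+
  \<comment> \<open>The left coordinates are the concomitants, \<open>Suc g\<close> for each
    unknown; the right ones are the jets of the common value of the operators.\<close>
  define X where "X = case_sum (\<lambda>(j, l) z. concomitant (?b j) g (u j l) (z j)) (\<lambda>i z. (\<delta> ^^ i) (L 1 (z 1)))"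
  define I1 where "I1 = {1..m} \<times> {..<Suc g}"
  define I where "I = I1 <+> (UNIV :: nat set)"
  define w where "w = L 1 (a 1)"
  have dX: "\<delta> (X (Inl (j, l)) z) = u j l * X (Inr 0) z" if "j \<in> {1..m}" "l < Suc g" "z \<in> V" for j l z
  proof -
    have "\<delta> (concomitant (?b j) g (u j l) (z j)) = u j l * L j (z j)"
      unfolding L_def by (rule deriv_concomitant[OF u[OF that(1,2)]])
    also have "L j (z j) = L 1 (z 1)" using that(1,3) unfolding V_def by blast
    finally show ?thesis by (simp add: X_def)
  qed

  \<comment> \<open>Two layers: the jets of \<open>w\<close> are independent over
    \<open>dalg k\<close> since \<open>w\<close> lies outside it, and the concomitants are
    independent over the field \<open>?E\<close> generated by these jets.\<close>
  have indep: "alg_independent_family ?K I (\<lambda>v. X v a)"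
  proof -
    let ?x = "\<lambda>v. X (Inl v) a" and ?y = "\<lambda>i. (\<delta> ^^ i) w"
    let ?E = "field_adjoin ?K (range ?y)"
    have KE: "?K \<subseteq> ?E" by (rule field_adjoin_base)
    have yE: "?y i \<in> ?E" for i using field_adjoin_gens[of "range ?y" ?K] by blast
    have E: "differential_subfield \<delta> ?E"
    proof (rule differential_subfield_field_adjoin)
      show "\<delta> ` ?K \<subseteq> ?E" using differential_subfieldD(2)[OF K] KE by blast
      have "\<delta> (?y i) \<in> ?E" for i using yE[of "Suc i"] by simp
      then show "\<delta> ` range ?y \<subseteq> ?E" by blast
    qed
    note Esf = differential_subfieldD(1)[OF E]
    have dx: "\<delta> (?x v) = u (fst v) (snd v) * w" if "v \<in> I1" for v
      using that dX[OF _ _ a] by (cases v) (auto simp: I1_def X_def w_def)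
    have "alg_independent_family ?E I1 ?x"
    proof (rule ccontr)
      assume dep: "\<not> ?thesis"
      have "\<exists>C. (\<forall>v\<in>I1. \<delta> (C v) = 0) \<and> (\<exists>v\<in>I1. C v \<noteq> 0) \<and> (\<Sum>v\<in>I1. C v * ?x v) \<in> ?E"
      proof (rule ostrowski[OF E _ _ _ dep])
        show "c \<in> ?E" if "\<delta> c = 0" for c using dalg_constant[OF that] KE by blast
        show "finite I1" by (simp add: I1_def)
        fix v assume v: "v \<in> I1"
        then have "u (fst v) (snd v) \<in> ?E" using uK KE by (auto simp: I1_def)
        then show "\<delta> (?x v) \<in> ?E"
          unfolding dx[OF v] using subfield_mult[OF Esf _ yE[of 0]] by simp
      qed
      then obtain C where C: "\<And>v. v \<in> I1 \<Longrightarrow> \<delta> (C v) = 0" "\<exists>v\<in>I1. C v \<noteq> 0"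
        "(\<Sum>v\<in>I1. C v * ?x v) \<in> ?E" by blast
      \<comment> \<open>A combination with constant coefficients, hence again an adjoint solution of
        the \<open>j\<close>-th operator.\<close>
      define U where "U j = (\<Sum>l<Suc g. C (j, l) * u j l)" for j
      have "\<delta> (\<Sum>v\<in>I1. C v * ?x v) = (\<Sum>v\<in>I1. C v * (u (fst v) (snd v) * w))"
        unfolding deriv_sum using C(1) dx by (intro sum.cong) (auto simp: deriv_mult)
      also have "\<dots> = (\<Sum>v\<in>I1. C v * u (fst v) (snd v)) * w"
        by (simp add: sum_distrib_right mult.assoc)
      also have "(\<Sum>v\<in>I1. C v * u (fst v) (snd v)) = (\<Sum>j=1..m. U j)"
        unfolding I1_def U_def sum.cartesian_product by (intro sum.cong) auto
      finally have de: "\<delta> (\<Sum>v\<in>I1. C v * ?x v) = (\<Sum>j=1..m. U j) * w" .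
      have CK: "C v \<in> ?K" if "v \<in> I1" for v using dalg_constant[OF C(1)[OF that]] .
      have "U j \<in> ?K" if "j \<in> {1..m}" for j
        unfolding U_def using CK uK that
        by (intro subfield_sum[OF Ksf] subfield_mult[OF Ksf]) (auto simp: I1_def)
      then have "(\<Sum>j=1..m. U j) \<in> ?K" by (rule subfield_sum[OF Ksf])
      \<comment> \<open>A nonzero sum would give a nonzero multiple of \<open>w\<close> a primitive
        in \<open>?E\<close>, forcing \<open>w\<close> into \<open>dalg k\<close>.\<close>
      then have sumU: "(\<Sum>j=1..m. U j) = 0"
        using dalg_if_rational_primitive_of_multiple[OF k C(3) de] w unfolding w_def by blast
      have Cc: "\<delta> (C (j, l)) = 0" if "j \<in> {1..m}" "l \<in> {..<Suc g}" for j l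
        using C(1)[of "(j, l)"] that by (simp add: I1_def)
      have U0: "U j = 0" if "j \<in> {1..m}" for j
      proof (rule generic_adj_kernels_independent[OF gen _ sumU that])
        show "U j \<in> adj_kernel (?b j) g" if "j \<in> {1..m}" for j
          unfolding U_def by (rule adj_kernel_const_lincomb) (use Cc u that in auto)
      qed
      \<comment> \<open>Constants pass through \<open>adj\<close>, so \<open>U j = 0\<close> becomes
        a relation between the rows of the invertible matrix.\<close>
      have "C (j, l) = 0" if "j \<in> {1..m}" "l < Suc g" for j l
      proof -
        have adj0: "adj (?b j) g i 0 = 0" for i by (induction i) auto
        have "(\<Sum>l<Suc g. C (j, l) * adj (?b j) g i (u j l)) = adj (?b j) g i (U j)" for i
          unfolding U_def by (rule adj_const_lincomb[symmetric]) (use Cc that in auto)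
        then have "\<forall>i<Suc g. (\<Sum>l<Suc g. C (j, l) * adj (?b j) g i (u j l)) = 0"
          using U0[OF that(1)] adj0 by simp
        from ind[OF that(1) this] show ?thesis using that(2) by blast
      qed
      then show False using C(2) by (auto simp: I1_def)
    qed
    moreover have "alg_independent_family ?K UNIV ?y"
      using dalg_of_dependent_jets[OF k, of w] w unfolding w_def by blast
    ultimately have "alg_independent_family ?K I (case_sum ?x ?y)"
      unfolding I_def by (rule alg_independent_family_sum_type[OF Ksf Esf KE yE])
    moreover have "case_sum ?x ?y = (\<lambda>v. X v a)"
      by (auto simp: fun_eq_iff X_def w_def split: sum.split)
    ultimately show ?thesis by simp
  qed

  have coord: "(\<lambda>z. X v z) \<in> linfun ?K I X V" if "v \<in> I" for v
    using that by (rule linfun_coord) simp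
  \<comment> \<open>For concomitants this holds only on \<open>V\<close>, where the value of each
    operator is the single coordinate \<open>Inr 0\<close>.\<close>
  have dcoord: "(\<lambda>z. \<delta> (X v z)) \<in> linfun ?K I X V" if v: "v \<in> I" for v
  proof (cases v)
    case (Inl p)
    obtain j l where p: "p = (j, l)" by (cases p)
    have jl: "j \<in> {1..m}" "l < Suc g" using v unfolding Inl p I_def I1_def by auto
    have "Inr 0 \<in> I" unfolding I_def by (rule InrI) simp
    show ?thesis
      unfolding Inl p by (rule linfun_scale[OF uK[OF jl] coord[OF \<open>Inr 0 \<in> I\<close>]]) (rule dX[OF jl])
  next
    case (Inr i)
    have "Inr (Suc i) \<in> I" unfolding I_def by (rule InrI) simp
    then show ?thesis unfolding Inr by (rule linfun_coord) (simp add: X_def)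
  qed
  have jets: "(\<lambda>z. (\<delta> ^^ i) (z j)) \<in> linfun ?K I X V" if j: "j \<in> {1..m}" for i j
  proof (induction i)
    case 0
    \<comment> \<open>Index \<open>g\<close> is the place of the undifferentiated \<open>z j\<close>
      in the concomitant; higher jets then follow by differentiation.\<close>
    obtain n where n: "\<And>l. l < Suc g \<Longrightarrow> n l \<in> ?K"
      "\<And>i. i < Suc g \<Longrightarrow> (\<Sum>l<Suc g. n l * adj (?b j) g i (u j l)) = (if i = g then 1 else 0)"
      by (rule unit_vector_in_span[OF Ksf, of "Suc g" "\<lambda>l i. adj (?b j) g i (u j l)" g])
        (use adjK[OF j] ind[OF j] in auto)
    have "z j = (\<Sum>l<Suc g. n l * X (Inl (j, l)) z)" for z
    proof -
      have "(\<Sum>l<Suc g. n l * X (Inl (j, l)) z) =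
          (\<Sum>l<Suc g. \<Sum>s<Suc g. n l * adj (?b j) g s (u j l) * (\<delta> ^^ (g - s)) (z j))"
        unfolding X_def concomitant_def lessThan_Suc_atMost by (simp add: sum_distrib_left mult.assoc)
      also have "\<dots> = (\<Sum>s<Suc g. (\<Sum>l<Suc g. n l * adj (?b j) g s (u j l)) * (\<delta> ^^ (g - s)) (z j))"
        unfolding sum_distrib_right by (rule sum.swap)
      also have "\<dots> = (\<Sum>s<Suc g. (if s = g then 1 else 0) * (\<delta> ^^ (g - s)) (z j))"
        using n(2) by (intro sum.cong) auto
      also have "\<dots> = z j" by simp
      finally show ?thesis ..
    qed
    moreover have "(\<lambda>z. \<Sum>l<Suc g. n l * X (Inl (j, l)) z) \<in> linfun ?K I X V"
    proof (rule linfun_sum)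
      fix l assume "l \<in> {..<Suc g}"
      then have "l < Suc g" "Inl (j, l) \<in> I" using j by (auto simp: I_def I1_def)
      then show "(\<lambda>z. n l * X (Inl (j, l)) z) \<in> linfun ?K I X V"
        by (intro linfun_scale[OF n(1) coord]) auto
    qed simp
    ultimately show ?case by simp
  next
    case (Suc i)
    then show ?case using linfun_deriv[OF K dcoord Suc] by simp
  qed
  \<comment> \<open>The polynomial functions \<open>\<Phi> v\<close> agree with the jets on
    \<open>V\<close> only, which is enough because both \<open>a\<close> and \<open>z\<close> lie
    there.\<close>
  have "\<forall>v\<in>{1..m} \<times> UNIV. \<exists>\<Phi>. \<Phi> \<in> polyfun ?K I X 1 \<and> (\<forall>z\<in>V. \<Phi> z = jet \<delta> z v)"
    using linfun_polyfun[OF Ksf jets] unfolding jet_def by fastforce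
  then obtain \<Phi> where \<Phi>: "\<And>v. v \<in> {1..m} \<times> UNIV \<Longrightarrow> \<Phi> v \<in> polyfun ?K I X 1"
    "\<And>v z. v \<in> {1..m} \<times> UNIV \<Longrightarrow> z \<in> V \<Longrightarrow> \<Phi> v z = jet \<delta> z v"
    by metis
  have eval: "peval f (\<lambda>v. \<Phi> v z) = dpeval \<delta> f z" if "z \<in> V" for z
    unfolding dpeval_def using f(1) \<Phi>(2)[OF _ that] by (intro peval_cong) blast
  have "\<exists>D. (\<lambda>z. peval f (\<lambda>v. \<Phi> v z)) \<in> polyfun ?K I X D"
    using f(1,2) dalg_base[of k] \<Phi>(1) by (intro polyfun_peval[OF Ksf]) blast+
  then obtain D where "(\<lambda>z. peval f (\<lambda>v. \<Phi> v z)) \<in> polyfun ?K I X D" by blast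
  from polyfun_transfer[OF Ksf indep this, of z] show ?thesis using eval a z f(3) by simp
qed

text \<open>All jets of \<open>a\<close> lie in one differential field generated by a finite
  \<open>T\<close>, so \<open>card T\<close> bounds the transcendence degrees uniformly in
  \<open>t\<close>.\<close>

lemma kolchin_polynomial_constant_of_dalg:
  assumes k: "differential_subfield \<delta> k" and a: "\<And>j. j \<in> {1..m} \<Longrightarrow> a j \<in> dalg k"
    and p: "is_kolchin_polynomial \<delta> m k a p"
  shows "degree p = 0"
proof -
  obtain T where T: "deriv_closed_gens k T" "a ` {1..m} \<subseteq> field_adjoin k T"
    by (rule finite_subset_dalg[of "a ` {1..m}" k]) (use a in auto)
  have "\<delta> ` k \<subseteq> field_adjoin k T"
    using differential_subfieldD(2)[OF k] field_adjoin_base[of k T] by blast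
  then have F: "differential_subfield \<delta> (field_adjoin k T)"
    using T(1) by (intro differential_subfield_field_adjoin) (auto simp: deriv_closed_gens_def)
  have "trdeg k (field_adjoin k (jet \<delta> a ` ({1..m} \<times> {0..t}))) \<le> enat (card T)" for t
  proof (rule trdeg_field_adjoin_le[OF differential_subfieldD(1)[OF k]])
    show "finite T" using T(1) by (simp add: deriv_closed_gens_def)
    have "jet \<delta> a ` ({1..m} \<times> {0..t}) \<subseteq> field_adjoin k T"
      using differential_subfield_iter[OF F] T(2) by (auto simp: jet_def)
    then show "field_adjoin k (jet \<delta> a ` ({1..m} \<times> {0..t})) \<subseteq> field_adjoin k T"
      by (intro field_adjoin_least is_subfield_field_adjoin field_adjoin_base)
  qed
  then have "\<forall>\<^sub>F t in sequentially. \<exists>d\<le>card T. poly p (of_nat t) = of_nat (d::nat)"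
    using p unfolding is_kolchin_polynomial_def
    by (elim eventually_mono) (metis enat_ord_simps(1))
  then show ?thesis by (rule degree_eq_0_if_bounded_nat_values)
qed

end

text \<open>Rank is measured over a field of definition; the claim is made for every differential
  field \<open>k\<close> that contains the coefficients and over which \<open>W\<close> is
  closed.\<close>

theorem theorem4p4:
  fixes \<delta> :: "'a::field_char_0 \<Rightarrow> 'a"
    and \<beta> :: "nat \<Rightarrow> nat \<Rightarrow> 'a"
    and h m :: nat
  assumes "derivation \<delta>"
    and "differentially_closed \<delta>"
    and "saturated \<delta>"
    and "h > 1"
    and "m > 1"
    and "independent_differential_transcendentals \<delta> ({0..h} \<times> {1..m}) (\<lambda>(i, j). \<beta> i j)"
  shows "\<forall>k W. differential_subfield \<delta> k \<and> (\<forall>i\<in>{0..h}. \<forall>j\<in>{1..m}. \<beta> i j \<in> k) \<and>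
           kolchin_closed_over \<delta> m k W \<and>
           W \<subset> {z \<in> affine_space m. \<forall>j\<in>{2..m}.
                  (\<Sum>i=0..h. \<beta> i 1 * (\<delta> ^^ i) (z 1)) = (\<Sum>i=0..h. \<beta> i j * (\<delta> ^^ i) (z j))} \<longrightarrow>
           \<not> has_infinite_rank \<delta> m k W"
proof (intro allI impI notI, elim conjE)
  fix k W
  let ?L = "\<lambda>j z. \<Sum>i=0..h. \<beta> i j * (\<delta> ^^ i) z"
  let ?Sol = "{z \<in> affine_space m. \<forall>j\<in>{2..m}. ?L 1 (z 1) = ?L j (z j)}"
  assume k: "differential_subfield \<delta> k" and \<beta>k: "\<forall>i\<in>{0..h}. \<forall>j\<in>{1..m}. \<beta> i j \<in> k"
    and closed: "kolchin_closed_over \<delta> m k W" and W: "W \<subset> ?Sol"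
    and rank: "has_infinite_rank \<delta> m k W"
  interpret differential_field \<delta> by unfold_locales (rule assms(1))
  obtain g where h: "h = Suc g" using assms(4) by (cases h) auto
  let ?V = "{z :: nat \<Rightarrow> 'a. \<forall>j\<in>{1..m}. (\<Sum>i\<le>Suc g. \<beta> i j * (\<delta> ^^ i) (z j)) = (\<Sum>i\<le>Suc g. \<beta> i 1 * (\<delta> ^^ i) (z 1))}"
  have V: "z \<in> ?V" if "z \<in> ?Sol" for z
  proof -
    have "?L j (z j) = ?L 1 (z 1)" if "j \<in> {1..m}" for j
    proof (cases "j = 1")
      case False
      then have "j \<in> {2..m}" using that by simp
      then show ?thesis using \<open>z \<in> ?Sol\<close> by (metis (mono_tags, lifting) mem_Collect_eq)
    qed simp
    then show ?thesis unfolding h atLeast0AtMost by blast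
  qed
  have b: "\<beta> i j \<in> k" if "i \<le> Suc g" "j \<in> {1..m}" for i j using \<beta>k that unfolding h by auto
  have gen: "independent_differential_transcendentals \<delta> ({0..Suc g} \<times> {1..m}) (\<lambda>(i, j). \<beta> i j)"
    using assms(6) unfolding h .
  obtain a p where a: "a \<in> W" and p: "is_kolchin_polynomial \<delta> m k a p" "0 < degree p"
    using rank unfolding has_infinite_rank_def by blast
  have aV: "a \<in> ?V" using a W V by blast
  \<comment> \<open>Otherwise every component of \<open>a\<close> would be differentially algebraic
    and the Kolchin polynomial of \<open>a\<close> constant.\<close>
  have w: "(\<Sum>i\<le>Suc g. \<beta> i 1 * (\<delta> ^^ i) (a 1)) \<notin> dalg k"
  proof
    assume w: "(\<Sum>i\<le>Suc g. \<beta> i 1 * (\<delta> ^^ i) (a 1)) \<in> dalg k"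
    have "a j \<in> dalg k" if j: "j \<in> {1..m}" for j
    proof (rule linear_solution_in_dalg[OF k, of g "\<lambda>i. \<beta> i j"])
      show "\<beta> (Suc g) j \<noteq> 0"
        using independent_differential_transcendentals_nonzero[OF gen, of "(Suc g, j)"] j by simp
      have "(\<Sum>i\<le>Suc g. \<beta> i j * (\<delta> ^^ i) (a j)) = (\<Sum>i\<le>Suc g. \<beta> i 1 * (\<delta> ^^ i) (a 1))"
        using aV j by blast
      then show "(\<Sum>i\<le>Suc g. \<beta> i j * (\<delta> ^^ i) (a j)) \<in> dalg k" using w by simp
    qed (use b j in blast)
    then have "degree p = 0" using kolchin_polynomial_constant_of_dalg[OF k _ p(1)] by blast
    then show False using p(2) by simp
  qed
  obtain S :: "(nat, 'a) dpol set" where S': "\<forall>f\<in>S. pvars f \<subseteq> {1..m} \<times> UNIV \<and> pcoeffs f \<subseteq> k"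
    and WS: "W = {z \<in> affine_space m. \<forall>f\<in>S. dpeval \<delta> f z = 0}"
    using closed unfolding kolchin_closed_over_def by (elim exE conjE)
  have S: "pvars f \<subseteq> {1..m} \<times> UNIV" "pcoeffs f \<subseteq> k" if "f \<in> S" for f using S' that by blast+
  \<comment> \<open>The one point \<open>a\<close> of \<open>W\<close> satisfies every equation in
    \<open>S\<close>, and each of these then holds on all solutions, contrary to properness of
    \<open>W\<close>.\<close>
  have "?Sol \<subseteq> W"
  proof
    fix z assume z: "z \<in> ?Sol"
    have "dpeval \<delta> f z = 0" if "f \<in> S" for f
    proof (rule relation_holds_on_solution_set[OF assms(2) gen k b aV w S(1)[OF that] S(2)[OF that] _ V[OF z]])
      show "dpeval \<delta> f a = 0" using a that unfolding WS by blast
    qed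
    then show "z \<in> W" using z unfolding WS by blast
  qed
  then show False using W by blast
qed

end
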